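(* Let $(\boldsymbol r,\boldsymbol c)\in\boldsymbol{RC}$, with $\boldsymbol r$ and $\boldsymbol c$ of length $t$. Then $B_{\boldsymbol r,\boldsymbol c}$ is a skew-Laurent extension of $B^+_{\boldsymbol r}\otimes B^-_{\boldsymbol c}$ of the form $$B_{\boldsymbol r,\boldsymbol c}=(B^+_{\boldsymbol r}\otimes B^-_{\boldsymbol c})\bigl[(Y_{r_11}\otimes Z_{1c_1})^{\pm1},\dots,(Y_{r_tt}\otimes Z_{tc_t})^{\pm1};\,\eta_1,\dots,\eta_t\bigr]$$ for some $\eta_1,\dots,\eta_t\in H\times H$.
   Context: Let $k$ be an arbitrary field, $n$ a positive integer, $q\in k^\times$ (no further hypothesis on $q$). All tensor products are over $k$, and $\langle\cdots\rangle$ denotes the two-sided ideal generated by the given elements. $A=\mathcal O_q(M_n(k))$ is the $k$-algebra with generators $X_{ij}$ ($1\le i,j\le n$) and relations $X_{ij}X_{lj}=qX_{lj}X_{ij}$ ($i<l$); $X_{ij}X_{im}=qX_{im}X_{ij}$ ($j<m$); $X_{ij}X_{lm}=X_{lm}X_{ij}$ ($i<l$, $j>m$); $X_{ij}X_{lm}-X_{lm}X_{ij}=(q-q^{-1})X_{im}X_{lj}$ ($i<l$, $j<m$). $\boldsymbol{RC}$ is the set of pairs $(\boldsymbol r,\boldsymbol c)$ of strictly increasing sequences $\boldsymbol r=(r_1,\dots,r_t)$, $\boldsymbol c=(c_1,\dots,c_t)$ in $\{1,\dots,n\}$ of the same length $t$ ($0\le t\le n$). Set $R^+_{\boldsymbol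 r,0}=A/\langle X_{ij}\mid j>t\text{ or }i<r_j\rangle$ and $R^-_{\boldsymbol c,0}=A/\langle X_{ij}\mid i>t\text{ or }j<c_i\rangle$, with $Y_{ij}$, $Z_{ij}$ the images of $X_{ij}$ in $R^+_{\boldsymbol r,0}$, $R^-_{\boldsymbol c,0}$ respectively. These are noetherian domains in which the $Y_{r_ss}$, respectively the $Z_{sc_s}$ ($s\le t$), are regular normal elements which commute with each other; set $R^+_{\boldsymbol r}=R^+_{\boldsymbol r,0}[Y_{r_11}^{-1},\dots,Y_{r_tt}^{-1}]$ and $R^-_{\boldsymbol c}=R^-_{\boldsymbol c,0}[Z_{1c_1}^{-1},\dots,Z_{tc_t}^{-1}]$. $B_{\boldsymbol r,\boldsymbol c}$ is the $k$-subalgebra of $R^+_{\boldsymbol r}\otimes R^-_{\boldsymbol c}$ generated by $\{Y_{il}\otimes Z_{lj}\mid l\le t,\ i\ge r_l,\ j\ge c_l\}\cup\{Y_{r_ll}^{-1}\otimes Z_{lc_l}^{-1}\mid l\le t\}$. $B^+_{\boldsymbol r}$ is the $k$-subalgebra of $R^+_{\boldsymbol r}$ generated by $\{Y_{il}Y_{r_ll}^{-1}\mid l\le t,\ i>r_l\}$, and $B^-_{\boldsymbol c}$ is the $k$-subalgebra of $R^-_{\boldsymbol c}$ generated by $\{Z_{lj}Z_{lc_l}^{-1}\mid l\le t,\ j>c_l\}$. The group $H=(k^\times)^n\times(k^\times)^n$ acts on $A$ by $(\alpha_1,\dots,\alpha_n,\beta_1,\dots,\beta_n).X_{ij}=\alpha_i\beta_jX_{ij}$,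 hence on $R^+_{\boldsymbol r}$ and $R^-_{\boldsymbol c}$; $H\times H$ acts on $R^+_{\boldsymbol r}\otimes R^-_{\boldsymbol c}$ factorwise and preserves $B^+_{\boldsymbol r}\otimes B^-_{\boldsymbol c}$. A ring $T$ is a skew-Laurent extension $S[x_1^{\pm1},\dots,x_t^{\pm1};\eta_1,\dots,\eta_t]$ of a subring $S$ if the $x_i$ are pairwise commuting units of $T$, the $\eta_i$ (restrict to) automorphisms of $S$ with $x_is=\eta_i(s)x_i$ for all $s\in S$, and the monomials $x_1^{m_1}\cdots x_t^{m_t}$ ($m_i\in\mathbb Z$) form a basis of $T$ as a left $S$-module. *)

theory Defs
  imports
    "HOL-Library.Poly_Mapping"
    "HOL-Library.FuncSet"
    "HOL-Algebra.Ring"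
    "HOL-Algebra.Module"
    "HOL-Algebra.Ideal"
    "HOL-Algebra.QuotRing"
    "HOL-Algebra.Subrings"
begin

section \<open>Associative algebras over a field\<close>

text \<open>
  The base field is a type \<open>'k\<close> of class \<open>field\<close>. A \<open>'k\<close>-algebra, not necessarily commutative,
  is given by the record type \<open>('k, 'a) module\<close> of HOL-Algebra: a ring record together with a
  scalar multiplication \<open>\<odot>\<close>.
\<close>

definition alg_hom :: "('k::field, 'a) module \<Rightarrow> ('k, 'b) module \<Rightarrow> ('a \<Rightarrow> 'b) set" where
  "alg_hom A B = {f \<in> ring_hom A B. \<forall>c. \<forall>a\<in>carrier A. f (c \<odot>\<^bsub>A\<^esub> a) = c \<odot>\<^bsub>B\<^esub> f a}"

definition alg_aut :: "('k::field, 'a) module \<Rightarrow> ('a \<Rightarrow> 'a) set" where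
  "alg_aut A = {f \<in> alg_hom A A. bij_betw f (carrier A) (carrier A)}"

definition subalg :: "'a set \<Rightarrow> ('k::field, 'a) module \<Rightarrow> bool" where
  "subalg B A \<longleftrightarrow> subring B A \<and> (\<forall>c. \<forall>b\<in>B. c \<odot>\<^bsub>A\<^esub> b \<in> B)"

definition subalg_gen :: "('k::field, 'a) module \<Rightarrow> 'a set \<Rightarrow> 'a set" where
  "subalg_gen A S = \<Inter>{B. subalg B A \<and> S \<subseteq> B}"

text \<open>\<open>quot_alg A J\<close> is the algebra \<open>A / \<langle>J\<rangle>\<close>, and \<open>quot_cls A J\<close> is the canonical map onto it.
  (\<open>Idl\<close> generates two-sided ideals.)\<close>

definition quot_cls :: "('k::field, 'a) module \<Rightarrow> 'a set \<Rightarrow> 'a \<Rightarrow> 'a set" where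
  "quot_cls A J a = (Idl\<^bsub>A\<^esub> J) +>\<^bsub>A\<^esub> a"

definition quot_alg :: "('k::field, 'a) module \<Rightarrow> 'a set \<Rightarrow> ('k, 'a set) module" where
  "quot_alg A J = (let Q = A Quot (Idl\<^bsub>A\<^esub> J) in
     \<lparr>carrier = carrier Q, mult = mult Q, one = one Q, zero = zero Q, add = add Q,
      smult = (\<lambda>c U. \<Union>a\<in>U. quot_cls A J (c \<odot>\<^bsub>A\<^esub> a))\<rparr>)"

definition monoid_algebra :: "('m, 'z) monoid_scheme \<Rightarrow> ('k::field, 'm \<Rightarrow>\<^sub>0 'k) module" where
  "monoid_algebra M =
     \<lparr>carrier = {f. Poly_Mapping.keys f \<subseteq> carrier M},
      mult = (\<lambda>f g. \<Sum>x\<in>Poly_Mapping.keys f. \<Sum>y\<in>Poly_Mapping.keys g.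
                Poly_Mapping.single (x \<otimes>\<^bsub>M\<^esub> y) (Poly_Mapping.lookup f x * Poly_Mapping.lookup g y)),
      one = Poly_Mapping.single \<one>\<^bsub>M\<^esub> 1,
      zero = 0,
      add = (+),
      smult = (\<lambda>c. Poly_Mapping.map ((*) c))\<rparr>"

definition free_monoid :: "'x set \<Rightarrow> 'x list monoid" where
  "free_monoid V = \<lparr>carrier = lists V, mult = (@), one = []\<rparr>"

definition free_alg :: "'x set \<Rightarrow> ('k::field, 'x list \<Rightarrow>\<^sub>0 'k) module" where
  "free_alg V = monoid_algebra (free_monoid V)"

subsection \<open>Inverting elements\<close>

text \<open>
  The algebra \<open>A[s\<^sup>-\<^sup>1 | s \<in> S]\<close> obtained from \<open>A\<close> by adjoining two-sided inverses of the elements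
  of \<open>S\<close>: the generators are \<open>Inl a\<close> for the elements \<open>a\<close> of \<open>A\<close> and \<open>Inr s\<close> for the formal
  inverses; the relations say that \<open>Inl\<close> is a unital algebra homomorphism and that \<open>Inr s\<close> is
  inverse to \<open>Inl s\<close>. It is the universal algebra over \<open>A\<close> in which the elements of \<open>S\<close> become
  invertible; when \<open>S\<close> consists of commuting regular normal elements, this is the Ore
  localization (ring of fractions) at the multiplicative set generated by \<open>S\<close>.
\<close>

definition loc_rels :: "('k::field, 'a) module \<Rightarrow> 'a set \<Rightarrow> (('a + 'a) list \<Rightarrow>\<^sub>0 'k) set" where
  "loc_rels A S =
     {Poly_Mapping.single [Inl (a \<oplus>\<^bsub>A\<^esub> b)] 1 - Poly_Mapping.single [Inl a] 1
        - Poly_Mapping.single [Inl b] 1 | a b. a \<in> carrier A \<and> b \<in> carrier A} \<union>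
     {Poly_Mapping.single [Inl (a \<otimes>\<^bsub>A\<^esub> b)] 1 - Poly_Mapping.single [Inl a, Inl b] 1
        | a b. a \<in> carrier A \<and> b \<in> carrier A} \<union>
     {Poly_Mapping.single [Inl (u \<odot>\<^bsub>A\<^esub> a)] 1 - Poly_Mapping.single [Inl a] u
        | u a. a \<in> carrier A} \<union>
     {Poly_Mapping.single [Inl \<one>\<^bsub>A\<^esub>] 1 - Poly_Mapping.single [] 1} \<union>
     {Poly_Mapping.single [Inl s, Inr s] 1 - Poly_Mapping.single [] 1 | s. s \<in> S} \<union>
     {Poly_Mapping.single [Inr s, Inl s] 1 - Poly_Mapping.single [] 1 | s. s \<in> S}"

definition loc :: "('k::field, 'a) module \<Rightarrow> 'a set \<Rightarrow> ('k, (('a + 'a) list \<Rightarrow>\<^sub>0 'k) set) module" where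
  "loc A S = quot_alg (free_alg (carrier A <+> S)) (loc_rels A S)"

definition to_loc :: "('k::field, 'a) module \<Rightarrow> 'a set \<Rightarrow> 'a \<Rightarrow> (('a + 'a) list \<Rightarrow>\<^sub>0 'k) set" where
  "to_loc A S a = quot_cls (free_alg (carrier A <+> S)) (loc_rels A S) (Poly_Mapping.single [Inl a] 1)"

subsection \<open>Tensor products\<close>

text \<open>
  The free \<open>'k\<close>-module on \<open>A \<times> B\<close> modulo the bilinearity relations, with multiplication
  \<open>(a \<otimes> b)(a' \<otimes> b') = aa' \<otimes> bb'\<close>; i.e. the monoid algebra of the multiplicative monoid \<open>A \<times> B\<close>
  modulo these relations, whose linear span is already a two-sided ideal.
\<close>

definition tensor_rels :: "('k::field, 'a) module \<Rightarrow> ('k, 'b) module \<Rightarrow> ('a \<times> 'b \<Rightarrow>\<^sub>0 'k) set" where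
  "tensor_rels A B =
     {Poly_Mapping.single (a \<oplus>\<^bsub>A\<^esub> a', b) 1 - Poly_Mapping.single (a, b) 1
        - Poly_Mapping.single (a', b) 1
        | a a' b. a \<in> carrier A \<and> a' \<in> carrier A \<and> b \<in> carrier B} \<union>
     {Poly_Mapping.single (a, b \<oplus>\<^bsub>B\<^esub> b') 1 - Poly_Mapping.single (a, b) 1
        - Poly_Mapping.single (a, b') 1
        | a b b'. a \<in> carrier A \<and> b \<in> carrier B \<and> b' \<in> carrier B} \<union>
     {Poly_Mapping.single (u \<odot>\<^bsub>A\<^esub> a, b) 1 - Poly_Mapping.single (a, b) u
        | u a b. a \<in> carrier A \<and> b \<in> carrier B} \<union>
     {Poly_Mapping.single (a, u \<odot>\<^bsub>B\<^esub> b) 1 - Poly_Mapping.single (a, b) u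
        | u a b. a \<in> carrier A \<and> b \<in> carrier B}"

definition tensor_alg ::
    "('k::field, 'a) module \<Rightarrow> ('k, 'b) module \<Rightarrow> ('k, ('a \<times> 'b \<Rightarrow>\<^sub>0 'k) set) module" where
  "tensor_alg A B = quot_alg (monoid_algebra (A \<times>\<times> B)) (tensor_rels A B)"

definition pure_tensor ::
    "('k::field, 'a) module \<Rightarrow> ('k, 'b) module \<Rightarrow> 'a \<Rightarrow> 'b \<Rightarrow> ('a \<times> 'b \<Rightarrow>\<^sub>0 'k) set" where
  "pure_tensor A B a b =
     quot_cls (monoid_algebra (A \<times>\<times> B)) (tensor_rels A B) (Poly_Mapping.single (a, b) 1)"

text \<open>For subspaces \<open>U \<subseteq> A\<close> and \<open>V \<subseteq> B\<close>, the subspace \<open>U \<otimes> V\<close> of \<open>A \<otimes> B\<close> (the image of the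
  canonical map from the tensor product of \<open>U\<close> and \<open>V\<close>, which is injective over a field).\<close>

definition tensor_sub ::
    "('k::field, 'a) module \<Rightarrow> ('k, 'b) module \<Rightarrow> 'a set \<Rightarrow> 'b set \<Rightarrow> ('a \<times> 'b \<Rightarrow>\<^sub>0 'k) set set" where
  "tensor_sub A B U V =
     {quot_cls (monoid_algebra (A \<times>\<times> B)) (tensor_rels A B) f | f. Poly_Mapping.keys f \<subseteq> U \<times> V}"

section \<open>Skew-Laurent extensions\<close>

definition left_basis :: "('a, 'z) ring_scheme \<Rightarrow> 'a set \<Rightarrow> 'i set \<Rightarrow> ('i \<Rightarrow> 'a) \<Rightarrow> bool" where
  "left_basis T S E e \<longleftrightarrow>
     e \<in> E \<rightarrow> carrier T \<and>
     (\<forall>b\<in>carrier T. \<exists>F a. finite F \<and> F \<subseteq> E \<and> a \<in> F \<rightarrow> S \<and> b = (\<Oplus>\<^bsub>T\<^esub>i\<in>F. a i \<otimes>\<^bsub>T\<^esub> e i)) \<and>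
     (\<forall>F a. finite F \<longrightarrow> F \<subseteq> E \<longrightarrow> a \<in> F \<rightarrow> S \<longrightarrow> (\<Oplus>\<^bsub>T\<^esub>i\<in>F. a i \<otimes>\<^bsub>T\<^esub> e i) = \<zero>\<^bsub>T\<^esub>
        \<longrightarrow> (\<forall>i\<in>F. a i = \<zero>\<^bsub>T\<^esub>))"

definition laurent_monom :: "('a, 'z) ring_scheme \<Rightarrow> nat \<Rightarrow> (nat \<Rightarrow> 'a) \<Rightarrow> (nat \<Rightarrow> int) \<Rightarrow> 'a" where
  "laurent_monom T t x m = foldr (\<lambda>i p. x i [^]\<^bsub>T\<^esub> m i \<otimes>\<^bsub>T\<^esub> p) [1..<Suc t] \<one>\<^bsub>T\<^esub>"

definition skew_laurent ::
    "('a, 'z) ring_scheme \<Rightarrow> 'a set \<Rightarrow> nat \<Rightarrow> (nat \<Rightarrow> 'a) \<Rightarrow> (nat \<Rightarrow> 'a \<Rightarrow> 'a) \<Rightarrow> bool" where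
  "skew_laurent T S t x \<eta> \<longleftrightarrow>
     ring T \<and> subring S T \<and>
     (\<forall>i\<in>{1..t}. x i \<in> Units T) \<and>
     (\<forall>i\<in>{1..t}. \<forall>j\<in>{1..t}. x i \<otimes>\<^bsub>T\<^esub> x j = x j \<otimes>\<^bsub>T\<^esub> x i) \<and>
     (\<forall>i\<in>{1..t}. \<eta> i \<in> ring_iso (T\<lparr>carrier := S\<rparr>) (T\<lparr>carrier := S\<rparr>)) \<and>
     (\<forall>i\<in>{1..t}. \<forall>s\<in>S. x i \<otimes>\<^bsub>T\<^esub> s = \<eta> i s \<otimes>\<^bsub>T\<^esub> x i) \<and>
     left_basis T S ({1..t} \<rightarrow>\<^sub>E UNIV) (laurent_monom T t x)"

section \<open>Quantum matrices and the algebras attached to a pair of index sequences\<close>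

definition qmat_rels :: "nat \<Rightarrow> 'k::field \<Rightarrow> ((nat \<times> nat) list \<Rightarrow>\<^sub>0 'k) set" where
  "qmat_rels n q =
     {Poly_Mapping.single [(i,j), (l,j)] 1 - Poly_Mapping.single [(l,j), (i,j)] q
        | i j l. {i,j,l} \<subseteq> {1..n} \<and> i < l} \<union>
     {Poly_Mapping.single [(i,j), (i,m)] 1 - Poly_Mapping.single [(i,m), (i,j)] q
        | i j m. {i,j,m} \<subseteq> {1..n} \<and> j < m} \<union>
     {Poly_Mapping.single [(i,j), (l,m)] 1 - Poly_Mapping.single [(l,m), (i,j)] 1
        | i j l m. {i,j,l,m} \<subseteq> {1..n} \<and> i < l \<and> j > m} \<union>
     {Poly_Mapping.single [(i,j), (l,m)] 1 - Poly_Mapping.single [(l,m), (i,j)] 1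
        - Poly_Mapping.single [(i,m), (l,j)] (q - inverse q)
        | i j l m. {i,j,l,m} \<subseteq> {1..n} \<and> i < l \<and> j < m}"

type_synonym 'k qm = "((nat \<times> nat) list \<Rightarrow>\<^sub>0 'k) set"
type_synonym 'k qm0 = "'k qm set"
type_synonym 'k qml = "(('k qm0 + 'k qm0) list \<Rightarrow>\<^sub>0 'k) set"

definition qmat :: "nat \<Rightarrow> 'k::field \<Rightarrow> ('k, 'k qm) module" where
  "qmat n q = quot_alg (free_alg ({1..n} \<times> {1..n})) (qmat_rels n q)"

definition X :: "nat \<Rightarrow> 'k::field \<Rightarrow> nat \<Rightarrow> nat \<Rightarrow> 'k qm" where
  "X n q i j = quot_cls (free_alg ({1..n} \<times> {1..n})) (qmat_rels n q) (Poly_Mapping.single [(i,j)] 1)"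

text \<open>Sequences are lists, and \<open>ent r j\<close> is the entry \<open>r\<^sub>j\<close>, with \<open>j\<close> counted from 1.\<close>

definition RC :: "nat \<Rightarrow> (nat list \<times> nat list) set" where
  "RC n = {(r, c). sorted_wrt (<) r \<and> sorted_wrt (<) c \<and> set r \<subseteq> {1..n} \<and> set c \<subseteq> {1..n}
                   \<and> length r = length c}"

definition ent :: "nat list \<Rightarrow> nat \<Rightarrow> nat" where
  "ent r j = r ! (j - 1)"

definition Jp :: "nat \<Rightarrow> 'k::field \<Rightarrow> nat list \<Rightarrow> 'k qm set" where
  "Jp n q r = {X n q i j | i j. i \<in> {1..n} \<and> j \<in> {1..n} \<and> (j > length r \<or> i < ent r j)}"

definition Jm :: "nat \<Rightarrow> 'k::field \<Rightarrow> nat list \<Rightarrow> 'k qm set" where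
  "Jm n q c = {X n q i j | i j. i \<in> {1..n} \<and> j \<in> {1..n} \<and> (i > length c \<or> j < ent c i)}"

definition Rp0 :: "nat \<Rightarrow> 'k::field \<Rightarrow> nat list \<Rightarrow> ('k, 'k qm0) module" where
  "Rp0 n q r = quot_alg (qmat n q) (Jp n q r)"

definition Rm0 :: "nat \<Rightarrow> 'k::field \<Rightarrow> nat list \<Rightarrow> ('k, 'k qm0) module" where
  "Rm0 n q c = quot_alg (qmat n q) (Jm n q c)"

definition Y0 :: "nat \<Rightarrow> 'k::field \<Rightarrow> nat list \<Rightarrow> nat \<Rightarrow> nat \<Rightarrow> 'k qm0" where
  "Y0 n q r i j = quot_cls (qmat n q) (Jp n q r) (X n q i j)"

definition Z0 :: "nat \<Rightarrow> 'k::field \<Rightarrow> nat list \<Rightarrow> nat \<Rightarrow> nat \<Rightarrow> 'k qm0" where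
  "Z0 n q c i j = quot_cls (qmat n q) (Jm n q c) (X n q i j)"

definition Sp :: "nat \<Rightarrow> 'k::field \<Rightarrow> nat list \<Rightarrow> 'k qm0 set" where
  "Sp n q r = {Y0 n q r (ent r s) s | s. s \<in> {1..length r}}"

definition Sm :: "nat \<Rightarrow> 'k::field \<Rightarrow> nat list \<Rightarrow> 'k qm0 set" where
  "Sm n q c = {Z0 n q c s (ent c s) | s. s \<in> {1..length c}}"

definition Rp :: "nat \<Rightarrow> 'k::field \<Rightarrow> nat list \<Rightarrow> ('k, 'k qml) module" where
  "Rp n q r = loc (Rp0 n q r) (Sp n q r)"

definition Rm :: "nat \<Rightarrow> 'k::field \<Rightarrow> nat list \<Rightarrow> ('k, 'k qml) module" where
  "Rm n q c = loc (Rm0 n q c) (Sm n q c)"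

definition Y :: "nat \<Rightarrow> 'k::field \<Rightarrow> nat list \<Rightarrow> nat \<Rightarrow> nat \<Rightarrow> 'k qml" where
  "Y n q r i j = to_loc (Rp0 n q r) (Sp n q r) (Y0 n q r i j)"

definition Z :: "nat \<Rightarrow> 'k::field \<Rightarrow> nat list \<Rightarrow> nat \<Rightarrow> nat \<Rightarrow> 'k qml" where
  "Z n q c i j = to_loc (Rm0 n q c) (Sm n q c) (Z0 n q c i j)"

definition Bp :: "nat \<Rightarrow> 'k::field \<Rightarrow> nat list \<Rightarrow> 'k qml set" where
  "Bp n q r = subalg_gen (Rp n q r)
     {Y n q r i l \<otimes>\<^bsub>Rp n q r\<^esub> inv\<^bsub>Rp n q r\<^esub> (Y n q r (ent r l) l)
        | i l. l \<in> {1..length r} \<and> i \<in> {1..n} \<and> i > ent r l}"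

definition Bm :: "nat \<Rightarrow> 'k::field \<Rightarrow> nat list \<Rightarrow> 'k qml set" where
  "Bm n q c = subalg_gen (Rm n q c)
     {Z n q c l j \<otimes>\<^bsub>Rm n q c\<^esub> inv\<^bsub>Rm n q c\<^esub> (Z n q c l (ent c l))
        | j l. l \<in> {1..length c} \<and> j \<in> {1..n} \<and> j > ent c l}"

abbreviation RR :: "nat \<Rightarrow> 'k::field \<Rightarrow> nat list \<Rightarrow> nat list \<Rightarrow>
    ('k, ('k qml \<times> 'k qml \<Rightarrow>\<^sub>0 'k) set) module" where
  "RR n q r c \<equiv> tensor_alg (Rp n q r) (Rm n q c)"

abbreviation RR_tensor :: "nat \<Rightarrow> 'k::field \<Rightarrow> nat list \<Rightarrow> nat list \<Rightarrow>
    'k qml \<Rightarrow> 'k qml \<Rightarrow> ('k qml \<times> 'k qml \<Rightarrow>\<^sub>0 'k) set" where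
  "RR_tensor n q r c \<equiv> pure_tensor (Rp n q r) (Rm n q c)"

definition B :: "nat \<Rightarrow> 'k::field \<Rightarrow> nat list \<Rightarrow> nat list \<Rightarrow> ('k qml \<times> 'k qml \<Rightarrow>\<^sub>0 'k) set set" where
  "B n q r c = subalg_gen (RR n q r c)
     ({RR_tensor n q r c (Y n q r i l) (Z n q c l j)
         | i j l. l \<in> {1..length r} \<and> i \<in> {1..n} \<and> j \<in> {1..n} \<and> i \<ge> ent r l \<and> j \<ge> ent c l} \<union>
      {RR_tensor n q r c (inv\<^bsub>Rp n q r\<^esub> (Y n q r (ent r l) l)) (inv\<^bsub>Rm n q c\<^esub> (Z n q c l (ent c l)))
         | l. l \<in> {1..length r}})"

subsection \<open>The torus action\<close>

definition torus :: "nat \<Rightarrow> ((nat \<Rightarrow> 'k::field) \<times> (nat \<Rightarrow> 'k)) set" where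
  "torus n = ({1..n} \<rightarrow>\<^sub>E (UNIV - {0})) \<times> ({1..n} \<rightarrow>\<^sub>E (UNIV - {0}))"

text \<open>
  \<open>torus_acts n R x h \<sigma>\<close>: the element \<open>h\<close> of the torus acts on \<open>R\<close> as \<open>\<sigma>\<close>, where \<open>x i j\<close> is the
  image of \<open>X\<^sub>i\<^sub>j\<close> in \<open>R\<close>. On a quotient or localization of the quantum matrix algebra, \<open>\<sigma>\<close> is
  determined on the carrier by these conditions; similarly for \<open>HH_acts\<close> below, the factorwise
  action of a pair of torus elements on the tensor product.
\<close>

definition torus_acts :: "nat \<Rightarrow> ('k::field, 'a) module \<Rightarrow> (nat \<Rightarrow> nat \<Rightarrow> 'a) \<Rightarrow>
    (nat \<Rightarrow> 'k) \<times> (nat \<Rightarrow> 'k) \<Rightarrow> ('a \<Rightarrow> 'a) \<Rightarrow> bool" where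
  "torus_acts n R x h \<sigma> \<longleftrightarrow> \<sigma> \<in> alg_aut R \<and>
     (\<forall>i\<in>{1..n}. \<forall>j\<in>{1..n}. \<sigma> (x i j) = (fst h i * snd h j) \<odot>\<^bsub>R\<^esub> x i j)"

definition HH_acts :: "nat \<Rightarrow> 'k::field \<Rightarrow> nat list \<Rightarrow> nat list \<Rightarrow>
    ((nat \<Rightarrow> 'k) \<times> (nat \<Rightarrow> 'k)) \<times> ((nat \<Rightarrow> 'k) \<times> (nat \<Rightarrow> 'k)) \<Rightarrow>
    (('k qml \<times> 'k qml \<Rightarrow>\<^sub>0 'k) set \<Rightarrow> ('k qml \<times> 'k qml \<Rightarrow>\<^sub>0 'k) set) \<Rightarrow> bool" where
  "HH_acts n q r c h \<eta> \<longleftrightarrow> \<eta> \<in> alg_aut (RR n q r c) \<and>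
     (\<exists>\<sigma> \<tau>. torus_acts n (Rp n q r) (Y n q r) (fst h) \<sigma> \<and>
            torus_acts n (Rm n q c) (Z n q c) (snd h) \<tau> \<and>
            (\<forall>a\<in>carrier (Rp n q r). \<forall>b\<in>carrier (Rm n q c).
               \<eta> (RR_tensor n q r c a b) = RR_tensor n q r c (\<sigma> a) (\<tau> b)))"

end

theory Submission
  imports Defs "HOL-Library.Function_Algebras"
begin

text \<open>
  Only two facts about quantum matrices matter. First, conjugation by the pivot \<open>Y\<^bsub>r\<^sub>l,l\<^esub>\<close> rescales every
  \<open>Y\<^sub>i\<^sub>j\<close> as a torus element does, because the correction term in the fourth relation always contains
  a generator that vanishes in the quotient; so \<open>\<eta>\<^sub>l\<close> can be taken to be conjugation by
  \<open>Y\<^bsub>r\<^sub>l,l\<^esub> \<otimes> Z\<^bsub>l,c\<^sub>l\<^esub>\<close>, and pulling the pivots to the right shows that the monomials span. Second, the relations are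
  homogeneous for the grading by columns of the first tensor factor. The subalgebra
  \<open>B\<^sup>+ \<otimes> B\<^sup>-\<close> has degree 0 and the monomial with exponent \<open>m\<close> is a unit of degree \<open>m\<close>, whence
  linear independence; neither a PBW basis nor the domain property is needed. The grading comes from a
  homomorphism into endomorphisms of the space of families in \<open>R\<^sup>+ \<otimes> R\<^sup>-\<close> indexed by the degrees: a homogeneous
  element acts by left multiplication followed by the shift by its degree.
\<close>

text \<open>The algebras are given by presentations and are reached only through homomorphisms out
  of them, so linear independence has to be read off in some target. The natural one is the group
  algebra of the degree group over \<open>R+ (x) R-\<close>. Sums of shift operators form a copy of
  it inside an endomorphism algebra, whose ring axioms are those of composition, without convolution
  sums. An operator is evaluated at the family that is 1 in degree 0 and 0 elsewhere: a homogeneous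
  element reappears there, alone, in its own degree, so that elements of different degrees cannot
  cancel.

  Only the columns of the first factor are recorded. A generator \<open>Y_il (x) Z_lj\<close> then
  has the same degree as the pivot product with index \<open>l\<close>, namely the
  \<open>l\<close>-th unit vector, and the second factor sits in degree 0. To combine the two
  factors into one homomorphism their images must commute; the values on the first factor are
  therefore taken in the centralizer of the image of the second. The commutation rules for the
  second factor come from those for the first through the transpose symmetry of the
  relations.\<close>

locale kalg = ring A for A :: "('k::field, 'a) module" (structure) +
  assumes smult_closed [simp, intro]: "a \<in> carrier A \<Longrightarrow> c \<odot> a \<in> carrier A"
    and smult_l_distr: "a \<in> carrier A \<Longrightarrow> (c + d) \<odot> a = c \<odot> a \<oplus> d \<odot> a"
    and smult_r_distr: "a \<in> carrier A \<Longrightarrow> b \<in> carrier A \<Longrightarrow> c \<odot> (a \<oplus> b) = c \<odot> a \<oplus> c \<odot> b"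
    and smult_smult: "a \<in> carrier A \<Longrightarrow> c \<odot> (d \<odot> a) = (c * d) \<odot> a"
    and smult_one [simp]: "a \<in> carrier A \<Longrightarrow> 1 \<odot> a = a"
    and smult_mult_l: "a \<in> carrier A \<Longrightarrow> b \<in> carrier A \<Longrightarrow> (c \<odot> a) \<otimes> b = c \<odot> (a \<otimes> b)"
    and smult_mult_r: "a \<in> carrier A \<Longrightarrow> b \<in> carrier A \<Longrightarrow> a \<otimes> (c \<odot> b) = c \<odot> (a \<otimes> b)"
begin

lemma smult_zero_l [simp]: "a \<in> carrier A \<Longrightarrow> 0 \<odot> a = \<zero>"
  using smult_l_distr[of a 0 0] by (simp add: add.r_cancel_one')

lemma smult_zero_r [simp]: "c \<odot> \<zero> = \<zero>"
  using smult_r_distr[of \<zero> \<zero> c] by (simp add: add.r_cancel_one')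

lemma smult_minus_l: "a \<in> carrier A \<Longrightarrow> (- c) \<odot> a = \<ominus> (c \<odot> a)"
  using smult_l_distr[of a "-c" c] by (simp add: minus_equality[symmetric])

lemma smult_minus_one: "a \<in> carrier A \<Longrightarrow> (- 1) \<odot> a = \<ominus> a"
  by (simp add: smult_minus_l)

lemma smult_eq_mult: "a \<in> carrier A \<Longrightarrow> c \<odot> a = (c \<odot> \<one>) \<otimes> a"
  by (simp add: smult_mult_l)

lemma smult_left_cancel: "a \<in> carrier A \<Longrightarrow> c \<noteq> 0 \<Longrightarrow> inverse c \<odot> (c \<odot> a) = a"
  by (simp add: smult_smult)

section \<open>Subalgebras and generation\<close>

lemma subalg_carrier: "subalg (carrier A) A"
  by (simp add: subalg_def carrier_is_subring)

lemma subalg_ring_closed: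
  assumes "subalg S A"
  shows "S \<subseteq> carrier A" "\<zero> \<in> S" "\<one> \<in> S" "a \<in> S \<Longrightarrow> b \<in> S \<Longrightarrow> a \<oplus> b \<in> S"
    "a \<in> S \<Longrightarrow> b \<in> S \<Longrightarrow> a \<otimes> b \<in> S" "a \<in> S \<Longrightarrow> \<ominus> a \<in> S" "a \<in> S \<Longrightarrow> c \<odot> a \<in> S"
    "a \<in> S \<Longrightarrow> b \<in> S \<Longrightarrow> a \<ominus> b \<in> S"
proof -
  have "subring S A" and s: "\<forall>c. \<forall>b\<in>S. c \<odot> b \<in> S" using assms by (auto simp: subalg_def)
  note r = subringE[OF this(1)]
  show "S \<subseteq> carrier A" "\<zero> \<in> S" "\<one> \<in> S" "a \<in> S \<Longrightarrow> b \<in> S \<Longrightarrow> a \<oplus> b \<in> S"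
    "a \<in> S \<Longrightarrow> b \<in> S \<Longrightarrow> a \<otimes> b \<in> S" "a \<in> S \<Longrightarrow> \<ominus> a \<in> S" "a \<in> S \<Longrightarrow> c \<odot> a \<in> S"
    using r s by simp_all
  show "a \<in> S \<Longrightarrow> b \<in> S \<Longrightarrow> a \<ominus> b \<in> S"
    using r by (simp add: a_minus_def)
qed

lemma subalgI:
  assumes "S \<subseteq> carrier A" "\<one> \<in> S" "\<And>a b. a \<in> S \<Longrightarrow> b \<in> S \<Longrightarrow> a \<oplus> b \<in> S"
    "\<And>a b. a \<in> S \<Longrightarrow> b \<in> S \<Longrightarrow> a \<otimes> b \<in> S" "\<And>a c. a \<in> S \<Longrightarrow> c \<odot> a \<in> S"
  shows "subalg S A"
proof -
  have "\<ominus> a \<in> S" if "a \<in> S" for a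
    using that assms(1) assms(5)[of a "-1"] smult_minus_one[of a] by auto
  then show ?thesis using assms unfolding subalg_def by (auto intro!: subringI)
qed

lemma subalg_gen_subset:
  "subalg S A \<Longrightarrow> G \<subseteq> S \<Longrightarrow> subalg_gen A G \<subseteq> S"
  unfolding subalg_gen_def by auto

lemma subalg_gen_incl: "G \<subseteq> subalg_gen A G"
  unfolding subalg_gen_def by auto

lemma subalg_subalg_gen:
  assumes "G \<subseteq> carrier A"
  shows "subalg (subalg_gen A G) A"
proof -
  let ?F = "{S. subalg S A \<and> G \<subseteq> S}"
  \<comment> \<open>The family must have a member inside the carrier: an empty intersection would be
    the whole type.\<close>
  have ne: "carrier A \<in> ?F" using assms subalg_carrier by auto
  show ?thesis
    unfolding subalg_gen_def
  proof (rule subalgI)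
    show "\<Inter>?F \<subseteq> carrier A" using ne by blast
  qed (auto dest: subalg_ring_closed)
qed

text \<open>Turns commutation on generators into commutation everywhere: a homomorphism obtained
  from a universal property with values in a centralizer commutes with \<open>G\<close> by
  construction, without an induction over its source.\<close>

lemma subalg_centralizer: "subalg {a \<in> carrier A. \<forall>b\<in>G \<inter> carrier A. a \<otimes> b = b \<otimes> a} A"
proof (rule subalgI)
  fix a b assume *: "a \<in> {a \<in> carrier A. \<forall>b\<in>G \<inter> carrier A. a \<otimes> b = b \<otimes> a}"
    "b \<in> {a \<in> carrier A. \<forall>b\<in>G \<inter> carrier A. a \<otimes> b = b \<otimes> a}"
  show "a \<oplus> b \<in> {a \<in> carrier A. \<forall>b\<in>G \<inter> carrier A. a \<otimes> b = b \<otimes> a}"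
    using * by (auto simp: l_distr r_distr)
  show "a \<otimes> b \<in> {a \<in> carrier A. \<forall>b\<in>G \<inter> carrier A. a \<otimes> b = b \<otimes> a}"
  proof (clarsimp, intro conjI ballI)
    show "a \<otimes> b \<in> carrier A" using * by auto
    fix g assume g: "g \<in> G \<inter> carrier A"
    have "a \<otimes> b \<otimes> g = a \<otimes> (g \<otimes> b)" using * g by (auto simp: m_assoc)
    also have "\<dots> = (a \<otimes> g) \<otimes> b" using * g by (intro m_assoc[symmetric]) auto
    also have "\<dots> = (g \<otimes> a) \<otimes> b" using * g by auto
    also have "\<dots> = g \<otimes> (a \<otimes> b)" using * g by (auto simp: m_assoc)
    finally show "a \<otimes> b \<otimes> g = g \<otimes> (a \<otimes> b)" .
  qed
qed (auto simp: smult_mult_l smult_mult_r)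

lemma kalg_subalg:
  assumes "subalg S A"
  shows "kalg (A\<lparr>carrier := S\<rparr>)"
proof -
  have "S \<subseteq> carrier A" using subalg_ring_closed[OF assms] by auto
  interpret S: ring "A\<lparr>carrier := S\<rparr>"
    using assms by (simp add: subalg_def subring_is_ring)
  show ?thesis
    using subalg_ring_closed[OF assms]
    by unfold_locales
      (auto simp: smult_l_distr smult_r_distr smult_smult smult_mult_l smult_mult_r subset_iff)
qed

end

lemma kalgI:
  fixes A :: "('k::field, 'a) module" (structure)
  assumes "abelian_group A" "monoid A"
    and "\<And>a b c. a \<in> carrier A \<Longrightarrow> b \<in> carrier A \<Longrightarrow> c \<in> carrier A \<Longrightarrow> (a \<oplus> b) \<otimes> c = a \<otimes> c \<oplus> b \<otimes> c"
    and "\<And>a b c. a \<in> carrier A \<Longrightarrow> b \<in> carrier A \<Longrightarrow> c \<in> carrier A \<Longrightarrow> c \<otimes> (a \<oplus> b) = c \<otimes> a \<oplus> c \<otimes> b"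
    and "\<And>a c. a \<in> carrier A \<Longrightarrow> c \<odot> a \<in> carrier A"
    and "\<And>a c d. a \<in> carrier A \<Longrightarrow> (c + d) \<odot> a = c \<odot> a \<oplus> d \<odot> a"
    and "\<And>a b c. a \<in> carrier A \<Longrightarrow> b \<in> carrier A \<Longrightarrow> c \<odot> (a \<oplus> b) = c \<odot> a \<oplus> c \<odot> b"
    and "\<And>a c d. a \<in> carrier A \<Longrightarrow> c \<odot> (d \<odot> a) = (c * d) \<odot> a"
    and "\<And>a. a \<in> carrier A \<Longrightarrow> 1 \<odot> a = a"
    and "\<And>a b c. a \<in> carrier A \<Longrightarrow> b \<in> carrier A \<Longrightarrow> (c \<odot> a) \<otimes> b = c \<odot> (a \<otimes> b)"
    and "\<And>a b c. a \<in> carrier A \<Longrightarrow> b \<in> carrier A \<Longrightarrow> a \<otimes> (c \<odot> b) = c \<odot> (a \<otimes> b)"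
  shows "kalg A"
proof -
  interpret ring A
    using assms(1-4) by (intro ringI)
  show ?thesis using assms(5-) by unfold_locales auto
qed

section \<open>Homomorphisms of algebras\<close>

lemma alg_homI:
  assumes "\<And>a. a \<in> carrier A \<Longrightarrow> f a \<in> carrier T"
    and "\<And>a b. a \<in> carrier A \<Longrightarrow> b \<in> carrier A \<Longrightarrow> f (a \<otimes>\<^bsub>A\<^esub> b) = f a \<otimes>\<^bsub>T\<^esub> f b"
    and "\<And>a b. a \<in> carrier A \<Longrightarrow> b \<in> carrier A \<Longrightarrow> f (a \<oplus>\<^bsub>A\<^esub> b) = f a \<oplus>\<^bsub>T\<^esub> f b"
    and "f \<one>\<^bsub>A\<^esub> = \<one>\<^bsub>T\<^esub>"
    and "\<And>a c. a \<in> carrier A \<Longrightarrow> f (c \<odot>\<^bsub>A\<^esub> a) = c \<odot>\<^bsub>T\<^esub> f a"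
  shows "f \<in> alg_hom A T"
  using assms unfolding alg_hom_def by (auto intro!: ring_hom_memI)

lemma alg_homD:
  assumes "f \<in> alg_hom A T"
  shows "a \<in> carrier A \<Longrightarrow> f a \<in> carrier T"
    "a \<in> carrier A \<Longrightarrow> b \<in> carrier A \<Longrightarrow> f (a \<otimes>\<^bsub>A\<^esub> b) = f a \<otimes>\<^bsub>T\<^esub> f b"
    "a \<in> carrier A \<Longrightarrow> b \<in> carrier A \<Longrightarrow> f (a \<oplus>\<^bsub>A\<^esub> b) = f a \<oplus>\<^bsub>T\<^esub> f b"
    "f \<one>\<^bsub>A\<^esub> = \<one>\<^bsub>T\<^esub>"
    "a \<in> carrier A \<Longrightarrow> f (c \<odot>\<^bsub>A\<^esub> a) = c \<odot>\<^bsub>T\<^esub> f a"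
  using assms unfolding alg_hom_def
  by (auto simp: ring_hom_closed ring_hom_mult ring_hom_add ring_hom_one)

lemma alg_hom_comp:
  "f \<in> alg_hom A T \<Longrightarrow> g \<in> alg_hom T T' \<Longrightarrow> (\<lambda>a. g (f a)) \<in> alg_hom A T'"
  by (rule alg_homI) (auto simp: alg_homD)

lemma alg_hom_carrier_update:
  "f \<in> alg_hom A (T\<lparr>carrier := C\<rparr>) \<Longrightarrow> C \<subseteq> carrier T \<Longrightarrow> f \<in> alg_hom A T"
  by (rule alg_homI) (use alg_homD[of f A "T\<lparr>carrier := C\<rparr>"] in auto)

locale alg_hom_pair = A: kalg A + T: kalg T
  for A :: "('k::field, 'a) module" and T :: "('k, 'b) module" +
  fixes f
  assumes hom: "f \<in> alg_hom A T"
begin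

sublocale rh: ring_hom_ring A T f
  using hom by (intro ring_hom_ringI2 A.ring_axioms T.ring_axioms) (simp add: alg_hom_def)

lemma subalg_vimage:
  assumes "subalg S T"
  shows "subalg {a \<in> carrier A. f a \<in> S} A"
  using T.subalg_ring_closed[OF assms]
  by (intro A.subalgI) (auto simp: alg_homD[OF hom])

text \<open>The preimage of \<open>S\<close> is a subalgebra that contains \<open>G\<close>, hence
  contains what \<open>G\<close> generates. This takes the place of an induction over words in the
  generators.\<close>

lemma image_subalg_gen:
  assumes "subalg S T" "G \<subseteq> carrier A" "f ` G \<subseteq> S"
  shows "f ` subalg_gen A G \<subseteq> S"
  using A.subalg_gen_subset[OF subalg_vimage[OF assms(1)], of G] assms(2,3) by auto

lemma hom_Units:
  assumes "a \<in> Units A"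
  shows "f a \<in> Units T" "inv\<^bsub>T\<^esub> f a = f (inv\<^bsub>A\<^esub> a)"
proof -
  have *: "f a \<otimes>\<^bsub>T\<^esub> f (inv\<^bsub>A\<^esub> a) = \<one>\<^bsub>T\<^esub>" "f (inv\<^bsub>A\<^esub> a) \<otimes>\<^bsub>T\<^esub> f a = \<one>\<^bsub>T\<^esub>"
    using alg_homD(2)[OF hom, of a "inv\<^bsub>A\<^esub> a"] alg_homD(2)[OF hom, of "inv\<^bsub>A\<^esub> a" a] assms A.Units_closed
    by (simp_all add: alg_homD(4)[OF hom])
  have c: "f a \<in> carrier T" "f (inv\<^bsub>A\<^esub> a) \<in> carrier T"
    using assms A.Units_closed by simp_all
  show "f a \<in> Units T" using * c unfolding Units_def by blast
  show "inv\<^bsub>T\<^esub> f a = f (inv\<^bsub>A\<^esub> a)" using * c T.inv_unique'[of "f a" "f (inv\<^bsub>A\<^esub> a)"] by simp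
qed

end

subsection \<open>Quotients\<close>

context kalg
begin

lemma ideal_smult: "ideal I A \<Longrightarrow> a \<in> I \<Longrightarrow> c \<odot> a \<in> I"
  by (subst smult_eq_mult) (auto simp: ideal.I_l_closed ideal.Icarr)

context
  fixes J assumes J: "J \<subseteq> carrier A"
begin

interpretation I: ideal "Idl J" A using genideal_ideal[OF J] .

lemma quot_cls_eq_iff:
  "a \<in> carrier A \<Longrightarrow> b \<in> carrier A \<Longrightarrow> quot_cls A J a = quot_cls A J b \<longleftrightarrow> a \<ominus> b \<in> Idl J"
  unfolding quot_cls_def by (rule quotient_eq_iff_same_a_r_cos[OF I.is_ideal, symmetric])

text \<open>The scalar action on a quotient is defined as a union over all representatives. That
  union is over a constant, nonempty family: representatives differ by elements of the ideal, and
  scalars preserve the ideal.\<close>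

lemma quot_cls_smult:
  assumes "a \<in> carrier A"
  shows "(\<Union>b\<in>quot_cls A J a. quot_cls A J (c \<odot> b)) = quot_cls A J (c \<odot> a)"
proof -
  have "a \<in> quot_cls A J a"
    unfolding quot_cls_def by (rule I.a_rcos_self[OF assms])
  moreover have "quot_cls A J (c \<odot> b) = quot_cls A J (c \<odot> a)" if b: "b \<in> quot_cls A J a" for b
  proof -
    obtain i where i: "i \<in> Idl J" "b = i \<oplus> a"
      using b unfolding quot_cls_def a_r_coset_def' by blast
    have ic: "i \<in> carrier A" by (rule I.Icarr[OF i(1)])
    have cc: "c \<odot> i \<in> carrier A" "c \<odot> a \<in> carrier A" "c \<odot> b \<in> carrier A"
      using assms ic i(2) by simp_all
    have "c \<odot> b = c \<odot> i \<oplus> c \<odot> a"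
      unfolding i(2) by (rule smult_r_distr[OF ic assms])
    then have "c \<odot> b \<ominus> c \<odot> a = c \<odot> i"
      using cc(1,2) by (simp add: a_minus_def a_assoc r_neg)
    then have "c \<odot> b \<ominus> c \<odot> a \<in> Idl J" using ideal_smult[OF I.is_ideal i(1), of c] by simp
    then show ?thesis using quot_cls_eq_iff[OF cc(3,2)] by blast
  qed
  ultimately show ?thesis by - (rule SUP_eq_const, blast)
qed

lemma quot_alg_simps:
  "carrier (quot_alg A J) = quot_cls A J ` carrier A"
  "\<one>\<^bsub>quot_alg A J\<^esub> = quot_cls A J \<one>"
  "\<zero>\<^bsub>quot_alg A J\<^esub> = quot_cls A J \<zero>"
  "a \<in> carrier A \<Longrightarrow> b \<in> carrier A \<Longrightarrow>
    quot_cls A J a \<otimes>\<^bsub>quot_alg A J\<^esub> quot_cls A J b = quot_cls A J (a \<otimes> b)"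
  "a \<in> carrier A \<Longrightarrow> b \<in> carrier A \<Longrightarrow>
    quot_cls A J a \<oplus>\<^bsub>quot_alg A J\<^esub> quot_cls A J b = quot_cls A J (a \<oplus> b)"
  "a \<in> carrier A \<Longrightarrow> c \<odot>\<^bsub>quot_alg A J\<^esub> quot_cls A J a = quot_cls A J (c \<odot> a)"
proof -
  have Q: "ring (A Quot (Idl J))" by (rule I.quotient_is_ring)
  have [simp]: "mult (quot_alg A J) = mult (A Quot (Idl J))" "add (quot_alg A J) = add (A Quot (Idl J))"
    "one (quot_alg A J) = one (A Quot (Idl J))" "zero (quot_alg A J) = zero (A Quot (Idl J))"
    "carrier (quot_alg A J) = carrier (A Quot (Idl J))"
    "smult (quot_alg A J) c U = (\<Union>a\<in>U. quot_cls A J (c \<odot> a))" for c U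
    by (simp_all add: quot_alg_def Let_def)
  have cl: "quot_cls A J = (+>) (Idl J)" by (simp add: quot_cls_def fun_eq_iff)
  show "carrier (quot_alg A J) = quot_cls A J ` carrier A"
    unfolding cl by (simp add: FactRing_def A_RCOSETS_def' image_def) blast
  show "\<one>\<^bsub>quot_alg A J\<^esub> = quot_cls A J \<one>" "\<zero>\<^bsub>quot_alg A J\<^esub> = quot_cls A J \<zero>"
    unfolding cl using ring_hom_one[OF I.rcos_ring_hom] ring_hom_zero[OF I.rcos_ring_hom ring_axioms Q]
    by simp_all
  show "a \<in> carrier A \<Longrightarrow> b \<in> carrier A \<Longrightarrow>
    quot_cls A J a \<otimes>\<^bsub>quot_alg A J\<^esub> quot_cls A J b = quot_cls A J (a \<otimes> b)"
    unfolding cl using ring_hom_mult[OF I.rcos_ring_hom] by simp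
  show "a \<in> carrier A \<Longrightarrow> b \<in> carrier A \<Longrightarrow>
    quot_cls A J a \<oplus>\<^bsub>quot_alg A J\<^esub> quot_cls A J b = quot_cls A J (a \<oplus> b)"
    unfolding cl using ring_hom_add[OF I.rcos_ring_hom] by simp
  show "a \<in> carrier A \<Longrightarrow> c \<odot>\<^bsub>quot_alg A J\<^esub> quot_cls A J a = quot_cls A J (c \<odot> a)"
    by (simp add: quot_cls_smult)
qed

lemma kalg_quot_alg: "kalg (quot_alg A J)"
proof (rule kalgI)
  note [simp] = quot_alg_simps
  show "abelian_group (quot_alg A J)"
  proof (rule abelian_groupI)
    fix U assume "U \<in> carrier (quot_alg A J)"
    then obtain a where a: "a \<in> carrier A" "U = quot_cls A J a" by auto
    then show "\<exists>V\<in>carrier (quot_alg A J). V \<oplus>\<^bsub>quot_alg A J\<^esub> U = \<zero>\<^bsub>quot_alg A J\<^esub>"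
      by (intro bexI[of _ "quot_cls A J (\<ominus> a)"]) (auto simp: l_neg)
  qed (simp_all, safe intro!: arg_cong[of _ _ "quot_cls A J"], simp_all add: a_ac)
  show "monoid (quot_alg A J)"
    by (rule monoidI) (simp_all, safe intro!: arg_cong[of _ _ "quot_cls A J"], simp_all add: m_assoc)
qed (simp_all add: quot_alg_simps, safe, simp_all add: quot_alg_simps l_distr r_distr smult_l_distr smult_r_distr smult_smult
        smult_mult_l smult_mult_r)

lemma quot_cls_alg_hom: "quot_cls A J \<in> alg_hom A (quot_alg A J)"
  by (rule alg_homI) (auto simp: quot_alg_simps)

lemma quot_cls_zero: "a \<in> J \<Longrightarrow> quot_cls A J a = \<zero>\<^bsub>quot_alg A J\<^esub>"
  unfolding quot_alg_simps
  using J genideal_self[OF J] by (subst quot_cls_eq_iff) (simp_all add: a_minus_def subset_iff)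

text \<open>The kernel of \<open>f\<close> is an ideal containing \<open>J\<close>, hence contains
  the ideal generated by \<open>J\<close>. So \<open>f\<close> is constant on cosets, and
  \<open>g\<close> may be evaluated at any chosen representative.\<close>

lemma quot_alg_universal:
  fixes T :: "('k, 'b) module"
  assumes "kalg T" and f: "f \<in> alg_hom A T" and J0: "\<And>a. a \<in> J \<Longrightarrow> f a = \<zero>\<^bsub>T\<^esub>"
  shows "\<exists>g\<in>alg_hom (quot_alg A J) T. \<forall>a\<in>carrier A. g (quot_cls A J a) = f a"
proof -
  interpret T: kalg T by fact
  interpret alg_hom_pair A T f by unfold_locales fact
  define g where "g U = f (SOME a. a \<in> carrier A \<and> U = quot_cls A J a)" for U
  have "J \<subseteq> a_kernel A T f"
    using J J0 unfolding a_kernel_def' by blast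
  then have ker: "Idl J \<subseteq> a_kernel A T f"
    by (intro genideal_minimal rh.kernel_is_ideal)
  have eq: "f a = f b" if ab: "a \<in> carrier A" "b \<in> carrier A" "quot_cls A J a = quot_cls A J b" for a b
  proof -
    have "a \<ominus> b \<in> Idl J" using quot_cls_eq_iff[OF ab(1,2)] ab(3) by blast
    then have "f (a \<ominus> b) = \<zero>\<^bsub>T\<^esub>" using ker unfolding a_kernel_def' by blast
    then have "f a \<ominus>\<^bsub>T\<^esub> f b = \<zero>\<^bsub>T\<^esub>" using ab(1,2) by (simp add: a_minus_def)
    then show ?thesis using T.r_right_minus_eq[of "f a" "f b"] alg_homD(1)[OF f] ab(1,2) by simp
  qed
  have g: "g (quot_cls A J a) = f a" if a: "a \<in> carrier A" for a
    unfolding g_def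
  proof (rule someI2)
    show "a \<in> carrier A \<and> quot_cls A J a = quot_cls A J a" using a by simp
    fix b assume "b \<in> carrier A \<and> quot_cls A J a = quot_cls A J b"
    then show "f b = f a" using eq[of b a] a by simp
  qed
  have "g \<in> alg_hom (quot_alg A J) T"
    by (rule alg_homI; (unfold quot_alg_simps, elim imageE)?; hypsubst?)
      (simp_all add: quot_alg_simps g alg_homD[OF f])
  with g show ?thesis by blast
qed

end
end

subsection \<open>Monoid algebras\<close>

text \<open>Additive statements need only be checked on single terms. The case \<open>add\<close>
  hands over the supports of both summands, so that closure facts, which require membership in the
  carrier, stay available in the induction.\<close>

lemma poly_mapping_span_induct [consumes 1, case_names zero single add]:
  fixes f :: "'a \<Rightarrow>\<^sub>0 'b::comm_monoid_add"
  assumes f: "Poly_Mapping.keys f \<subseteq> C" and "P 0" and single: "\<And>x c. x \<in> C \<Longrightarrow> P (Poly_Mapping.single x c)"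
    and add: "\<And>f g. Poly_Mapping.keys f \<subseteq> C \<Longrightarrow> Poly_Mapping.keys g \<subseteq> C \<Longrightarrow> P f \<Longrightarrow> P g \<Longrightarrow> P (f + g)"
  shows "P f"
proof -
  let ?s = "\<lambda>x. Poly_Mapping.single x (Poly_Mapping.lookup f x)"
  have *: "Poly_Mapping.keys (\<Sum>x\<in>F. ?s x) \<subseteq> C \<and> P (\<Sum>x\<in>F. ?s x)"
    if "finite F" "F \<subseteq> C" for F
    using that
  proof (induction F rule: finite_induct)
    case (insert x F)
    have "Poly_Mapping.keys (?s x) \<subseteq> C" using insert by (auto split: if_splits)
    with insert show ?case
      using Poly_Mapping.keys_add[of "?s x" "\<Sum>x\<in>F. ?s x"] by (auto intro!: single add)
  qed (use assms in auto)
  have "f = (\<Sum>x\<in>Poly_Mapping.keys f. ?s x)"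
    by (intro poly_mapping_eqI)
      (auto simp: lookup_sum lookup_single when_def in_keys_iff sum.delta')
  then show ?thesis using *[of "Poly_Mapping.keys f"] f by simp
qed

lemma lookup_map_times [simp]:
  "Poly_Mapping.lookup (Poly_Mapping.map ((*) c) f) x = c * Poly_Mapping.lookup f x"
  for c :: "'a::mult_zero"
  by (auto simp: Poly_Mapping.map.rep_eq when_def)

lemma map_times_single [simp]:
  "Poly_Mapping.map ((*) c) (Poly_Mapping.single x d) = Poly_Mapping.single x (c * d)"
  for c :: "'a::mult_zero"
  by (intro poly_mapping_eqI) (auto simp: lookup_single when_def)

lemma map_times_add:
  "Poly_Mapping.map ((*) c) (f + g) = Poly_Mapping.map ((*) c) f + Poly_Mapping.map ((*) c) g"
  for c :: "'a::semiring_0"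
  by (intro poly_mapping_eqI) (auto simp: lookup_add algebra_simps)

lemma keys_map_times: "Poly_Mapping.keys (Poly_Mapping.map ((*) c) f) \<subseteq> Poly_Mapping.keys f"
  for c :: "'a::mult_zero"
  by (auto simp: in_keys_iff)

lemma keys_single_subset: "x \<in> C \<Longrightarrow> Poly_Mapping.keys (Poly_Mapping.single x c) \<subseteq> C"
  by auto

lemma monoid_algebra_simps [simp]:
  "carrier (monoid_algebra M) = {f. Poly_Mapping.keys f \<subseteq> carrier M}"
  "\<one>\<^bsub>monoid_algebra M\<^esub> = Poly_Mapping.single \<one>\<^bsub>M\<^esub> 1"
  "\<zero>\<^bsub>monoid_algebra M\<^esub> = 0"
  "f \<oplus>\<^bsub>monoid_algebra M\<^esub> g = f + g"
  "c \<odot>\<^bsub>monoid_algebra M\<^esub> f = Poly_Mapping.map ((*) c) f"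
  by (simp_all add: monoid_algebra_def)

text \<open>Summing over larger index sets adds only zero terms. It allows \<open>f\<close>,
  \<open>g\<close> and \<open>f + g\<close> to be expanded over one common index set although
  cancellation can shrink the support of the sum.\<close>

lemma monoid_algebra_mult:
  assumes "finite U" "finite V" "Poly_Mapping.keys f \<subseteq> U" "Poly_Mapping.keys g \<subseteq> V"
  shows "f \<otimes>\<^bsub>monoid_algebra M\<^esub> g = (\<Sum>x\<in>U. \<Sum>y\<in>V.
    Poly_Mapping.single (x \<otimes>\<^bsub>M\<^esub> y) (Poly_Mapping.lookup f x * Poly_Mapping.lookup g y))"
proof -
  have "f \<otimes>\<^bsub>monoid_algebra M\<^esub> g = (\<Sum>x\<in>Poly_Mapping.keys f. \<Sum>y\<in>V.
    Poly_Mapping.single (x \<otimes>\<^bsub>M\<^esub> y) (Poly_Mapping.lookup f x * Poly_Mapping.lookup g y))"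
    unfolding monoid_algebra_def monoid.simps
    using assms by (intro sum.cong refl sum.mono_neutral_left) (auto simp: in_keys_iff)
  also have "\<dots> = (\<Sum>x\<in>U. \<Sum>y\<in>V.
    Poly_Mapping.single (x \<otimes>\<^bsub>M\<^esub> y) (Poly_Mapping.lookup f x * Poly_Mapping.lookup g y))"
    using assms by (intro sum.mono_neutral_left) (auto simp: in_keys_iff)
  finally show ?thesis .
qed

lemma monoid_algebra_single_mult [simp]:
  "Poly_Mapping.single x c \<otimes>\<^bsub>monoid_algebra M\<^esub> Poly_Mapping.single y d =
    Poly_Mapping.single (x \<otimes>\<^bsub>M\<^esub> y) (c * d)"
  by (subst monoid_algebra_mult[of "{x}" "{y}"]) auto

lemma monoid_algebra_distrib:
  "(f + g) \<otimes>\<^bsub>monoid_algebra M\<^esub> h = f \<otimes>\<^bsub>monoid_algebra M\<^esub> h + g \<otimes>\<^bsub>monoid_algebra M\<^esub> h"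
  "h \<otimes>\<^bsub>monoid_algebra M\<^esub> (f + g) = h \<otimes>\<^bsub>monoid_algebra M\<^esub> f + h \<otimes>\<^bsub>monoid_algebra M\<^esub> g"
proof -
  let ?U = "Poly_Mapping.keys f \<union> Poly_Mapping.keys g" and ?V = "Poly_Mapping.keys h"
  have k: "Poly_Mapping.keys (f + g) \<subseteq> ?U" by (rule Poly_Mapping.keys_add)
  show "(f + g) \<otimes>\<^bsub>monoid_algebra M\<^esub> h = f \<otimes>\<^bsub>monoid_algebra M\<^esub> h + g \<otimes>\<^bsub>monoid_algebra M\<^esub> h"
    using k by (subst (1 2 3) monoid_algebra_mult[of ?U ?V])
      (auto simp: lookup_add algebra_simps single_add sum.distrib)
  show "h \<otimes>\<^bsub>monoid_algebra M\<^esub> (f + g) = h \<otimes>\<^bsub>monoid_algebra M\<^esub> f + h \<otimes>\<^bsub>monoid_algebra M\<^esub> g"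
    using k by (subst (1 2 3) monoid_algebra_mult[of ?V ?U])
      (auto simp: lookup_add algebra_simps single_add sum.distrib)
qed

lemma monoid_algebra_mult_zero [simp]:
  "0 \<otimes>\<^bsub>monoid_algebra M\<^esub> f = 0" "f \<otimes>\<^bsub>monoid_algebra M\<^esub> 0 = 0"
  by (simp_all add: monoid_algebra_def)

lemma monoid_algebra_smult_mult:
  fixes f g :: "'m \<Rightarrow>\<^sub>0 'k::field"
  shows "Poly_Mapping.map ((*) c) f \<otimes>\<^bsub>monoid_algebra M\<^esub> g = Poly_Mapping.map ((*) c) (f \<otimes>\<^bsub>monoid_algebra M\<^esub> g)"
  "f \<otimes>\<^bsub>monoid_algebra M\<^esub> Poly_Mapping.map ((*) c) g = Poly_Mapping.map ((*) c) (f \<otimes>\<^bsub>monoid_algebra M\<^esub> g)"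
proof -
  have m: "Poly_Mapping.map ((*) c) (\<Sum>x\<in>F. h x) = (\<Sum>x\<in>F. Poly_Mapping.map ((*) c) (h x))"
    if "finite F" for F :: "'m set" and h :: "'m \<Rightarrow> 'm \<Rightarrow>\<^sub>0 'k"
    using that by (induction F rule: finite_induct) (auto simp: map_times_add intro: poly_mapping_eqI)
  show "Poly_Mapping.map ((*) c) f \<otimes>\<^bsub>monoid_algebra M\<^esub> g = Poly_Mapping.map ((*) c) (f \<otimes>\<^bsub>monoid_algebra M\<^esub> g)"
    using keys_map_times[of c f]
    by (subst (1 2) monoid_algebra_mult[of "Poly_Mapping.keys f" "Poly_Mapping.keys g"])
      (auto simp: m mult.assoc)
  show "f \<otimes>\<^bsub>monoid_algebra M\<^esub> Poly_Mapping.map ((*) c) g = Poly_Mapping.map ((*) c) (f \<otimes>\<^bsub>monoid_algebra M\<^esub> g)"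
    using keys_map_times[of c g]
    by (subst (1 2) monoid_algebra_mult[of "Poly_Mapping.keys f" "Poly_Mapping.keys g"])
      (auto simp: m mult.left_commute)
qed

text \<open>Stated for a general target \<open>C\<close>, because it serves both for closure of the
  monoid algebra and for closure of \<open>tensor_sub\<close>, where \<open>C\<close> is a product
  of two subalgebras.\<close>

lemma keys_monoid_algebra_mult:
  fixes f g :: "'m \<Rightarrow>\<^sub>0 'k::field"
  assumes "\<And>x y. x \<in> Poly_Mapping.keys f \<Longrightarrow> y \<in> Poly_Mapping.keys g \<Longrightarrow> x \<otimes>\<^bsub>M\<^esub> y \<in> C"
  shows "Poly_Mapping.keys (f \<otimes>\<^bsub>monoid_algebra M\<^esub> g) \<subseteq> C"
proof -
  have "Poly_Mapping.keys (\<Sum>x\<in>F. h x) \<subseteq> C"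
    if "finite F" "\<And>x. x \<in> F \<Longrightarrow> Poly_Mapping.keys (h x) \<subseteq> C" for F :: "'m set" and h :: "'m \<Rightarrow> 'm \<Rightarrow>\<^sub>0 'k"
    using that
  proof (induction F rule: finite_induct)
    case (insert x F)
    then show ?case using Poly_Mapping.keys_add[of "h x" "\<Sum>x\<in>F. h x"] by auto
  qed auto
  note * = this
  show ?thesis
    unfolding monoid_algebra_def monoid.simps
    using assms by (intro * finite_keys keys_single_subset)
qed

text \<open>Associativity is trilinear, so three nested inductions reduce it to single terms, where
  it is associativity in \<open>M\<close>.\<close>

lemma kalg_monoid_algebra:
  fixes M :: "('m, 'z) monoid_scheme"
  assumes "monoid M"
  shows "kalg (monoid_algebra M :: ('k::field, 'm \<Rightarrow>\<^sub>0 'k) module)"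
proof -
  interpret M: monoid M by fact
  let ?A = "monoid_algebra M :: ('k, 'm \<Rightarrow>\<^sub>0 'k) module"
  show ?thesis
  proof (rule kalgI)
    show "abelian_group ?A"
    proof (rule abelian_groupI)
      fix f assume "f \<in> carrier ?A"
      then show "\<exists>g\<in>carrier ?A. g \<oplus>\<^bsub>?A\<^esub> f = \<zero>\<^bsub>?A\<^esub>"
        by (intro bexI[of _ "- f"]) (auto simp: in_keys_iff)
    next
      fix f g assume "f \<in> carrier ?A" "g \<in> carrier ?A"
      then show "f \<oplus>\<^bsub>?A\<^esub> g \<in> carrier ?A" using Poly_Mapping.keys_add[of f g] by auto
    qed (simp_all add: ac_simps)
    show "monoid ?A"
    proof
      fix f g h :: "'m \<Rightarrow>\<^sub>0 'k" assume f: "f \<in> carrier ?A" and g: "g \<in> carrier ?A"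
      show "f \<otimes>\<^bsub>?A\<^esub> g \<in> carrier ?A" using f g
        using keys_monoid_algebra_mult[of f g M "carrier M"] by (simp add: subset_iff)
      assume h: "h \<in> carrier ?A"
      have f: "Poly_Mapping.keys f \<subseteq> carrier M" and g: "Poly_Mapping.keys g \<subseteq> carrier M"
        and h: "Poly_Mapping.keys h \<subseteq> carrier M" using f g h by auto
      show "f \<otimes>\<^bsub>?A\<^esub> g \<otimes>\<^bsub>?A\<^esub> h = f \<otimes>\<^bsub>?A\<^esub> (g \<otimes>\<^bsub>?A\<^esub> h)"
        using f
      proof (induction rule: poly_mapping_span_induct)
        case (single x c)
        show ?case using g
        proof (induction rule: poly_mapping_span_induct)
          case (single y d)
          show ?case using h
            by (induction rule: poly_mapping_span_induct)
              (use \<open>x \<in> _\<close> single in \<open>auto simp: M.m_assoc mult.assoc monoid_algebra_distrib\<close>)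
        qed (auto simp: monoid_algebra_distrib)
      qed (auto simp: monoid_algebra_distrib)
    next
      fix f :: "'m \<Rightarrow>\<^sub>0 'k" assume "f \<in> carrier ?A"
      then have f: "Poly_Mapping.keys f \<subseteq> carrier M" by simp
      show "\<one>\<^bsub>?A\<^esub> \<otimes>\<^bsub>?A\<^esub> f = f" using f
        by (induction rule: poly_mapping_span_induct) (auto simp: monoid_algebra_distrib)
      show "f \<otimes>\<^bsub>?A\<^esub> \<one>\<^bsub>?A\<^esub> = f" using f
        by (induction rule: poly_mapping_span_induct) (auto simp: monoid_algebra_distrib)
    qed auto
    fix f assume "f \<in> carrier ?A"
    then show "c \<odot>\<^bsub>?A\<^esub> f \<in> carrier ?A" for c using keys_map_times[of c f] by auto
    show "(c + d) \<odot>\<^bsub>?A\<^esub> f = c \<odot>\<^bsub>?A\<^esub> f \<oplus>\<^bsub>?A\<^esub> d \<odot>\<^bsub>?A\<^esub> f" for c d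
      by (simp add: poly_mapping_eq_iff fun_eq_iff lookup_add algebra_simps)
    show "c \<odot>\<^bsub>?A\<^esub> (d \<odot>\<^bsub>?A\<^esub> f) = (c * d) \<odot>\<^bsub>?A\<^esub> f" "1 \<odot>\<^bsub>?A\<^esub> f = f" for c d
      by (simp_all add: poly_mapping_eq_iff fun_eq_iff algebra_simps)
  qed (simp_all add: monoid_algebra_distrib monoid_algebra_smult_mult map_times_add)
qed

lemma keys_diff_subset:
  fixes f g :: "'m \<Rightarrow>\<^sub>0 'k::ab_group_add"
  shows "Poly_Mapping.keys f \<subseteq> C \<Longrightarrow> Poly_Mapping.keys g \<subseteq> C \<Longrightarrow> Poly_Mapping.keys (f - g) \<subseteq> C"
  unfolding subset_iff in_keys_iff lookup_minus by (metis diff_self)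

text \<open>Ideals are compared through the subtraction of the ring record, whereas relations are
  written with the subtraction of the type; on the carrier the two agree.\<close>

lemma minus_monoid_algebra:
  fixes f g :: "'m \<Rightarrow>\<^sub>0 'k::field"
  assumes "monoid M" and g: "Poly_Mapping.keys g \<subseteq> carrier M"
  shows "f \<ominus>\<^bsub>monoid_algebra M\<^esub> g = f - g"
proof -
  interpret F: kalg "monoid_algebra M :: ('k, 'm \<Rightarrow>\<^sub>0 'k) module"
    by (rule kalg_monoid_algebra) fact
  have "\<ominus>\<^bsub>monoid_algebra M\<^esub> g = - g"
    using g by (intro F.minus_equality) (auto simp: in_keys_iff)
  then show ?thesis by (simp add: a_minus_def)
qed

text \<open>This is how a listed relation becomes an equation in the presented algebra.\<close>

lemma monoid_algebra_quot_eqI: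
  fixes f g :: "'m \<Rightarrow>\<^sub>0 'k::field"
  assumes M: "monoid M" and J: "J \<subseteq> carrier (monoid_algebra M)"
    and f: "Poly_Mapping.keys f \<subseteq> carrier M" and g: "Poly_Mapping.keys g \<subseteq> carrier M"
    and "f - g \<in> J"
  shows "quot_cls (monoid_algebra M) J f = quot_cls (monoid_algebra M) J g"
proof -
  interpret F: kalg "monoid_algebra M :: ('k, 'm \<Rightarrow>\<^sub>0 'k) module"
    by (rule kalg_monoid_algebra) fact
  have "f \<ominus>\<^bsub>monoid_algebra M\<^esub> g \<in> Idl\<^bsub>monoid_algebra M\<^esub> J"
    unfolding minus_monoid_algebra[OF M g] using F.genideal_self[OF J] assms(5) by blast
  then show ?thesis using F.quot_cls_eq_iff[OF J, of f g] f g by simp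
qed

section \<open>Linear extension from a basis\<close>

definition lin_ext :: "('k::field, 'a) module \<Rightarrow> ('m \<Rightarrow> 'a) \<Rightarrow> ('m \<Rightarrow>\<^sub>0 'k) \<Rightarrow> 'a" where
  "lin_ext T \<phi> f = (\<Oplus>\<^bsub>T\<^esub>x\<in>Poly_Mapping.keys f. Poly_Mapping.lookup f x \<odot>\<^bsub>T\<^esub> \<phi> x)"

context kalg
begin

context
  fixes C and \<phi> :: "'m \<Rightarrow> 'a"
  assumes \<phi>: "\<phi> \<in> C \<rightarrow> carrier A"
begin

lemma lin_ext_superset:
  assumes "finite F" "Poly_Mapping.keys f \<subseteq> F" "F \<subseteq> C"
  shows "lin_ext A \<phi> f = (\<Oplus>x\<in>F. Poly_Mapping.lookup f x \<odot> \<phi> x)"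
proof -
  have cl: "Poly_Mapping.lookup f x \<odot> \<phi> x \<in> carrier A" if "x \<in> F" for x
    using that assms(3) \<phi> by (intro smult_closed) blast
  show ?thesis
    unfolding lin_ext_def
  proof (rule add.finprod_mono_neutral_cong_left[OF assms(1,2)])
    fix x assume x: "x \<in> F - Poly_Mapping.keys f"
    then have "\<phi> x \<in> carrier A" using assms(3) \<phi> by blast
    with x show "Poly_Mapping.lookup f x \<odot> \<phi> x = \<zero>" by (simp add: in_keys_iff)
  qed (use cl in blast)+
qed

lemma lin_ext_closed: "Poly_Mapping.keys f \<subseteq> C \<Longrightarrow> lin_ext A \<phi> f \<in> carrier A"
  unfolding lin_ext_def using \<phi> by (intro finsum_closed) blast

lemma lin_ext_add:
  assumes "Poly_Mapping.keys f \<subseteq> C" "Poly_Mapping.keys g \<subseteq> C"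
  shows "lin_ext A \<phi> (f + g) = lin_ext A \<phi> f \<oplus> lin_ext A \<phi> g"
proof -
  let ?F = "Poly_Mapping.keys f \<union> Poly_Mapping.keys g"
  have *: "\<phi> x \<in> carrier A" if "x \<in> ?F" for x using that assms \<phi> by blast
  have "lin_ext A \<phi> (f + g) = (\<Oplus>x\<in>?F. Poly_Mapping.lookup (f + g) x \<odot> \<phi> x)"
    using assms Poly_Mapping.keys_add[of f g] by (intro lin_ext_superset) auto
  also have "\<dots> = (\<Oplus>x\<in>?F. Poly_Mapping.lookup f x \<odot> \<phi> x \<oplus> Poly_Mapping.lookup g x \<odot> \<phi> x)"
    using * by (intro finsum_cong') (auto simp: lookup_add smult_l_distr)
  also have "\<dots> = (\<Oplus>x\<in>?F. Poly_Mapping.lookup f x \<odot> \<phi> x) \<oplus> (\<Oplus>x\<in>?F. Poly_Mapping.lookup g x \<odot> \<phi> x)"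
    using * by (intro finsum_addf) auto
  also have "\<dots> = lin_ext A \<phi> f \<oplus> lin_ext A \<phi> g"
    using lin_ext_superset[of ?F f] lin_ext_superset[of ?F g] assms by simp
  finally show ?thesis .
qed

lemma lin_ext_zero [simp]: "lin_ext A \<phi> 0 = \<zero>"
  by (simp add: lin_ext_def)

lemma lin_ext_single: "x \<in> C \<Longrightarrow> lin_ext A \<phi> (Poly_Mapping.single x c) = c \<odot> \<phi> x"
  using lin_ext_superset[of "{x}" "Poly_Mapping.single x c"] \<phi> by (simp add: Pi_iff)

lemma lin_ext_smult:
  assumes "Poly_Mapping.keys f \<subseteq> C"
  shows "lin_ext A \<phi> (Poly_Mapping.map ((*) c) f) = c \<odot> lin_ext A \<phi> f"
  using assms
proof (induction rule: poly_mapping_span_induct)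
  case (add f g)
  have "Poly_Mapping.keys (Poly_Mapping.map ((*) c) f) \<subseteq> C" "Poly_Mapping.keys (Poly_Mapping.map ((*) c) g) \<subseteq> C"
    using add(1,2) keys_map_times[of c f] keys_map_times[of c g] by blast+
  then show ?case using add
    by (simp add: map_times_add lin_ext_add smult_r_distr lin_ext_closed)
next
  case zero
  have "Poly_Mapping.map ((*) c) 0 = (0 :: 'm \<Rightarrow>\<^sub>0 'k)" by (intro poly_mapping_eqI) simp
  then show ?case by simp
qed (use \<phi> in \<open>auto simp: lin_ext_single smult_smult Pi_iff\<close>)

lemma lin_ext_diff:
  assumes f: "Poly_Mapping.keys f \<subseteq> C" and g: "Poly_Mapping.keys g \<subseteq> C"
  shows "lin_ext A \<phi> (f - g) = lin_ext A \<phi> f \<ominus> lin_ext A \<phi> g"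
proof -
  have d: "Poly_Mapping.keys (f - g) \<subseteq> C" by (rule keys_diff_subset[OF f g])
  have "lin_ext A \<phi> f = lin_ext A \<phi> (f - g) \<oplus> lin_ext A \<phi> g"
    using lin_ext_add[OF d g] by simp
  then show ?thesis
    using lin_ext_closed[OF d] lin_ext_closed[OF g] by (simp add: a_minus_def a_assoc r_neg)
qed

end

text \<open>Universal property of the monoid algebra. Multiplicativity is bilinear in
  \<open>f\<close> and \<open>g\<close>, so the hypothesis on basis elements is enough once scalars
  are moved out of both factors.\<close>

lemma lin_ext_alg_hom:
  fixes M :: "('m, 'z) monoid_scheme" and \<phi> :: "'m \<Rightarrow> 'a"
  assumes M: "monoid M" and \<phi>: "\<phi> \<in> carrier M \<rightarrow> carrier A"
    and one: "\<phi> \<one>\<^bsub>M\<^esub> = \<one>"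
    and mult: "\<And>x y. x \<in> carrier M \<Longrightarrow> y \<in> carrier M \<Longrightarrow> \<phi> (x \<otimes>\<^bsub>M\<^esub> y) = \<phi> x \<otimes> \<phi> y"
  shows "lin_ext A \<phi> \<in> alg_hom (monoid_algebra M) A"
proof -
  interpret M: monoid M by fact
  interpret MA: kalg "monoid_algebra M :: ('k, 'm \<Rightarrow>\<^sub>0 'k) module" by (rule kalg_monoid_algebra[OF M])
  note [simp] = lin_ext_single[OF \<phi>] lin_ext_add[OF \<phi>] lin_ext_zero[OF \<phi>]
  have cl: "\<And>x. x \<in> carrier M \<Longrightarrow> \<phi> x \<in> carrier A" using \<phi> by auto
  have lcl: "\<And>f. Poly_Mapping.keys f \<subseteq> carrier M \<Longrightarrow> lin_ext A \<phi> f \<in> carrier A"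
    using lin_ext_closed[OF \<phi>] by auto
  have mcl: "\<And>f g. Poly_Mapping.keys f \<subseteq> carrier M \<Longrightarrow> Poly_Mapping.keys g \<subseteq> carrier M \<Longrightarrow>
      Poly_Mapping.keys (f \<otimes>\<^bsub>monoid_algebra M\<^esub> (g :: 'm \<Rightarrow>\<^sub>0 'k)) \<subseteq> carrier M"
    using MA.m_closed by simp
  have m: "lin_ext A \<phi> (f \<otimes>\<^bsub>monoid_algebra M\<^esub> g) = lin_ext A \<phi> f \<otimes> lin_ext A \<phi> g"
    if f: "Poly_Mapping.keys f \<subseteq> carrier M" and g: "Poly_Mapping.keys g \<subseteq> carrier M" for f g
    using f
  proof (induction rule: poly_mapping_span_induct)
    case (single x c)
    show ?case using g
    proof (induction rule: poly_mapping_span_induct)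
      case (single y d)
      then show ?case using \<open>x \<in> carrier M\<close>
        by (simp add: mult cl smult_mult_l smult_mult_r smult_smult mult.commute)
    next
      case (add f g)
      have "Poly_Mapping.keys (Poly_Mapping.single x c) \<subseteq> carrier M" using single by auto
      then show ?case using add single mcl cl
        by (simp add: monoid_algebra_distrib r_distr lcl)
    qed (use single cl in auto)
  next
    case (add f h)
    then show ?case using g mcl by (simp add: monoid_algebra_distrib l_distr lcl)
  qed (use g lcl in auto)
  show ?thesis
    using \<phi> by (intro alg_homI) (auto simp: m lcl one lin_ext_smult[OF \<phi>])
qed

end

subsection \<open>Free algebras\<close>

lemma monoid_free_monoid: "monoid (free_monoid V)"
  by unfold_locales (auto simp: free_monoid_def)

lemma kalg_free_alg: "kalg (free_alg V)"
  unfolding free_alg_def by (rule kalg_monoid_algebra[OF monoid_free_monoid])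

lemma free_alg_simps [simp]:
  "carrier (free_alg V) = {f. Poly_Mapping.keys f \<subseteq> lists V}"
  "\<one>\<^bsub>free_alg V\<^esub> = Poly_Mapping.single [] 1"
  "\<zero>\<^bsub>free_alg V\<^esub> = 0"
  "f \<oplus>\<^bsub>free_alg V\<^esub> g = f + g"
  "c \<odot>\<^bsub>free_alg V\<^esub> f = Poly_Mapping.map ((*) c) f"
  "Poly_Mapping.single v c \<otimes>\<^bsub>free_alg V\<^esub> Poly_Mapping.single w d = Poly_Mapping.single (v @ w) (c * d)"
  by (simp_all add: free_alg_def free_monoid_def)

context kalg
begin

primrec word :: "('x \<Rightarrow> 'a) \<Rightarrow> 'x list \<Rightarrow> 'a" where
  "word y [] = \<one>"
| "word y (x # xs) = y x \<otimes> word y xs"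

lemma word_closed: "y \<in> V \<rightarrow> carrier A \<Longrightarrow> w \<in> lists V \<Longrightarrow> word y w \<in> carrier A"
  by (induction w) auto

lemma word_append:
  "y \<in> V \<rightarrow> carrier A \<Longrightarrow> v \<in> lists V \<Longrightarrow> w \<in> lists V \<Longrightarrow> word y (v @ w) = word y v \<otimes> word y w"
  by (induction v) (auto simp: m_assoc word_closed Pi_iff)

text \<open>The clause on differences is what evaluates the homomorphism on relations: these are
  written with the subtraction of the type, while \<open>alg_hom\<close> speaks of the operations of
  the record.\<close>

lemma free_alg_universal:
  assumes y: "y \<in> V \<rightarrow> carrier A"
  obtains f where "f \<in> alg_hom (free_alg V) A"
    "\<And>w c. w \<in> lists V \<Longrightarrow> f (Poly_Mapping.single w c) = c \<odot> word y w"
    "\<And>g h. Poly_Mapping.keys g \<subseteq> lists V \<Longrightarrow> Poly_Mapping.keys h \<subseteq> lists V \<Longrightarrow> f (g - h) = f g \<ominus> f h"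
proof -
  have w: "word y \<in> lists V \<rightarrow> carrier A" using word_closed[OF y] by auto
  have hom: "lin_ext A (word y) \<in> alg_hom (free_alg V) A"
    unfolding free_alg_def using w y
    by (intro lin_ext_alg_hom monoid_free_monoid) (auto simp: free_monoid_def word_append)
  show ?thesis
    using that[OF hom] lin_ext_single[OF w] lin_ext_diff[OF w] by blast
qed

end

subsection \<open>Localization\<close>

lemma free_alg_quot_eqI:
  fixes f g :: "'x list \<Rightarrow>\<^sub>0 'k::field"
  assumes "J \<subseteq> carrier (free_alg V)" "Poly_Mapping.keys f \<subseteq> lists V" "Poly_Mapping.keys g \<subseteq> lists V"
    and "f - g \<in> J"
  shows "quot_cls (free_alg V) J f = quot_cls (free_alg V) J g"
  using monoid_algebra_quot_eqI[OF monoid_free_monoid[of V], of J f g] assms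
  by (simp add: free_alg_def free_monoid_def)

lemma Plus_iffs [simp]:
  "Inl a \<in> Sum_Type.Plus U V \<longleftrightarrow> a \<in> U" "Inr b \<in> Sum_Type.Plus U V \<longleftrightarrow> b \<in> V"
  by auto

lemma (in kalg) quot_cls_closed:
  "J \<subseteq> carrier A \<Longrightarrow> a \<in> carrier A \<Longrightarrow> quot_cls A J a \<in> carrier (quot_alg A J)"
  by (rule alg_homD(1)[OF quot_cls_alg_hom])

context kalg
begin

text \<open>The shape taken by the image of a three-term relation (additivity, bilinearity, the
  fourth quantum matrix relation) after the equation known in the target has been
  substituted.\<close>

lemma add_minus_minus:
  assumes "x \<in> carrier A" "y \<in> carrier A"
  shows "x \<oplus> y \<ominus> x \<ominus> y = \<zero>"
proof -
  have "x \<oplus> y \<ominus> x = y" using assms by (simp add: minus_eq a_comm[of x y] a_assoc r_neg)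
  then show ?thesis using assms by (simp add: minus_eq r_neg)
qed

context
  fixes S assumes S: "S \<subseteq> carrier A"
begin

lemma loc_rels_carrier: "loc_rels A S \<subseteq> carrier (free_alg (carrier A <+> S))"
proof
  fix r assume "r \<in> loc_rels A S"
  then show "r \<in> carrier (free_alg (carrier A <+> S))"
    unfolding loc_rels_def free_alg_simps
    by (elim UnE CollectE exE conjE singletonE; hypsubst; intro CollectI keys_diff_subset keys_single_subset)
      (use S in auto)
qed

lemma kalg_loc: "kalg (loc A S)"
  unfolding loc_def by (rule kalg.kalg_quot_alg[OF kalg_free_alg loc_rels_carrier])

interpretation F: kalg "free_alg (carrier A <+> S) :: ('k, ('a + 'a) list \<Rightarrow>\<^sub>0 'k) module"
  by (rule kalg_free_alg)

lemma to_loc_alg_hom: "to_loc A S \<in> alg_hom A (loc A S)"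
proof -
  let ?F = "free_alg (carrier A <+> S) :: ('k, ('a + 'a) list \<Rightarrow>\<^sub>0 'k) module"
  let ?s = "Poly_Mapping.single :: ('a + 'a) list \<Rightarrow> 'k \<Rightarrow> _"
  note simps = F.quot_alg_simps(2-)[OF loc_rels_carrier] F.quot_cls_closed[OF loc_rels_carrier]
  have eq: "quot_cls ?F (loc_rels A S) f = quot_cls ?F (loc_rels A S) g"
    if "f - g \<in> loc_rels A S" "Poly_Mapping.keys f \<subseteq> lists (Sum_Type.Plus (carrier A) S)"
      "Poly_Mapping.keys g \<subseteq> lists (Sum_Type.Plus (carrier A) S)" for f g
    using that by (intro free_alg_quot_eqI loc_rels_carrier)
  show ?thesis
    unfolding loc_def to_loc_def
  proof (rule alg_homI)
    fix a b assume a: "a \<in> carrier A" and b: "b \<in> carrier A"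
    then have w: "[Inl a] \<in> lists (Sum_Type.Plus (carrier A) S)" "[Inl b] \<in> lists (Sum_Type.Plus (carrier A) S)" by auto
    have "?s [Inl (a \<otimes> b)] 1 - ?s [Inl a, Inl b] 1 \<in> loc_rels A S"
      unfolding loc_rels_def using a b by blast
    then show "quot_cls ?F (loc_rels A S) (?s [Inl (a \<otimes> b)] 1) =
      quot_cls ?F (loc_rels A S) (?s [Inl a] 1) \<otimes>\<^bsub>quot_alg ?F (loc_rels A S)\<^esub> quot_cls ?F (loc_rels A S) (?s [Inl b] 1)"
      using a b by (subst eq) (simp_all add: simps)
    have k: "Poly_Mapping.keys (?s [Inl a] 1 + ?s [Inl b] 1) \<subseteq> lists (Sum_Type.Plus (carrier A) S)"
      by (rule order_trans[OF Poly_Mapping.keys_add]) (use w in simp)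
    have "?s [Inl (a \<oplus> b)] 1 - ?s [Inl a] 1 - ?s [Inl b] 1 \<in> loc_rels A S"
      unfolding loc_rels_def using a b by blast
    \<comment> \<open>Regrouped from \<open>f - g - h\<close> into a difference of two elements, the
      form in which a relation identifies two classes.\<close>
    then have "?s [Inl (a \<oplus> b)] 1 - (?s [Inl a] 1 + ?s [Inl b] 1) \<in> loc_rels A S"
      by (simp add: diff_diff_eq)
    then show "quot_cls ?F (loc_rels A S) (?s [Inl (a \<oplus> b)] 1) =
      quot_cls ?F (loc_rels A S) (?s [Inl a] 1) \<oplus>\<^bsub>quot_alg ?F (loc_rels A S)\<^esub> quot_cls ?F (loc_rels A S) (?s [Inl b] 1)"
      using a b by (subst eq[OF _ _ k]) (simp_all add: simps)
  next
    fix a and c :: 'k assume a: "a \<in> carrier A"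
    have "?s [Inl (c \<odot> a)] 1 - ?s [Inl a] c \<in> loc_rels A S"
      unfolding loc_rels_def using a by blast
    then show "quot_cls ?F (loc_rels A S) (?s [Inl (c \<odot> a)] 1) =
      c \<odot>\<^bsub>quot_alg ?F (loc_rels A S)\<^esub> quot_cls ?F (loc_rels A S) (?s [Inl a] 1)"
      using a by (subst eq) (simp_all add: simps)
  next
    have "?s [Inl \<one>] 1 - ?s [] 1 \<in> loc_rels A S"
      unfolding loc_rels_def by blast
    then show "quot_cls ?F (loc_rels A S) (?s [Inl \<one>] 1) = \<one>\<^bsub>quot_alg ?F (loc_rels A S)\<^esub>"
      by (subst eq) (simp_all add: simps)
  next
    fix a assume "a \<in> carrier A"
    then show "quot_cls ?F (loc_rels A S) (?s [Inl a] 1) \<in> carrier (quot_alg ?F (loc_rels A S))"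
      by (simp add: simps)
  qed
qed

text \<open>The class of the formal inverse \<open>Inr s\<close> is a two-sided inverse by the last
  two families of relations.\<close>

lemma to_loc_Units:
  assumes s: "s \<in> S"
  shows "to_loc A S s \<in> Units (loc A S)"
proof -
  let ?F = "free_alg (carrier A <+> S) :: ('k, ('a + 'a) list \<Rightarrow>\<^sub>0 'k) module"
  let ?s = "Poly_Mapping.single :: ('a + 'a) list \<Rightarrow> 'k \<Rightarrow> _"
  let ?q = "quot_cls ?F (loc_rels A S)"
  note simps = F.quot_alg_simps(2-)[OF loc_rels_carrier] F.quot_cls_closed[OF loc_rels_carrier]
  have sc: "s \<in> carrier A" using s S by blast
  have "?s [Inl s, Inr s] 1 - ?s [] 1 \<in> loc_rels A S" "?s [Inr s, Inl s] 1 - ?s [] 1 \<in> loc_rels A S"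
    unfolding loc_rels_def using s by blast+
  note r = this
  have eq: "?q (?s [Inl s, Inr s] 1) = ?q (?s [] 1)"
    by (rule free_alg_quot_eqI[OF loc_rels_carrier _ _ r(1)]) (use s sc in auto)
  have "?q (?s [Inr s, Inl s] 1) = ?q (?s [] 1)"
    by (rule free_alg_quot_eqI[OF loc_rels_carrier _ _ r(2)]) (use s sc in auto)
  note eq = eq this
  then show ?thesis
    unfolding Units_def loc_def to_loc_def using s sc
    by (intro CollectI conjI bexI[of _ "?q (?s [Inr s] 1)"]) (simp_all add: simps eq)
qed

lemma loc_universal:
  fixes T :: "('k, 'b) module"
  assumes "kalg T" and f: "f \<in> alg_hom A T" and fS: "\<And>s. s \<in> S \<Longrightarrow> f s \<in> Units T"
  shows "\<exists>g\<in>alg_hom (loc A S) T. \<forall>a\<in>carrier A. g (to_loc A S a) = f a"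
proof -
  interpret T: kalg T by fact
  let ?V = "Sum_Type.Plus (carrier A) S"
  \<comment> \<open>Elements of \<open>A\<close> go where \<open>f\<close> sends them and formal
    inverses to the actual inverses in \<open>T\<close>. What remains is to check that each of the
    six families of relations is sent to zero.\<close>
  let ?y = "case_sum f (\<lambda>s. inv\<^bsub>T\<^esub> (f s))"
  note fc = alg_homD(1)[OF f]
  have "?y \<in> ?V \<rightarrow> carrier T" using fc fS by auto
  then obtain h where h: "h \<in> alg_hom (free_alg ?V) T"
    and hs: "\<And>w c. w \<in> lists ?V \<Longrightarrow> h (Poly_Mapping.single w c) = c \<odot>\<^bsub>T\<^esub> T.word ?y w"
    and hd: "\<And>g k. Poly_Mapping.keys g \<subseteq> lists ?V \<Longrightarrow> Poly_Mapping.keys k \<subseteq> lists ?V \<Longrightarrow> h (g - k) = h g \<ominus>\<^bsub>T\<^esub> h k"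
    by (rule T.free_alg_universal) blast
  have hd1: "h (Poly_Mapping.single v c - Poly_Mapping.single w d) =
      c \<odot>\<^bsub>T\<^esub> T.word ?y v \<ominus>\<^bsub>T\<^esub> d \<odot>\<^bsub>T\<^esub> T.word ?y w" if "v \<in> lists ?V" "w \<in> lists ?V" for v w c d
    using that by (simp add: hd hs)
  have hd2: "h (Poly_Mapping.single v c - Poly_Mapping.single w d - Poly_Mapping.single u e) =
      c \<odot>\<^bsub>T\<^esub> T.word ?y v \<ominus>\<^bsub>T\<^esub> d \<odot>\<^bsub>T\<^esub> T.word ?y w \<ominus>\<^bsub>T\<^esub> e \<odot>\<^bsub>T\<^esub> T.word ?y u"
    if "v \<in> lists ?V" "w \<in> lists ?V" "u \<in> lists ?V" for v w u c d e
    using that hd1[OF that(1,2)] by (simp add: hd hs keys_diff_subset)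
  have "h r = \<zero>\<^bsub>T\<^esub>" if "r \<in> loc_rels A S" for r
    using that unfolding loc_rels_def
  proof (elim UnE CollectE exE conjE)
    fix a b assume *: "r = Poly_Mapping.single [Inl (a \<oplus> b)] 1 - Poly_Mapping.single [Inl a] 1 - Poly_Mapping.single [Inl b] 1"
      "a \<in> carrier A" "b \<in> carrier A"
    then show ?thesis
      by (simp add: hd2 fc alg_homD(3)[OF f] T.add_minus_minus)
  next
    fix a b assume *: "r = Poly_Mapping.single [Inl (a \<otimes> b)] 1 - Poly_Mapping.single [Inl a, Inl b] 1"
      "a \<in> carrier A" "b \<in> carrier A"
    then show ?thesis
      by (simp add: hd1 fc alg_homD(2)[OF f] T.minus_eq T.r_neg)
  next
    fix u a assume *: "r = Poly_Mapping.single [Inl (u \<odot> a)] 1 - Poly_Mapping.single [Inl a] u"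
      "a \<in> carrier A"
    then show ?thesis
      by (simp add: hd1 fc alg_homD(5)[OF f] T.minus_eq T.r_neg)
  next
    assume *: "r \<in> {Poly_Mapping.single [Inl \<one>] 1 - Poly_Mapping.single [] 1}"
    then have "r = Poly_Mapping.single [Inl \<one>] 1 - Poly_Mapping.single [] 1" by blast
    then show ?thesis
      by (simp add: hd1 fc alg_homD(4)[OF f] T.minus_eq T.r_neg)
  next
    fix s assume *: "r = Poly_Mapping.single [Inl s, Inr s] 1 - Poly_Mapping.single [] 1" "s \<in> S"
    moreover have "s \<in> carrier A" using * S by blast
    ultimately show ?thesis
      by (simp add: hd1 fc fS T.minus_eq T.r_neg)
  next
    fix s assume *: "r = Poly_Mapping.single [Inr s, Inl s] 1 - Poly_Mapping.single [] 1" "s \<in> S"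
    moreover have "s \<in> carrier A" using * S by blast
    ultimately show ?thesis
      by (simp add: hd1 fc fS T.minus_eq T.r_neg)
  qed
  then obtain g where g: "g \<in> alg_hom (loc A S) T"
    "\<And>r. r \<in> carrier (free_alg ?V) \<Longrightarrow> g (quot_cls (free_alg ?V) (loc_rels A S) r) = h r"
    using F.quot_alg_universal[OF loc_rels_carrier \<open>kalg T\<close> h, folded loc_def] by blast
  have "g (to_loc A S a) = f a" if "a \<in> carrier A" for a
    unfolding to_loc_def using that by (simp add: g(2) hs fc)
  with g(1) show ?thesis by blast
qed

end

end

subsection \<open>Tensor products\<close>

locale tensor = A: kalg A + C: kalg C
  for A :: "('k::field, 'a) module" and C :: "('k, 'c) module"
begin

abbreviation "K \<equiv> monoid_algebra (A \<times>\<times> C) :: ('k, 'a \<times> 'c \<Rightarrow>\<^sub>0 'k) module"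
abbreviation "AC \<equiv> tensor_alg A C"
abbreviation "pt \<equiv> pure_tensor A C"

lemma monoid_DirProd: "monoid (A \<times>\<times> C)"
  by (rule DirProd_monoid[OF A.monoid_axioms C.monoid_axioms])

sublocale K: kalg K by (rule kalg_monoid_algebra[OF monoid_DirProd])

lemma carrier_DirProd [simp]: "carrier (A \<times>\<times> C) = carrier A \<times> carrier C"
  by (simp add: DirProd_def)

lemma tensor_rels_carrier: "tensor_rels A C \<subseteq> carrier K"
  unfolding tensor_rels_def monoid_algebra_simps carrier_DirProd
  by (intro Un_least subsetI; elim CollectE exE conjE; hypsubst; intro CollectI;
      intro keys_diff_subset keys_single_subset; simp)

sublocale AC: kalg AC
  unfolding tensor_alg_def by (rule K.kalg_quot_alg[OF tensor_rels_carrier])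

abbreviation "cls \<equiv> quot_cls K (tensor_rels A C)"

lemmas carrier_AC = K.quot_alg_simps(1)[OF tensor_rels_carrier, folded tensor_alg_def]
lemmas tsimps = K.quot_alg_simps(2-)[OF tensor_rels_carrier, folded tensor_alg_def]
  K.quot_cls_closed[OF tensor_rels_carrier, folded tensor_alg_def]

lemma cls_eqI:
  "f - g \<in> tensor_rels A C \<Longrightarrow> Poly_Mapping.keys f \<subseteq> carrier A \<times> carrier C \<Longrightarrow>
    Poly_Mapping.keys g \<subseteq> carrier A \<times> carrier C \<Longrightarrow> cls f = cls g"
  using monoid_algebra_quot_eqI[OF monoid_DirProd tensor_rels_carrier] by simp

lemma pt_closed [simp, intro]: "a \<in> carrier A \<Longrightarrow> b \<in> carrier C \<Longrightarrow> pt a b \<in> carrier AC"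
  by (simp add: pure_tensor_def tsimps)

lemma pt_one: "pt \<one>\<^bsub>A\<^esub> \<one>\<^bsub>C\<^esub> = \<one>\<^bsub>AC\<^esub>"
  by (simp add: pure_tensor_def tsimps DirProd_def)

lemma pt_mult:
  "a \<in> carrier A \<Longrightarrow> a' \<in> carrier A \<Longrightarrow> b \<in> carrier C \<Longrightarrow> b' \<in> carrier C \<Longrightarrow>
    pt a b \<otimes>\<^bsub>AC\<^esub> pt a' b' = pt (a \<otimes>\<^bsub>A\<^esub> a') (b \<otimes>\<^bsub>C\<^esub> b')"
  by (simp add: pure_tensor_def tsimps)

lemma pt_smult:
  assumes "a \<in> carrier A" "b \<in> carrier C"
  shows "pt (u \<odot>\<^bsub>A\<^esub> a) b = u \<odot>\<^bsub>AC\<^esub> pt a b" "pt a (u \<odot>\<^bsub>C\<^esub> b) = u \<odot>\<^bsub>AC\<^esub> pt a b"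
proof -
  have "Poly_Mapping.single (u \<odot>\<^bsub>A\<^esub> a, b) 1 - Poly_Mapping.single (a, b) u \<in> tensor_rels A C"
    "Poly_Mapping.single (a, u \<odot>\<^bsub>C\<^esub> b) 1 - Poly_Mapping.single (a, b) u \<in> tensor_rels A C"
    unfolding tensor_rels_def using assms by blast+
  note r = this
  show "pt (u \<odot>\<^bsub>A\<^esub> a) b = u \<odot>\<^bsub>AC\<^esub> pt a b"
    unfolding pure_tensor_def using assms by (subst cls_eqI[OF r(1)]) (simp_all add: tsimps)
  show "pt a (u \<odot>\<^bsub>C\<^esub> b) = u \<odot>\<^bsub>AC\<^esub> pt a b"
    unfolding pure_tensor_def using assms by (subst cls_eqI[OF r(2)]) (simp_all add: tsimps)
qed

lemma pt_add_l:
  assumes "a \<in> carrier A" "a' \<in> carrier A" "b \<in> carrier C"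
  shows "pt (a \<oplus>\<^bsub>A\<^esub> a') b = pt a b \<oplus>\<^bsub>AC\<^esub> pt a' b"
proof -
  have *: "Poly_Mapping.single (a \<oplus>\<^bsub>A\<^esub> a', b) 1 - Poly_Mapping.single (a, b) 1 - Poly_Mapping.single (a', b) 1 \<in> tensor_rels A C"
    unfolding tensor_rels_def using assms by blast
  have k: "Poly_Mapping.keys (Poly_Mapping.single (a, b) (1::'k) + Poly_Mapping.single (a', b) 1) \<subseteq> carrier A \<times> carrier C"
    using Poly_Mapping.keys_add[of "Poly_Mapping.single (a, b) (1::'k)" "Poly_Mapping.single (a', b) 1"] assms by auto
  show ?thesis
    unfolding pure_tensor_def
    using cls_eqI[OF *[unfolded diff_diff_eq] _ k] assms by (simp add: tsimps)
qed

lemma pt_add_r: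
  assumes "a \<in> carrier A" "b \<in> carrier C" "b' \<in> carrier C"
  shows "pt a (b \<oplus>\<^bsub>C\<^esub> b') = pt a b \<oplus>\<^bsub>AC\<^esub> pt a b'"
proof -
  have *: "Poly_Mapping.single (a, b \<oplus>\<^bsub>C\<^esub> b') 1 - Poly_Mapping.single (a, b) 1 - Poly_Mapping.single (a, b') 1 \<in> tensor_rels A C"
    unfolding tensor_rels_def using assms by blast
  have k: "Poly_Mapping.keys (Poly_Mapping.single (a, b) (1::'k) + Poly_Mapping.single (a, b') 1) \<subseteq> carrier A \<times> carrier C"
    using Poly_Mapping.keys_add[of "Poly_Mapping.single (a, b) (1::'k)" "Poly_Mapping.single (a, b') 1"] assms by auto
  show ?thesis
    unfolding pure_tensor_def
    using cls_eqI[OF *[unfolded diff_diff_eq] _ k] assms by (simp add: tsimps)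
qed

lemma pt_left_alg_hom: "(\<lambda>a. pt a \<one>\<^bsub>C\<^esub>) \<in> alg_hom A AC"
  by (rule alg_homI) (simp_all add: pt_mult pt_add_l pt_smult pt_one)

lemma pt_right_alg_hom: "pt \<one>\<^bsub>A\<^esub> \<in> alg_hom C AC"
  by (rule alg_homI) (simp_all add: pt_mult pt_add_r pt_smult pt_one)

lemma pt_split:
  assumes "a \<in> carrier A" "b \<in> carrier C"
  shows "pt a b = pt a \<one>\<^bsub>C\<^esub> \<otimes>\<^bsub>AC\<^esub> pt \<one>\<^bsub>A\<^esub> b" "pt a b = pt \<one>\<^bsub>A\<^esub> b \<otimes>\<^bsub>AC\<^esub> pt a \<one>\<^bsub>C\<^esub>"
  using assms by (simp_all add: pt_mult)

text \<open>An element of \<open>tensor_sub\<close> is by definition the class of a finite linear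
  combination of pure tensors. With \<open>D\<close> chosen as a preimage or as a homogeneous part,
  this reduces every claim about \<open>U (x) V\<close> to pure tensors.\<close>

lemma tensor_sub_minimal:
  assumes D: "subalg D AC" and UV: "U \<subseteq> carrier A" "V \<subseteq> carrier C"
    and UVD: "\<And>a b. a \<in> U \<Longrightarrow> b \<in> V \<Longrightarrow> pt a b \<in> D"
  shows "tensor_sub A C U V \<subseteq> D"
proof
  note D' = AC.subalg_ring_closed[OF D]
  fix z assume "z \<in> tensor_sub A C U V"
  then obtain f where f: "Poly_Mapping.keys f \<subseteq> U \<times> V" and z: "z = cls f"
    unfolding tensor_sub_def by blast
  have UV': "U \<times> V \<subseteq> carrier A \<times> carrier C" using UV by blast
  show "z \<in> D" unfolding z using f
  proof (induction rule: poly_mapping_span_induct)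
    case zero
    then show ?case using D'(2) by (simp add: tsimps)
  next
    case (single x c)
    obtain a b where x: "x = (a, b)" by fastforce
    have ab: "a \<in> U" "b \<in> V" "a \<in> carrier A" "b \<in> carrier C" using single UV' unfolding x by blast+
    have "cls (Poly_Mapping.single x c) = c \<odot>\<^bsub>AC\<^esub> pt a b"
      using ab by (simp add: pure_tensor_def tsimps x)
    then show ?case using D'(7)[OF UVD[OF ab(1,2)]] by simp
  next
    case (add f g)
    have "f \<in> carrier K" "g \<in> carrier K" using add(1,2) UV' by auto
    then have "cls (f + g) = cls f \<oplus>\<^bsub>AC\<^esub> cls g" by (simp add: tsimps)
    then show ?case using D'(4) add by simp
  qed
qed

lemma carrier_eq_tensor_sub: "carrier AC = tensor_sub A C (carrier A) (carrier C)"
  unfolding carrier_AC tensor_sub_def by auto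

lemma pt_in_tensor_sub: "a \<in> U \<Longrightarrow> b \<in> V \<Longrightarrow> pt a b \<in> tensor_sub A C U V"
  unfolding tensor_sub_def pure_tensor_def
  by (intro CollectI exI[of _ "Poly_Mapping.single (a, b) 1"]) simp

lemma subalg_tensor_sub:
  assumes U: "subalg U A" and V: "subalg V C"
  shows "subalg (tensor_sub A C U V) AC"
proof (rule AC.subalgI)
  note U' = A.subalg_ring_closed[OF U] and V' = C.subalg_ring_closed[OF V]
  have UV: "U \<times> V \<subseteq> carrier A \<times> carrier C" using U'(1) V'(1) by blast
  show "tensor_sub A C U V \<subseteq> carrier AC"
    unfolding carrier_eq_tensor_sub using UV by (auto simp: tensor_sub_def)
  show "\<one>\<^bsub>AC\<^esub> \<in> tensor_sub A C U V"
    unfolding pt_one[symmetric] by (rule pt_in_tensor_sub) (rule U' V')+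
  fix z assume "z \<in> tensor_sub A C U V"
  then obtain f where f: "Poly_Mapping.keys f \<subseteq> U \<times> V" "z = cls f"
    unfolding tensor_sub_def by blast
  have fK: "f \<in> carrier K" using f UV by auto
  show "c \<odot>\<^bsub>AC\<^esub> z \<in> tensor_sub A C U V" for c
    unfolding f(2) tsimps(5)[OF fK] tensor_sub_def using f(1) keys_map_times[of c f] by auto
  fix w assume "w \<in> tensor_sub A C U V"
  then obtain g where g: "Poly_Mapping.keys g \<subseteq> U \<times> V" "w = cls g"
    unfolding tensor_sub_def by blast
  have gK: "g \<in> carrier K" using g UV by auto
  show "z \<oplus>\<^bsub>AC\<^esub> w \<in> tensor_sub A C U V"
    unfolding f(2) g(2) tsimps(4)[OF fK gK] tensor_sub_def
    using f(1) g(1) Poly_Mapping.keys_add[of f g] by auto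
  \<comment> \<open>Supports multiply componentwise, and both \<open>U\<close> and \<open>V\<close>
    are closed under products.\<close>
  have "Poly_Mapping.keys (f \<otimes>\<^bsub>K\<^esub> g) \<subseteq> U \<times> V"
  proof (rule keys_monoid_algebra_mult)
    fix x y assume "x \<in> Poly_Mapping.keys f" "y \<in> Poly_Mapping.keys g"
    then have "x \<in> U \<times> V" "y \<in> U \<times> V" using f g by blast+
    then show "x \<otimes>\<^bsub>A \<times>\<times> C\<^esub> y \<in> U \<times> V"
      using U'(5) V'(5) by (auto simp: DirProd_def)
  qed
  then show "z \<otimes>\<^bsub>AC\<^esub> w \<in> tensor_sub A C U V"
    unfolding f(2) g(2) tsimps(3)[OF fK gK] tensor_sub_def by blast
qed

lemma tensor_alg_universal:
  fixes T :: "('k, 'b) module"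
  assumes "kalg T" and f: "f \<in> alg_hom A T" and g: "g \<in> alg_hom C T"
    and comm: "\<And>a b. a \<in> carrier A \<Longrightarrow> b \<in> carrier C \<Longrightarrow> f a \<otimes>\<^bsub>T\<^esub> g b = g b \<otimes>\<^bsub>T\<^esub> f a"
  shows "\<exists>h\<in>alg_hom AC T. \<forall>a\<in>carrier A. \<forall>b\<in>carrier C. h (pt a b) = f a \<otimes>\<^bsub>T\<^esub> g b"
proof -
  interpret T: kalg T by fact
  let ?\<phi> = "\<lambda>(a, b). f a \<otimes>\<^bsub>T\<^esub> g b"
  note fc [simp] = alg_homD[OF f] and gc [simp] = alg_homD[OF g]
  have \<phi>: "?\<phi> \<in> carrier (A \<times>\<times> C) \<rightarrow> carrier T" by auto
  have hom: "lin_ext T ?\<phi> \<in> alg_hom K T"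
  proof (rule T.lin_ext_alg_hom[OF monoid_DirProd \<phi>])
    show "?\<phi> \<one>\<^bsub>A \<times>\<times> C\<^esub> = \<one>\<^bsub>T\<^esub>" by (simp add: DirProd_def)
    fix x y assume "x \<in> carrier (A \<times>\<times> C)" "y \<in> carrier (A \<times>\<times> C)"
    then obtain a b a' b' where x: "x = (a, b)" "y = (a', b')"
      and c: "a \<in> carrier A" "b \<in> carrier C" "a' \<in> carrier A" "b' \<in> carrier C" by auto
    \<comment> \<open>Multiplicativity requires moving \<open>g b\<close> past \<open>f a'\<close>;
      this exchange of the two middle factors is where the commutation of the images enters.\<close>
    have "f a \<otimes>\<^bsub>T\<^esub> f a' \<otimes>\<^bsub>T\<^esub> (g b \<otimes>\<^bsub>T\<^esub> g b') = f a \<otimes>\<^bsub>T\<^esub> ((f a' \<otimes>\<^bsub>T\<^esub> g b) \<otimes>\<^bsub>T\<^esub> g b')"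
      using c by (simp add: T.m_assoc del: comm)
    also have "\<dots> = f a \<otimes>\<^bsub>T\<^esub> ((g b \<otimes>\<^bsub>T\<^esub> f a') \<otimes>\<^bsub>T\<^esub> g b')"
      using c by (simp add: comm)
    also have "\<dots> = (f a \<otimes>\<^bsub>T\<^esub> g b) \<otimes>\<^bsub>T\<^esub> (f a' \<otimes>\<^bsub>T\<^esub> g b')"
      using c by (simp add: T.m_assoc)
    finally show "?\<phi> (x \<otimes>\<^bsub>A \<times>\<times> C\<^esub> y) = ?\<phi> x \<otimes>\<^bsub>T\<^esub> ?\<phi> y"
      using c by (simp add: x DirProd_def)
  qed
  note sg = T.lin_ext_single[OF \<phi>] and df = T.lin_ext_diff[OF \<phi>]
  have d1: "lin_ext T ?\<phi> (Poly_Mapping.single v c - Poly_Mapping.single w d) =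
      c \<odot>\<^bsub>T\<^esub> ?\<phi> v \<ominus>\<^bsub>T\<^esub> d \<odot>\<^bsub>T\<^esub> ?\<phi> w" if "v \<in> carrier A \<times> carrier C" "w \<in> carrier A \<times> carrier C" for v w c d
    using that by (simp add: df sg del: split_paired_All)
  have d2: "lin_ext T ?\<phi> (Poly_Mapping.single v c - Poly_Mapping.single w d - Poly_Mapping.single u e) =
      c \<odot>\<^bsub>T\<^esub> ?\<phi> v \<ominus>\<^bsub>T\<^esub> d \<odot>\<^bsub>T\<^esub> ?\<phi> w \<ominus>\<^bsub>T\<^esub> e \<odot>\<^bsub>T\<^esub> ?\<phi> u"
    if "v \<in> carrier A \<times> carrier C" "w \<in> carrier A \<times> carrier C" "u \<in> carrier A \<times> carrier C" for v w u c d e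
    using that by (simp add: df sg keys_diff_subset)
  have "lin_ext T ?\<phi> r = \<zero>\<^bsub>T\<^esub>" if "r \<in> tensor_rels A C" for r
    using that unfolding tensor_rels_def
    by (elim UnE CollectE exE conjE)
      (simp_all add: d1 d2 T.l_distr T.r_distr T.add_minus_minus T.smult_mult_l T.smult_mult_r T.r_neg T.minus_eq[symmetric] T.r_right_minus_eq)
  then obtain h where h: "h \<in> alg_hom AC T" "\<And>r. r \<in> carrier K \<Longrightarrow> h (cls r) = lin_ext T ?\<phi> r"
    using K.quot_alg_universal[OF tensor_rels_carrier \<open>kalg T\<close> hom, folded tensor_alg_def] by blast
  have "h (pt a b) = f a \<otimes>\<^bsub>T\<^esub> g b" if "a \<in> carrier A" "b \<in> carrier C" for a b
    unfolding pure_tensor_def using that sg[of "(a, b)" 1] by (simp add: h(2))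
  with h(1) show ?thesis by blast
qed

end

subsection \<open>Integer powers of units\<close>

context monoid
begin

lemma Units_nat_pow: "y \<in> Units G \<Longrightarrow> y [^] (n::nat) \<in> Units G"
  by (induction n) auto

lemma inv_mult_Units:
  assumes "x \<in> Units G" "y \<in> Units G"
  shows "inv (x \<otimes> y) = inv y \<otimes> inv x"
proof -
  have "(x \<otimes> y) \<otimes> (inv y \<otimes> inv x) = x \<otimes> (y \<otimes> inv y) \<otimes> inv x"
    using assms by (simp add: m_assoc Units_closed del: Units_r_inv)
  then have 1: "(x \<otimes> y) \<otimes> (inv y \<otimes> inv x) = \<one>"
    using assms by (simp add: Units_closed)
  have "(inv y \<otimes> inv x) \<otimes> (x \<otimes> y) = inv y \<otimes> (inv x \<otimes> x) \<otimes> y"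
    using assms by (simp add: m_assoc Units_closed del: Units_l_inv)
  then have 2: "(inv y \<otimes> inv x) \<otimes> (x \<otimes> y) = \<one>"
    using assms by (simp add: Units_closed)
  show ?thesis
    by (rule inv_unique'[OF _ _ 1 2, symmetric]) (use assms in \<open>simp_all add: Units_closed\<close>)
qed

lemma Units_l_cancel_inv:
  "y \<in> Units G \<Longrightarrow> z \<in> carrier G \<Longrightarrow> y \<otimes> (inv y \<otimes> z) = z"
  "y \<in> Units G \<Longrightarrow> z \<in> carrier G \<Longrightarrow> inv y \<otimes> (y \<otimes> z) = z"
  by (simp_all add: Units_closed flip: m_assoc)

lemma int_pow_minus_nat: "y [^] (- int n) = inv (y [^] n)"
  by (subst int_pow_def2) simp

lemma Units_int_pow: "y \<in> Units G \<Longrightarrow> y [^] (k::int) \<in> Units G"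
  by (cases k rule: int_cases2) (simp_all add: int_pow_minus_nat int_pow_int Units_nat_pow)

text \<open>Exponents are only ever changed by one, since a monomial is multiplied by one pivot or
  one inverse at a time. For negative exponents the power is the inverse of a natural power, from
  which a single factor \<open>y\<close> is split off and cancelled.\<close>

lemma Units_int_pow_step:
  assumes y: "y \<in> Units G"
  shows "y \<otimes> y [^] (k::int) = y [^] (k + 1)"
proof (cases k rule: int_cases2)
  case (nonneg n)
  have "k + 1 = int (Suc n)" by (simp add: nonneg)
  then show ?thesis
    unfolding nonneg by (simp only: int_pow_int nat_pow_Suc2[OF Units_closed[OF y]])
next
  case (nonpos n)
  show ?thesis
  proof (cases n)
    case 0
    then show ?thesis using y int_pow_int[of G y 1] by (simp add: nonpos Units_closed)
  next
    case (Suc m)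
    let ?u = "y [^] m"
    have u: "?u \<in> Units G" using y by (rule Units_nat_pow)
    have "y [^] k = inv (?u \<otimes> y)" unfolding nonpos int_pow_minus_nat by (simp add: Suc)
    also have "\<dots> = inv y \<otimes> inv ?u" by (rule inv_mult_Units[OF u y])
    finally have "y \<otimes> y [^] k = inv ?u" using y u by (simp add: Units_l_cancel_inv)
    moreover have "k + 1 = - int m" by (simp add: nonpos Suc)
    ultimately show ?thesis by (simp only: int_pow_minus_nat)
  qed
qed

lemma Units_int_pow_inv_step:
  assumes y: "y \<in> Units G"
  shows "inv y \<otimes> y [^] (k::int) = y [^] (k - 1)"
proof -
  have "y [^] k = y \<otimes> y [^] (k - 1)" using Units_int_pow_step[OF y, of "k - 1"] by simp
  then show ?thesis using y by (simp add: Units_l_cancel_inv Units_closed Units_int_pow)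
qed

lemma Units_inv_commute:
  assumes y: "y \<in> Units G" and z: "z \<in> carrier G" and c: "z \<otimes> y = y \<otimes> z"
  shows "z \<otimes> inv y = inv y \<otimes> z"
proof -
  have "inv y \<otimes> z = inv y \<otimes> (z \<otimes> y) \<otimes> inv y"
    using y z by (simp add: m_assoc Units_closed)
  also have "\<dots> = z \<otimes> inv y" using y z by (simp add: c Units_l_cancel_inv Units_closed)
  finally show ?thesis by simp
qed

lemma Units_int_pow_commute:
  assumes y: "y \<in> Units G" and z: "z \<in> carrier G" and c: "z \<otimes> y = y \<otimes> z"
  shows "z \<otimes> y [^] (k::int) = y [^] k \<otimes> z"
proof (induction k rule: int_induct[where k = 0])
  case base
  then show ?case using z by simp
next
  case (step1 i)
  have "z \<otimes> (y \<otimes> y [^] i) = y \<otimes> (z \<otimes> y [^] i)"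
    using y z c by (simp add: Units_closed Units_int_pow flip: m_assoc)
  also have "\<dots> = (y \<otimes> y [^] i) \<otimes> z"
    using y z step1 by (simp add: Units_closed Units_int_pow m_assoc)
  finally show ?case by (simp add: Units_int_pow_step[OF y])
next
  case (step2 i)
  have "z \<otimes> (inv y \<otimes> y [^] i) = inv y \<otimes> (z \<otimes> y [^] i)"
    using y z Units_inv_commute[OF y z c] by (simp add: Units_closed Units_int_pow flip: m_assoc)
  also have "\<dots> = (inv y \<otimes> y [^] i) \<otimes> z"
    using y z step2 by (simp add: Units_closed Units_int_pow m_assoc)
  finally show ?case by (simp add: Units_int_pow_inv_step[OF y])
qed

end

lemma (in kalg) conj_alg_aut:
  assumes u: "u \<in> Units A"
  shows "(\<lambda>a. u \<otimes> a \<otimes> inv u) \<in> alg_aut A"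
proof -
  have uc: "u \<in> carrier A" using u by (rule Units_closed)
  have mult: "u \<otimes> (a \<otimes> b) \<otimes> inv u = (u \<otimes> a \<otimes> inv u) \<otimes> (u \<otimes> b \<otimes> inv u)"
    if "a \<in> carrier A" "b \<in> carrier A" for a b
    using u uc that by (simp add: m_assoc Units_l_cancel_inv)
  have h: "(\<lambda>a. u \<otimes> a \<otimes> inv u) \<in> alg_hom A A"
  proof (rule alg_homI)
    show "u \<otimes> \<one> \<otimes> inv u = \<one>" using u uc by simp
  qed (use u uc in \<open>simp_all add: mult l_distr r_distr smult_mult_l smult_mult_r\<close>)
  have "bij_betw (\<lambda>a. u \<otimes> a \<otimes> inv u) (carrier A) (carrier A)"
    by (rule bij_betwI[where g = "\<lambda>a. inv u \<otimes> a \<otimes> u"])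
      (use u uc in \<open>auto simp: m_assoc Units_l_cancel_inv\<close>)
  with h show ?thesis by (simp add: alg_aut_def)
qed

subsection \<open>Graded skew-Laurent extensions\<close>

text \<open>\<open>k\<close> times the \<open>l\<close>-th unit vector. Degrees are arbitrary
  functions from \<open>nat\<close> to \<open>int\<close>, an additive group under pointwise
  operations.\<close>

definition udeg :: "nat \<Rightarrow> int \<Rightarrow> nat \<Rightarrow> int" where
  "udeg l k = (\<lambda>j. if j = l then k else 0)"

lemma udeg_add: "udeg l k + udeg l k' = udeg l (k + k')"
  by (auto simp: udeg_def fun_eq_iff)

text \<open>\<open>G d\<close> stands for homogeneous elements of degree \<open>d\<close>.
  \<open>G_direct\<close> carries a separate injective degree map because an exponent is not its own
  degree: members of \<open>{1..t} \<rightarrow>\<^sub>E UNIV\<close> are \<open>undefined\<close>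
  outside \<open>{1..t}\<close>, whereas degrees are 0 there. \<open>conj_inv_S\<close> makes
  conjugation surjective on \<open>S\<close> and lets inverse pivots move past coefficients.
  \<open>gen\<close> says that \<open>S\<close> and the \<open>x l\<close> with their inverses
  generate \<open>A\<close>.\<close>

locale graded_skew_laurent = kalg A for A :: "('k::field, 'a) module" (structure) +
  fixes S :: "'a set" and t :: nat and x :: "nat \<Rightarrow> 'a" and G :: "(nat \<Rightarrow> int) \<Rightarrow> 'a set"
  assumes S: "subalg S A"
    and x_Units: "l \<in> {1..t} \<Longrightarrow> x l \<in> Units A"
    and x_comm: "l \<in> {1..t} \<Longrightarrow> m \<in> {1..t} \<Longrightarrow> x l \<otimes> x m = x m \<otimes> x l"
    and conj_S: "l \<in> {1..t} \<Longrightarrow> a \<in> S \<Longrightarrow> x l \<otimes> a \<otimes> inv (x l) \<in> S"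
    and conj_inv_S: "l \<in> {1..t} \<Longrightarrow> a \<in> S \<Longrightarrow> inv (x l) \<otimes> a \<otimes> x l \<in> S"
    and gen: "\<And>D. subalg D A \<Longrightarrow> S \<subseteq> D \<Longrightarrow>
      (\<And>l. l \<in> {1..t} \<Longrightarrow> x l \<in> D \<and> inv (x l) \<in> D) \<Longrightarrow> carrier A \<subseteq> D"
    and G_mult: "a \<in> G d \<Longrightarrow> b \<in> G d' \<Longrightarrow> a \<otimes> b \<in> G (d + d')"
    and S_deg: "a \<in> S \<Longrightarrow> a \<in> G 0"
    and x_deg: "l \<in> {1..t} \<Longrightarrow> x l \<in> G (udeg l 1)" "l \<in> {1..t} \<Longrightarrow> inv (x l) \<in> G (udeg l (-1))"
    and G_direct: "\<And>(F :: (nat \<Rightarrow> int) set) \<delta> z i. finite F \<Longrightarrow> inj_on \<delta> F \<Longrightarrow> (\<And>i. i \<in> F \<Longrightarrow> z i \<in> G (\<delta> i) \<and> z i \<in> carrier A) \<Longrightarrow>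
      (\<Oplus>i\<in>F. z i) = \<zero> \<Longrightarrow> i \<in> F \<Longrightarrow> z i = \<zero>"
begin

lemmas S_closed = subalg_ring_closed[OF S]

lemma S_carrier: "a \<in> S \<Longrightarrow> a \<in> carrier A" using S_closed(1) by blast

lemma x_carrier: "l \<in> {1..t} \<Longrightarrow> x l \<in> carrier A" using x_Units Units_closed by blast

text \<open>\<open>laurent_monom\<close> along an arbitrary list of indices, so that its properties
  follow by induction on the list.\<close>

definition monl :: "nat list \<Rightarrow> (nat \<Rightarrow> int) \<Rightarrow> 'a" where
  "monl ls m = foldr (\<lambda>i p. x i [^] m i \<otimes> p) ls \<one>"

lemma monl_Cons: "monl (i # ls) m = x i [^] m i \<otimes> monl ls m"
  by (simp add: monl_def)

lemma monl_Units: "set ls \<subseteq> {1..t} \<Longrightarrow> monl ls m \<in> Units A"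
  by (induction ls) (auto simp: monl_def x_Units Units_int_pow)

lemma monl_cong: "(\<And>i. i \<in> set ls \<Longrightarrow> m i = m' i) \<Longrightarrow> monl ls m = monl ls m'"
  by (induction ls) (auto simp: monl_def)

lemma x_int_pow_deg:
  assumes l: "l \<in> {1..t}"
  shows "x l [^] k \<in> G (udeg l k)"
proof (induction k rule: int_induct[where k = 0])
  case base
  have "udeg l 0 = 0" by (auto simp: udeg_def fun_eq_iff)
  moreover have "x l [^] (0::int) = \<one>" by simp
  ultimately show ?case using S_deg[OF S_closed(3)] by (simp only:)
next
  case (step1 i)
  show ?case
    using G_mult[OF x_deg(1)[OF l] step1(2)]
    unfolding Units_int_pow_step[OF x_Units[OF l]] udeg_add add.commute[of 1 i] .
next
  case (step2 i)
  have e: "- 1 + i = i - 1" by simp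
  show ?case
    using G_mult[OF x_deg(2)[OF l] step2(2)]
    unfolding Units_int_pow_inv_step[OF x_Units[OF l]] udeg_add e .
qed

lemma monl_deg:
  assumes "set ls \<subseteq> {1..t}" "distinct ls"
  shows "monl ls m \<in> G (\<lambda>i. if i \<in> set ls then m i else 0)"
  using assms
proof (induction ls)
  case Nil
  have "(\<lambda>i. if i \<in> set [] then m i else 0) = 0" by auto
  moreover have "monl [] m = \<one>" by (simp add: monl_def)
  ultimately show ?case using S_deg[OF S_closed(3)] by (simp only:)
next
  case (Cons l ls)
  have "(\<lambda>i. if i \<in> set (l # ls) then m i else 0) = udeg l (m l) + (\<lambda>i. if i \<in> set ls then m i else 0)"
    using Cons.prems by (auto simp: udeg_def fun_eq_iff)
  then show ?case using Cons G_mult[OF x_int_pow_deg[of l "m l"]] by (simp add: monl_Cons)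
qed

lemma x_monl_commute:
  assumes "i \<in> {1..t}" "l \<in> {1..t}" "z = x l \<or> z = inv (x l)"
  shows "z \<otimes> x i [^] (k::int) = x i [^] k \<otimes> z"
proof (rule Units_int_pow_commute[OF x_Units[OF assms(1)]])
  show "z \<in> carrier A" using assms x_carrier x_Units by auto
  show "z \<otimes> x i = x i \<otimes> z"
    using assms Units_inv_commute[OF x_Units[OF assms(2)] x_carrier[OF assms(1)]]
      x_comm[OF assms(1,2)] by auto
qed

text \<open>The factor commutes past the powers of the other variables until it meets the power of
  \<open>x l\<close>, which it changes by one; distinctness ensures that there is only one such
  power. Both claims are carried through the same induction, which treats \<open>x l\<close> and its
  inverse alike.\<close>

lemma x_monl_step:
  assumes "set ls \<subseteq> {1..t}" "distinct ls" "l \<in> set ls"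
  shows "x l \<otimes> monl ls m = monl ls (m(l := m l + 1))"
    and "inv (x l) \<otimes> monl ls m = monl ls (m(l := m l - 1))"
proof -
  have "x l \<otimes> monl ls m = monl ls (m(l := m l + 1)) \<and> inv (x l) \<otimes> monl ls m = monl ls (m(l := m l - 1))"
    using assms
  proof (induction ls)
    case (Cons i ls)
    have i: "i \<in> {1..t}" and ls: "set ls \<subseteq> {1..t}" and l: "l \<in> {1..t}" using Cons.prems by auto
    have c: "monl ls m \<in> carrier A" "x i [^] m i \<in> carrier A" "x l \<in> carrier A" "inv (x l) \<in> carrier A"
      using monl_Units[OF ls] x_Units[OF l] Units_int_pow[OF x_Units[OF i]] by (auto simp: Units_closed)
    show ?case
    proof (cases "i = l")
      case True
      have "monl ls (m(l := k)) = monl ls m" for k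
        using Cons.prems True by (intro monl_cong) auto
      then have e: "monl (i # ls) (m(l := k)) = x l [^] k \<otimes> monl ls m" for k
        by (simp only: monl_Cons True fun_upd_same)
      have "z \<otimes> monl (i # ls) m = (z \<otimes> x l [^] m l) \<otimes> monl ls m" if "z \<in> carrier A" for z
        using True c that by (simp add: monl_Cons m_assoc)
      then show ?thesis
        unfolding e using c x_Units[OF l] by (simp add: Units_int_pow_step Units_int_pow_inv_step)
    next
      case False
      have ds: "distinct ls" "l \<in> set ls" using Cons.prems False by auto
      have IH: "x l \<otimes> monl ls m = monl ls (m(l := m l + 1))" "inv (x l) \<otimes> monl ls m = monl ls (m(l := m l - 1))"
        using Cons.IH[OF ls ds] by blast+
      have "z \<otimes> (x i [^] m i \<otimes> monl ls m) = x i [^] m i \<otimes> (z \<otimes> monl ls m)"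
        if "z = x l \<or> z = inv (x l)" for z
        using x_monl_commute[OF i l that, of "m i"] c that by (auto simp flip: m_assoc)
      then have "z \<otimes> monl (i # ls) m = x i [^] m i \<otimes> (z \<otimes> monl ls m)" if "z = x l \<or> z = inv (x l)" for z
        using that by (simp add: monl_Cons)
      moreover have "monl (i # ls) (m(l := k)) = x i [^] m i \<otimes> monl ls (m(l := k))" for k
        by (simp only: monl_Cons fun_upd_other[OF False])
      ultimately show ?thesis using IH by (simp only: simp_thms)
    qed
  qed simp
  then show "x l \<otimes> monl ls m = monl ls (m(l := m l + 1))"
    and "inv (x l) \<otimes> monl ls m = monl ls (m(l := m l - 1))" by auto
qed

abbreviation "E \<equiv> {1..t} \<rightarrow>\<^sub>E (UNIV :: int set)"
abbreviation "lmon \<equiv> laurent_monom A t x"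

lemma mon_monl: "lmon m = monl [1..<Suc t] m"
  by (simp add: laurent_monom_def monl_def)

lemma mon_Units: "lmon m \<in> Units A"
  unfolding mon_monl by (rule monl_Units) auto

lemma mon_carrier: "lmon m \<in> carrier A"
  using mon_Units Units_closed by blast

text \<open>Exponents that arise in the span argument are arbitrary functions, while the basis is
  indexed by \<open>E\<close>. Restriction passes from the former to the latter without changing the
  monomial.\<close>

lemma mon_restrict: "lmon (restrict m {1..t}) = lmon m"
  unfolding mon_monl by (rule monl_cong) auto

lemma mon_deg: "lmon m \<in> G (\<lambda>i. if i \<in> {1..t} then m i else 0)"
proof -
  have "set [1..<Suc t] = {1..t}" by auto
  then show ?thesis using monl_deg[of "[1..<Suc t]" m] unfolding mon_monl by simp
qed

lemma mon_step:
  assumes "l \<in> {1..t}"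
  shows "x l \<otimes> lmon m = lmon (m(l := m l + 1))" "inv (x l) \<otimes> lmon m = lmon (m(l := m l - 1))"
  unfolding mon_monl by (rule x_monl_step; use assms in auto)+

text \<open>The left \<open>S\<close>-span of the monomials, as sums in which exponents may repeat.
  Closure properties are then plain inductions, and collecting equal exponents is left to
  \<open>mspan_basis\<close>.\<close>

inductive_set mspan :: "'a set" where
  mspan_zero: "\<zero> \<in> mspan"
| mspan_add: "a \<in> S \<Longrightarrow> z \<in> mspan \<Longrightarrow> a \<otimes> lmon m \<oplus> z \<in> mspan"

lemma mspan_carrier: "z \<in> mspan \<Longrightarrow> z \<in> carrier A"
  by (induction rule: mspan.induct) (auto simp: S_carrier mon_carrier)

lemma mspan_closed_add:
  assumes "z \<in> mspan" "w \<in> mspan"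
  shows "z \<oplus> w \<in> mspan"
  using assms(1)
proof (induction rule: mspan.induct)
  case (mspan_add a z m)
  have "a \<otimes> lmon m \<oplus> z \<oplus> w = a \<otimes> lmon m \<oplus> (z \<oplus> w)"
    using mspan_add assms(2) by (intro a_assoc) (auto simp: S_carrier mon_carrier mspan_carrier)
  then show ?case using mspan.mspan_add[OF mspan_add(1,3)] by simp
qed (use assms mspan_carrier in simp)

lemma mspan_left_mult:
  assumes u: "u \<in> carrier A" and z: "z \<in> mspan"
    and step: "\<And>a m. a \<in> S \<Longrightarrow> \<exists>b\<in>S. \<exists>m'. u \<otimes> (a \<otimes> lmon m) = b \<otimes> lmon m'"
  shows "u \<otimes> z \<in> mspan"
  using z
proof (induction rule: mspan.induct)
  case (mspan_add a z m)
  obtain b m' where b: "b \<in> S" "u \<otimes> (a \<otimes> lmon m) = b \<otimes> lmon m'" using step[OF mspan_add(1)] by blast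
  have "u \<otimes> (a \<otimes> lmon m \<oplus> z) = b \<otimes> lmon m' \<oplus> u \<otimes> z"
    using u mspan_add by (simp add: r_distr S_carrier mon_carrier mspan_carrier b)
  then show ?case using mspan.mspan_add[OF b(1) mspan_add(3)] by simp
qed (use u mspan_zero in simp)

lemma mspan_smult: "z \<in> mspan \<Longrightarrow> c \<odot> z \<in> mspan"
proof (induction rule: mspan.induct)
  case (mspan_add a z m)
  have "c \<odot> (a \<otimes> lmon m \<oplus> z) = (c \<odot> a) \<otimes> lmon m \<oplus> c \<odot> z"
    using mspan_add by (simp add: smult_r_distr smult_mult_l S_carrier mon_carrier mspan_carrier)
  then show ?case using mspan.mspan_add[OF S_closed(7)[OF mspan_add(1)] mspan_add(3)] by simp
qed (simp add: mspan_zero)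

text \<open>The elements whose left multiplication preserves the span form a subalgebra. It contains
  \<open>S\<close>, and it contains each \<open>x l\<close> and its inverse because conjugation
  moves them past coefficients; by \<open>gen\<close> it is all of \<open>A\<close>. Applied to 1,
  which is a monomial, this gives the claim.\<close>

lemma carrier_mspan:
  assumes b: "b \<in> carrier A"
  shows "b \<in> mspan"
proof -
  let ?D = "{b \<in> carrier A. \<forall>z\<in>mspan. b \<otimes> z \<in> mspan}"
  have "subalg ?D A"
  proof (rule subalgI)
    fix a b assume "a \<in> ?D" "b \<in> ?D"
    then show "a \<oplus> b \<in> ?D" "a \<otimes> b \<in> ?D"
      by (auto simp: l_distr m_assoc mspan_carrier mspan_closed_add)
  next
    fix a c assume "a \<in> ?D"
    then show "c \<odot> a \<in> ?D" by (auto simp: smult_mult_l mspan_carrier mspan_smult)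
  qed (auto simp: mspan_carrier)
  moreover have "S \<subseteq> ?D"
  proof (intro subsetI CollectI conjI ballI)
    show "a \<in> carrier A" if "a \<in> S" for a using that by (rule S_carrier)
    show "a \<otimes> z \<in> mspan" if a: "a \<in> S" and z: "z \<in> mspan" for a z
    proof (rule mspan_left_mult[OF S_carrier[OF a] z])
      fix b m assume b: "b \<in> S"
      have "a \<otimes> (b \<otimes> lmon m) = (a \<otimes> b) \<otimes> lmon m"
        using a b by (simp add: m_assoc S_carrier mon_carrier)
      then show "\<exists>b'\<in>S. \<exists>m'. a \<otimes> (b \<otimes> lmon m) = b' \<otimes> lmon m'" using S_closed(5)[OF a b] by blast
    qed
  qed
  moreover have "x l \<in> ?D \<and> inv (x l) \<in> ?D" if l: "l \<in> {1..t}" for l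
  proof safe
    note u = x_Units[OF l] and uc = x_carrier[OF l]
    show c: "x l \<in> carrier A" "inv (x l) \<in> carrier A" using u by auto
    fix z assume z: "z \<in> mspan"
    show "x l \<otimes> z \<in> mspan"
    proof (rule mspan_left_mult[OF c(1) z])
      fix a m assume a: "a \<in> S"
      \<comment> \<open>The pivot is pulled through the coefficient at the cost of conjugating it,
        and is then absorbed into the monomial.\<close>
      have "x l \<otimes> (a \<otimes> lmon m) = (x l \<otimes> a \<otimes> inv (x l)) \<otimes> (x l \<otimes> lmon m)"
        using c u a by (simp add: m_assoc S_carrier mon_carrier Units_l_cancel_inv)
      then show "\<exists>b\<in>S. \<exists>m'. x l \<otimes> (a \<otimes> lmon m) = b \<otimes> lmon m'"
        using conj_S[OF l a] unfolding mon_step[OF l] by blast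
    qed
    show "inv (x l) \<otimes> z \<in> mspan"
    proof (rule mspan_left_mult[OF c(2) z])
      fix a m assume a: "a \<in> S"
      have "inv (x l) \<otimes> (a \<otimes> lmon m) = (inv (x l) \<otimes> a \<otimes> x l) \<otimes> (inv (x l) \<otimes> lmon m)"
        using c u a by (simp add: m_assoc S_carrier mon_carrier Units_l_cancel_inv)
      then show "\<exists>b\<in>S. \<exists>m'. inv (x l) \<otimes> (a \<otimes> lmon m) = b \<otimes> lmon m'"
        using conj_inv_S[OF l a] unfolding mon_step[OF l] by blast
    qed
  qed
  ultimately have D: "carrier A \<subseteq> ?D" by (rule gen)
  \<comment> \<open>The zero exponent gives the product of trivial powers, so 1 lies in the
    span.\<close>
  have "lmon (\<lambda>_. 0) = \<one>"
  proof -
    have "monl ls (\<lambda>_. 0) = \<one>" for ls by (induction ls) (auto simp: monl_def)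
    then show ?thesis by (simp add: mon_monl)
  qed
  then have "\<one> \<in> mspan" using mspan_add[OF S_closed(3) mspan_zero, of "\<lambda>_. 0"] by simp
  then have "b \<otimes> \<one> \<in> mspan" using D b by blast
  with b show "b \<in> mspan" by simp
qed

text \<open>Equal exponents are merged one term at a time: the coefficient is added to an existing
  one if the exponent already occurs, and otherwise the index set grows by one.\<close>

lemma mspan_basis:
  assumes "z \<in> mspan"
  shows "\<exists>F a. finite F \<and> F \<subseteq> E \<and> a \<in> F \<rightarrow> S \<and> z = (\<Oplus>i\<in>F. a i \<otimes> lmon i)"
  using assms
proof (induction rule: mspan.induct)
  case mspan_zero
  show ?case by (intro exI[of _ "{}"]) simp
next
  case (mspan_add b z m0)
  define m where "m = restrict m0 {1..t}"
  have m: "m \<in> E" "lmon m0 = lmon m" unfolding m_def mon_restrict by auto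
  obtain F a where F: "finite F" "F \<subseteq> E" "a \<in> F \<rightarrow> S" "z = (\<Oplus>i\<in>F. a i \<otimes> lmon i)"
    using mspan_add by blast
  have bc: "b \<in> carrier A" "b \<otimes> lmon m \<in> carrier A" using mspan_add(1) S_carrier mon_carrier by auto
  have ac: "a i \<otimes> lmon i \<in> carrier A" "a i \<in> carrier A" if "i \<in> F" for i
    using that F(3) S_carrier mon_carrier by auto
  show ?case
  proof (cases "m \<in> F")
    case True
    let ?F = "F - {m}" let ?a = "a(m := b \<oplus> a m)"
    have Fm: "F = insert m ?F" using True by blast
    have s: "(\<Oplus>i\<in>?F. ?a i \<otimes> lmon i) = (\<Oplus>i\<in>?F. a i \<otimes> lmon i)"
      using ac by (intro finsum_cong') auto
    have sc: "(\<Oplus>i\<in>?F. a i \<otimes> lmon i) \<in> carrier A" using ac by (intro finsum_closed) auto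
    have "(\<Oplus>i\<in>F. ?a i \<otimes> lmon i) = ?a m \<otimes> lmon m \<oplus> (\<Oplus>i\<in>?F. ?a i \<otimes> lmon i)"
      using F(1) ac bc True by (subst Fm, subst finsum_insert) (auto simp: mon_carrier)
    also have "\<dots> = b \<otimes> lmon m \<oplus> (a m \<otimes> lmon m \<oplus> (\<Oplus>i\<in>?F. a i \<otimes> lmon i))"
      using ac[OF True] bc sc unfolding s by (simp add: l_distr mon_carrier a_assoc)
    also have "a m \<otimes> lmon m \<oplus> (\<Oplus>i\<in>?F. a i \<otimes> lmon i) = z"
      unfolding F(4) using F(1) ac True by (subst (2) Fm, subst finsum_insert) auto
    finally have "b \<otimes> lmon m0 \<oplus> z = (\<Oplus>i\<in>F. ?a i \<otimes> lmon i)" using m by simp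
    moreover have "?a \<in> F \<rightarrow> S" using F(3) True mspan_add(1) S_closed(4) by (simp add: Pi_iff)
    ultimately show ?thesis using F by blast
  next
    case False
    let ?a = "a(m := b)"
    have s: "(\<Oplus>i\<in>F. ?a i \<otimes> lmon i) = z"
      unfolding F(4) using ac False by (intro finsum_cong') auto
    have "(\<Oplus>i\<in>insert m F. ?a i \<otimes> lmon i) = ?a m \<otimes> lmon m \<oplus> (\<Oplus>i\<in>F. ?a i \<otimes> lmon i)"
      by (rule finsum_insert) (use F(1) False ac bc in \<open>auto simp: mon_carrier\<close>)
    then have "(\<Oplus>i\<in>insert m F. ?a i \<otimes> lmon i) = b \<otimes> lmon m \<oplus> z"
      unfolding s fun_upd_same .
    then have "b \<otimes> lmon m0 \<oplus> z = (\<Oplus>i\<in>insert m F. ?a i \<otimes> lmon i)" using m by simp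
    moreover have "?a \<in> insert m F \<rightarrow> S" using F(3) mspan_add(1) by auto
    moreover have "finite (insert m F)" "insert m F \<subseteq> E" using F m by auto
    ultimately show ?thesis by blast
  qed
qed

text \<open>\<open>\<eta>\<close> is prescribed on \<open>S\<close> alone, so it may be the
  restriction of an automorphism of a larger algebra. Conjugation by the inverse provides the
  inverse map on \<open>S\<close>.\<close>

theorem skew_laurent:
  assumes \<eta>: "\<And>l a. l \<in> {1..t} \<Longrightarrow> a \<in> S \<Longrightarrow> \<eta> l a = x l \<otimes> a \<otimes> inv (x l)"
  shows "skew_laurent A S t x \<eta>"
  unfolding skew_laurent_def
proof (intro conjI ballI)
  show "ring A" by (rule ring_axioms)
  show "subring S A" using S by (simp add: subalg_def)
  show "x i \<in> Units A" if "i \<in> {1..t}" for i using that by (rule x_Units)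
  show "x i \<otimes> x j = x j \<otimes> x i" if "i \<in> {1..t}" "j \<in> {1..t}" for i j using that by (rule x_comm)
  show "x l \<otimes> a = \<eta> l a \<otimes> x l" if "l \<in> {1..t}" "a \<in> S" for l a
    using that x_Units[OF that(1)] by (simp add: \<eta> m_assoc x_carrier S_carrier)
  show "\<eta> l \<in> ring_iso (A\<lparr>carrier := S\<rparr>) (A\<lparr>carrier := S\<rparr>)" if l: "l \<in> {1..t}" for l
  proof -
    note u = x_Units[OF l] and uc = x_carrier[OF l]
    have h: "(\<lambda>a. x l \<otimes> a \<otimes> inv (x l)) \<in> alg_hom A A"
      using conj_alg_aut[OF u] by (simp add: alg_aut_def)
    have "\<eta> l \<in> ring_hom (A\<lparr>carrier := S\<rparr>) (A\<lparr>carrier := S\<rparr>)"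
      by (rule ring_hom_memI)
        (use S_closed(3) alg_homD[OF h] in \<open>simp_all add: \<eta>[OF l] conj_S[OF l] S_closed S_carrier\<close>)
    moreover have "bij_betw (\<eta> l) S S"
    proof (rule bij_betwI[where g = "\<lambda>a. inv (x l) \<otimes> a \<otimes> x l"])
      fix a assume a: "a \<in> S"
      show "inv (x l) \<otimes> \<eta> l a \<otimes> x l = a"
        using a u uc by (simp add: \<eta>[OF l] m_assoc S_carrier Units_l_cancel_inv)
      show "\<eta> l (inv (x l) \<otimes> a \<otimes> x l) = a"
        using conj_inv_S[OF l a] a u uc by (simp add: \<eta>[OF l] m_assoc S_carrier Units_l_cancel_inv)
    qed (use \<eta>[OF l] conj_S[OF l] conj_inv_S[OF l] in auto)
    ultimately show ?thesis by (simp add: ring_iso_def)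
  qed
  show "left_basis A S E lmon"
    unfolding left_basis_def
  proof (intro conjI ballI allI impI)
    show "lmon \<in> E \<rightarrow> carrier A" using mon_carrier by auto
    show "\<exists>F a. finite F \<and> F \<subseteq> E \<and> a \<in> F \<rightarrow> S \<and> b = (\<Oplus>i\<in>F. a i \<otimes> lmon i)" if "b \<in> carrier A" for b
      using mspan_basis[OF carrier_mspan[OF that]] .
    fix F a i assume F: "finite F" "F \<subseteq> E" "a \<in> F \<rightarrow> S" "(\<Oplus>i\<in>F. a i \<otimes> lmon i) = \<zero>" and i: "i \<in> F"
    let ?\<delta> = "\<lambda>m::nat \<Rightarrow> int. \<lambda>i. if i \<in> {1..t} then m i else 0"
    \<comment> \<open>Members of \<open>E\<close> agree outside \<open>{1..t}\<close>, hence an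
      exponent is recovered from its degree, where the outside values are replaced by 0.\<close>
    have "inj_on ?\<delta> F"
    proof (rule inj_onI)
      fix m m' assume m: "m \<in> F" "m' \<in> F" "?\<delta> m = ?\<delta> m'"
      show "m = m'"
      proof (rule PiE_ext)
        show "m \<in> E" "m' \<in> E" using m F(2) by blast+
        show "m i = m' i" if "i \<in> {1..t}" for i using fun_cong[OF m(3), of i] that by simp
      qed
    qed
    moreover have "a i \<otimes> lmon i \<in> G (?\<delta> i) \<and> a i \<otimes> lmon i \<in> carrier A" if "i \<in> F" for i
    proof -
      have "a i \<in> S" using that F(3) by blast
      then show ?thesis using G_mult[OF S_deg mon_deg, of "a i" i] S_carrier mon_carrier by simp
    qed
    ultimately have "a i \<otimes> lmon i = \<zero>" using G_direct[OF F(1) _ _ F(4) i, of ?\<delta>] by blast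
    \<comment> \<open>The terms of a vanishing sum have different degrees and vanish one by one; the
      monomial is a unit and can be cancelled.\<close>
    then have "a i \<otimes> lmon i \<otimes> inv (lmon i) = \<zero>" using mon_Units by simp
    moreover have "a i \<in> carrier A" using i F(3) S_carrier by blast
    ultimately show "a i = \<zero>" using mon_Units mon_carrier by (simp add: m_assoc)
  qed
qed

end

subsection \<open>Endomorphisms of sequence spaces and shift operators\<close>

definition seqs :: "('k::field, 'a) module \<Rightarrow> ('d \<Rightarrow> 'a) set" where
  "seqs R = {f. \<forall>d. f d \<in> carrier R}"

text \<open>The linear endomorphisms of the space of all families. Operators are extensional so that
  those agreeing on \<open>seqs R\<close> are equal; each operation therefore restricts its result
  to \<open>seqs R\<close> again.\<close>

definition end_alg :: "('k::field, 'a) module \<Rightarrow> ('k, ('d \<Rightarrow> 'a) \<Rightarrow> 'd \<Rightarrow> 'a) module" where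
  "end_alg R =
     \<lparr>carrier = {E \<in> extensional (seqs R). (\<forall>f\<in>seqs R. E f \<in> seqs R) \<and>
        (\<forall>f\<in>seqs R. \<forall>g\<in>seqs R. E (\<lambda>d. f d \<oplus>\<^bsub>R\<^esub> g d) = (\<lambda>d. E f d \<oplus>\<^bsub>R\<^esub> E g d)) \<and>
        (\<forall>c. \<forall>f\<in>seqs R. E (\<lambda>d. c \<odot>\<^bsub>R\<^esub> f d) = (\<lambda>d. c \<odot>\<^bsub>R\<^esub> E f d))},
      mult = (\<lambda>E F. \<lambda>f\<in>seqs R. E (F f)),
      one = (\<lambda>f\<in>seqs R. f),
      zero = (\<lambda>f\<in>seqs R. \<lambda>d. \<zero>\<^bsub>R\<^esub>),
      add = (\<lambda>E F. \<lambda>f\<in>seqs R. \<lambda>d. E f d \<oplus>\<^bsub>R\<^esub> F f d),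
      smult = (\<lambda>c E. \<lambda>f\<in>seqs R. \<lambda>d. c \<odot>\<^bsub>R\<^esub> E f d)\<rparr>"

definition shift :: "('k::field, 'a) module \<Rightarrow> 'a \<Rightarrow> 'd \<Rightarrow> ('d \<Rightarrow> 'a) \<Rightarrow> 'd::ab_group_add \<Rightarrow> 'a" where
  "shift R z e = (\<lambda>f\<in>seqs R. \<lambda>d. z \<otimes>\<^bsub>R\<^esub> f (d - e))"

context kalg
begin

lemma seqs_apply: "f \<in> seqs A \<Longrightarrow> f d \<in> carrier A"
  by (simp add: seqs_def)

lemma end_alg_dest:
  assumes "E \<in> carrier (end_alg A)"
  shows "E \<in> extensional (seqs A)"
    and "f \<in> seqs A \<Longrightarrow> E f \<in> seqs A"
    and "f \<in> seqs A \<Longrightarrow> g \<in> seqs A \<Longrightarrow> E (\<lambda>d. f d \<oplus> g d) = (\<lambda>d. E f d \<oplus> E g d)"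
    and "f \<in> seqs A \<Longrightarrow> E (\<lambda>d. c \<odot> f d) = (\<lambda>d. c \<odot> E f d)"
  using assms by (simp_all add: end_alg_def)

lemma end_alg_carrierI:
  assumes "E \<in> extensional (seqs A)"
    and "\<And>f. f \<in> seqs A \<Longrightarrow> E f \<in> seqs A"
    and "\<And>f g. f \<in> seqs A \<Longrightarrow> g \<in> seqs A \<Longrightarrow> E (\<lambda>d. f d \<oplus> g d) = (\<lambda>d. E f d \<oplus> E g d)"
    and "\<And>f c. f \<in> seqs A \<Longrightarrow> E (\<lambda>d. c \<odot> f d) = (\<lambda>d. c \<odot> E f d)"
  shows "E \<in> carrier (end_alg A)"
  using assms by (simp add: end_alg_def)

lemma seqs_closed [simp]:
  "f \<in> seqs A \<Longrightarrow> g \<in> seqs A \<Longrightarrow> (\<lambda>d. f d \<oplus> g d) \<in> seqs A"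
  "f \<in> seqs A \<Longrightarrow> (\<lambda>d. c \<odot> f d) \<in> seqs A"
  "(\<lambda>d. \<zero>) \<in> seqs A"
  "f \<in> seqs A \<Longrightarrow> (\<lambda>d. \<ominus> f d) \<in> seqs A"
  "z \<in> carrier A \<Longrightarrow> f' \<in> seqs A \<Longrightarrow> (\<lambda>d. z \<otimes> f' (d - e)) \<in> seqs A"
  by (simp_all add: seqs_def)

lemma end_alg_ops:
  "E \<otimes>\<^bsub>end_alg A\<^esub> F = (\<lambda>f\<in>seqs A. E (F f))"
  "\<one>\<^bsub>end_alg A\<^esub> = (\<lambda>f\<in>seqs A. f)"
  "\<zero>\<^bsub>end_alg A\<^esub> = (\<lambda>f\<in>seqs A. \<lambda>d. \<zero>)"
  "E \<oplus>\<^bsub>end_alg A\<^esub> F = (\<lambda>f\<in>seqs A. \<lambda>d. E f d \<oplus> F f d)"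
  "c \<odot>\<^bsub>end_alg A\<^esub> E = (\<lambda>f\<in>seqs A. \<lambda>d. c \<odot> E f d)"
  by (simp_all add: end_alg_def)

lemma end_alg_eqI:
  assumes "E \<in> extensional (seqs A)" "F \<in> extensional (seqs A)"
    and "\<And>f d. f \<in> seqs A \<Longrightarrow> E f d = F f d"
  shows "E = F"
  using assms by (intro extensionalityI[OF assms(1,2)]) auto

lemma end_alg_closed:
  assumes E: "E \<in> carrier (end_alg A)" and F: "F \<in> carrier (end_alg A)"
  shows "E \<otimes>\<^bsub>end_alg A\<^esub> F \<in> carrier (end_alg A)"
    and "E \<oplus>\<^bsub>end_alg A\<^esub> F \<in> carrier (end_alg A)"
    and "c \<odot>\<^bsub>end_alg A\<^esub> E \<in> carrier (end_alg A)"
    and "(\<lambda>f\<in>seqs A. \<lambda>d. \<ominus> E f d) \<in> carrier (end_alg A)"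
proof -
  note e = end_alg_dest[OF E] and f = end_alg_dest[OF F]
  have ec: "E g d \<in> carrier A" if "g \<in> seqs A" for g d
    using e(2)[OF that] by (rule seqs_apply)
  have fc: "F g d \<in> carrier A" if "g \<in> seqs A" for g d
    using f(2)[OF that] by (rule seqs_apply)
  show "E \<otimes>\<^bsub>end_alg A\<^esub> F \<in> carrier (end_alg A)"
    unfolding end_alg_ops by (rule end_alg_carrierI) (simp_all add: e(2-) f(2-))
  show "E \<oplus>\<^bsub>end_alg A\<^esub> F \<in> carrier (end_alg A)"
    unfolding end_alg_ops
    by (rule end_alg_carrierI) (simp_all add: e(2-) f(2-) fun_eq_iff ec fc a_ac smult_r_distr)
  show "c \<odot>\<^bsub>end_alg A\<^esub> E \<in> carrier (end_alg A)"
    unfolding end_alg_ops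
    by (rule end_alg_carrierI) (simp_all add: e(2-) fun_eq_iff ec smult_r_distr smult_smult mult.commute)
  have m: "c \<odot> (\<ominus> a) = \<ominus> (c \<odot> a)" if "a \<in> carrier A" for a c
    using that smult_smult[OF that, of c "-1"] smult_minus_l[OF that, of c]
    by (simp flip: smult_minus_one)
  show "(\<lambda>f\<in>seqs A. \<lambda>d. \<ominus> E f d) \<in> carrier (end_alg A)"
    by (rule end_alg_carrierI) (simp_all add: e(2-) fun_eq_iff ec m minus_add)
qed

lemma kalg_end_alg: "kalg (end_alg A :: ('k, ('d \<Rightarrow> 'a) \<Rightarrow> 'd \<Rightarrow> 'a) module)"
proof -
  let ?T = "end_alg A :: ('k, ('d \<Rightarrow> 'a) \<Rightarrow> 'd \<Rightarrow> 'a) module"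
  have c: "E f d \<in> carrier A" "E f \<in> seqs A" if "E \<in> carrier ?T" "f \<in> seqs A" for E f d
    using end_alg_dest(2)[OF that] by (simp_all add: seqs_apply)
  have ex: "E \<in> extensional (seqs A)" if "E \<in> carrier ?T" for E
    using end_alg_dest(1)[OF that] .
  show ?thesis
  proof (rule kalgI)
    show "abelian_group ?T"
    proof (rule abelian_groupI)
      fix E assume E: "E \<in> carrier ?T"
      show "\<exists>F\<in>carrier ?T. F \<oplus>\<^bsub>?T\<^esub> E = \<zero>\<^bsub>?T\<^esub>"
        by (rule bexI[OF _ end_alg_closed(4)[OF E E]], rule end_alg_eqI)
          (simp_all add: end_alg_ops c[OF E] l_neg)
      show "\<zero>\<^bsub>?T\<^esub> \<oplus>\<^bsub>?T\<^esub> E = E"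
        by (rule end_alg_eqI) (simp_all add: end_alg_ops ex[OF E] c[OF E])
    next
      show "\<zero>\<^bsub>?T\<^esub> \<in> carrier ?T"
        unfolding end_alg_ops by (rule end_alg_carrierI) simp_all
    next
      fix E F H assume E: "E \<in> carrier ?T" and F: "F \<in> carrier ?T" and H: "H \<in> carrier ?T"
      show "E \<oplus>\<^bsub>?T\<^esub> F \<oplus>\<^bsub>?T\<^esub> H = E \<oplus>\<^bsub>?T\<^esub> (F \<oplus>\<^bsub>?T\<^esub> H)"
        by (rule end_alg_eqI) (simp_all add: end_alg_ops c[OF E] c[OF F] c[OF H] a_assoc)
    next
      fix E F assume E: "E \<in> carrier ?T" and F: "F \<in> carrier ?T"
      show "E \<oplus>\<^bsub>?T\<^esub> F \<in> carrier ?T" using end_alg_closed(2)[OF E F] .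
      show "E \<oplus>\<^bsub>?T\<^esub> F = F \<oplus>\<^bsub>?T\<^esub> E"
        by (rule end_alg_eqI) (simp_all add: end_alg_ops c[OF E] c[OF F] a_comm)
    qed
    show "monoid ?T"
    proof (rule monoidI)
      show "\<one>\<^bsub>?T\<^esub> \<in> carrier ?T"
        unfolding end_alg_ops by (rule end_alg_carrierI) simp_all
    next
      fix E assume E: "E \<in> carrier ?T"
      show "\<one>\<^bsub>?T\<^esub> \<otimes>\<^bsub>?T\<^esub> E = E" "E \<otimes>\<^bsub>?T\<^esub> \<one>\<^bsub>?T\<^esub> = E"
        by (rule end_alg_eqI; simp add: end_alg_ops ex[OF E] c[OF E])+
    next
      fix E F assume E: "E \<in> carrier ?T" and F: "F \<in> carrier ?T"
      show "E \<otimes>\<^bsub>?T\<^esub> F \<in> carrier ?T" using end_alg_closed(1)[OF E F] .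
    next
      fix E F H assume E: "E \<in> carrier ?T" and F: "F \<in> carrier ?T" and H: "H \<in> carrier ?T"
      show "E \<otimes>\<^bsub>?T\<^esub> F \<otimes>\<^bsub>?T\<^esub> H = E \<otimes>\<^bsub>?T\<^esub> (F \<otimes>\<^bsub>?T\<^esub> H)"
        by (rule end_alg_eqI) (simp_all add: end_alg_ops c[OF E] c[OF F] c[OF H])
    qed
    fix E F assume E: "E \<in> carrier ?T" and F: "F \<in> carrier ?T"
    show "(c \<odot>\<^bsub>?T\<^esub> E) \<otimes>\<^bsub>?T\<^esub> F = c \<odot>\<^bsub>?T\<^esub> (E \<otimes>\<^bsub>?T\<^esub> F)" "E \<otimes>\<^bsub>?T\<^esub> (c \<odot>\<^bsub>?T\<^esub> F) = c \<odot>\<^bsub>?T\<^esub> (E \<otimes>\<^bsub>?T\<^esub> F)"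
      "c \<odot>\<^bsub>?T\<^esub> (E \<oplus>\<^bsub>?T\<^esub> F) = c \<odot>\<^bsub>?T\<^esub> E \<oplus>\<^bsub>?T\<^esub> c \<odot>\<^bsub>?T\<^esub> F" for c
      by (rule end_alg_eqI; simp add: end_alg_ops c[OF E] c[OF F] end_alg_dest(4)[OF E] smult_r_distr)+
    fix H assume H: "H \<in> carrier ?T"
    show "(E \<oplus>\<^bsub>?T\<^esub> F) \<otimes>\<^bsub>?T\<^esub> H = E \<otimes>\<^bsub>?T\<^esub> H \<oplus>\<^bsub>?T\<^esub> F \<otimes>\<^bsub>?T\<^esub> H"
      "H \<otimes>\<^bsub>?T\<^esub> (E \<oplus>\<^bsub>?T\<^esub> F) = H \<otimes>\<^bsub>?T\<^esub> E \<oplus>\<^bsub>?T\<^esub> H \<otimes>\<^bsub>?T\<^esub> F"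
      by (rule end_alg_eqI; simp add: end_alg_ops c[OF E] c[OF F] c[OF H] end_alg_dest(3)[OF H])+
  next
    fix E and a b :: 'k assume E: "E \<in> carrier ?T"
    show "a \<odot>\<^bsub>?T\<^esub> E \<in> carrier ?T" using end_alg_closed(3)[OF E E] .
    show "(a + b) \<odot>\<^bsub>?T\<^esub> E = a \<odot>\<^bsub>?T\<^esub> E \<oplus>\<^bsub>?T\<^esub> b \<odot>\<^bsub>?T\<^esub> E" "a \<odot>\<^bsub>?T\<^esub> (b \<odot>\<^bsub>?T\<^esub> E) = (a * b) \<odot>\<^bsub>?T\<^esub> E"
      "1 \<odot>\<^bsub>?T\<^esub> E = E"
      by (rule end_alg_eqI; simp add: end_alg_ops c[OF E] ex[OF E] smult_l_distr smult_smult)+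
  qed
qed

lemma shift_apply: "f \<in> seqs A \<Longrightarrow> shift A z e f = (\<lambda>d. z \<otimes> f (d - e))"
  by (simp add: shift_def)

lemma shift_closed: "z \<in> carrier A \<Longrightarrow> shift A z e \<in> carrier (end_alg A)"
  by (rule end_alg_carrierI)
    (simp_all add: shift_def fun_eq_iff r_distr smult_mult_r seqs_apply)

lemma shift_mult:
  "z \<in> carrier A \<Longrightarrow> w \<in> carrier A \<Longrightarrow> shift A z d \<otimes>\<^bsub>end_alg A\<^esub> shift A w e = shift A (z \<otimes> w) (d + e)"
  by (rule end_alg_eqI)
    (simp_all add: end_alg_ops shift_def m_assoc seqs_apply diff_diff_eq)

lemma shift_add:
  "z \<in> carrier A \<Longrightarrow> w \<in> carrier A \<Longrightarrow> shift A z d \<oplus>\<^bsub>end_alg A\<^esub> shift A w d = shift A (z \<oplus> w) d"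
  by (rule end_alg_eqI) (simp_all add: end_alg_ops shift_def l_distr seqs_apply)

lemma shift_smult: "z \<in> carrier A \<Longrightarrow> c \<odot>\<^bsub>end_alg A\<^esub> shift A z d = shift A (c \<odot> z) d"
  by (rule end_alg_eqI) (simp_all add: end_alg_ops shift_def smult_mult_l seqs_apply)

lemma shift_one: "shift A \<one> 0 = \<one>\<^bsub>end_alg A\<^esub>"
  by (rule end_alg_eqI) (simp_all add: end_alg_ops shift_def seqs_apply)

lemma shift_zero: "shift A \<zero> d = \<zero>\<^bsub>end_alg A\<^esub>"
  by (rule end_alg_eqI) (simp_all add: end_alg_ops shift_def seqs_apply)

lemma shift_inverse:
  assumes z: "z \<in> Units A"
  shows "shift A z d \<in> Units (end_alg A)" "inv\<^bsub>end_alg A\<^esub> shift A z d = shift A (inv z) (- d)"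
proof -
  interpret T: kalg "end_alg A :: ('k, ('b \<Rightarrow> 'a) \<Rightarrow> 'b \<Rightarrow> 'a) module" by (rule kalg_end_alg)
  have 1: "shift A z d \<otimes>\<^bsub>end_alg A\<^esub> shift A (inv z) (- d) = \<one>\<^bsub>end_alg A\<^esub>"
    "shift A (inv z) (- d) \<otimes>\<^bsub>end_alg A\<^esub> shift A z d = \<one>\<^bsub>end_alg A\<^esub>"
    using z by (simp_all add: shift_mult Units_closed shift_one)
  have 2: "shift A z d \<in> carrier (end_alg A)" "shift A (inv z) (- d) \<in> carrier (end_alg A)"
    using z by (simp_all add: shift_closed Units_closed)
  show "shift A z d \<in> Units (end_alg A)" using 1 2 unfolding Units_def by blast
  show "inv\<^bsub>end_alg A\<^esub> shift A z d = shift A (inv z) (- d)"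
    by (rule T.inv_unique'[OF 2 1, symmetric])
qed

text \<open>The shift operator of \<open>z\<close> with degree \<open>d\<close>, applied to the
  family \<open>u\<close> concentrated in degree 0 with value 1, is concentrated in degree
  \<open>d\<close> with value \<open>z\<close>. The component in degree \<open>\<delta> i\<close> of
  a vanishing sum is therefore \<open>z i\<close>. \<open>R\<close> is kept apart from
  \<open>A\<close> so that \<open>R\<close> may be a subalgebra while the operators act on families
  in the ambient algebra.\<close>

lemma shift_direct:
  fixes \<delta> :: "'i \<Rightarrow> 'd::ab_group_add" and R :: "('k, 'a) module"
  assumes R: "kalg R" and f: "f \<in> alg_hom R (end_alg A)"
    and F: "finite F" "inj_on \<delta> F"
    and z: "\<And>i. i \<in> F \<Longrightarrow> z i \<in> carrier R" "\<And>i. i \<in> F \<Longrightarrow> z i \<in> carrier A"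
      "\<And>i. i \<in> F \<Longrightarrow> f (z i) = shift A (z i) (\<delta> i)"
    and sum: "(\<Oplus>\<^bsub>R\<^esub>i\<in>F. z i) = \<zero>\<^bsub>R\<^esub>" and i: "i \<in> F"
  shows "z i = \<zero>"
proof -
  interpret R: kalg R by fact
  interpret T: kalg "end_alg A :: ('k, ('d \<Rightarrow> 'a) \<Rightarrow> 'd \<Rightarrow> 'a) module" by (rule kalg_end_alg)
  interpret alg_hom_pair R "end_alg A" f by unfold_locales fact
  define u where "u = (\<lambda>d::'d. if d = 0 then \<one> else \<zero>)"
  have u: "u \<in> seqs A" by (simp add: u_def seqs_def)
  have ev: "f (z j) u m = (if \<delta> j = m then z j else \<zero>)" if "j \<in> F" for j m
    using z(2)[OF that] by (simp only: z(3)[OF that] shift_apply[OF u]) (auto simp: u_def)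
  have add: "f (a \<oplus>\<^bsub>R\<^esub> b) u m = f a u m \<oplus> f b u m" if "a \<in> carrier R" "b \<in> carrier R" for a b m
    using that u by (simp add: alg_homD(3)[OF f] end_alg_ops)
  have zero: "f \<zero>\<^bsub>R\<^esub> u m = \<zero>" for m
    using u by (simp add: end_alg_ops)
  \<comment> \<open>Terms whose degrees differ from \<open>m\<close> contribute nothing in degree
    \<open>m\<close>; injectivity of \<open>\<delta>\<close> makes this apply to all terms except
    the one with index \<open>i\<close>.\<close>
  have off: "f (\<Oplus>\<^bsub>R\<^esub>j\<in>F'. z j) u m = \<zero>" if "F' \<subseteq> F" "\<And>j. j \<in> F' \<Longrightarrow> \<delta> j \<noteq> m" for F' m
    using finite_subset[OF that(1) F(1)] that
  proof (induction F' rule: finite_induct)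
    case (insert j F')
    have s: "(\<Oplus>\<^bsub>R\<^esub>j\<in>F'. z j) \<in> carrier R" using insert z(1) by (intro R.finsum_closed) blast
    have "(\<Oplus>\<^bsub>R\<^esub>j\<in>insert j F'. z j) = z j \<oplus>\<^bsub>R\<^esub> (\<Oplus>\<^bsub>R\<^esub>j\<in>F'. z j)"
      using insert z(1) by (intro R.finsum_insert) auto
    moreover have j: "j \<in> F" "\<delta> j \<noteq> m" using insert by auto
    moreover have "f (\<Oplus>\<^bsub>R\<^esub>j\<in>F'. z j) u m = \<zero>" using insert by simp
    ultimately show ?case using add[OF z(1)[OF j(1)] s, of m] ev[OF j(1), of m] by simp
  qed (simp only: R.finsum_empty zero)
  let ?F = "F - {i}"
  have "(\<Oplus>\<^bsub>R\<^esub>j\<in>insert i ?F. z j) = z i \<oplus>\<^bsub>R\<^esub> (\<Oplus>\<^bsub>R\<^esub>j\<in>?F. z j)"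
    using F i z(1) by (intro R.finsum_insert) auto
  moreover have "insert i ?F = F" using i by blast
  ultimately have eq: "\<zero>\<^bsub>R\<^esub> = z i \<oplus>\<^bsub>R\<^esub> (\<Oplus>\<^bsub>R\<^esub>j\<in>?F. z j)" using sum by simp
  have s: "(\<Oplus>\<^bsub>R\<^esub>j\<in>?F. z j) \<in> carrier R" using z(1) by (intro R.finsum_closed) blast
  have o: "f (\<Oplus>\<^bsub>R\<^esub>j\<in>?F. z j) u (\<delta> i) = \<zero>"
    by (rule off) (use F(2) i in \<open>auto dest: inj_onD\<close>)
  have "\<zero> = f (z i \<oplus>\<^bsub>R\<^esub> (\<Oplus>\<^bsub>R\<^esub>j\<in>?F. z j)) u (\<delta> i)"
    unfolding eq[symmetric] zero ..
  also have "\<dots> = f (z i) u (\<delta> i) \<oplus> \<zero>"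
    unfolding add[OF z(1)[OF i] s] o ..
  also have "\<dots> = z i" using ev[OF i, of "\<delta> i"] z(2)[OF i] by simp
  finally show ?thesis ..
qed

end

subsection \<open>Quantum matrices\<close>

text \<open>Exactly the data of a homomorphism from the quantum matrix algebra to \<open>A\<close>.
  The correction term of the fourth relation is moved to the right-hand side, so that every relation
  can be used as a rewriting of a product.\<close>

definition qmat_family :: "nat \<Rightarrow> 'k::field \<Rightarrow> ('k, 'a) module \<Rightarrow> (nat \<Rightarrow> nat \<Rightarrow> 'a) \<Rightarrow> bool" where
  "qmat_family n q A y \<longleftrightarrow>
     (\<forall>i\<in>{1..n}. \<forall>j\<in>{1..n}. y i j \<in> carrier A) \<and>
     (\<forall>i\<in>{1..n}. \<forall>j\<in>{1..n}. \<forall>l\<in>{1..n}. i < l \<longrightarrow>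
        y i j \<otimes>\<^bsub>A\<^esub> y l j = q \<odot>\<^bsub>A\<^esub> (y l j \<otimes>\<^bsub>A\<^esub> y i j)) \<and>
     (\<forall>i\<in>{1..n}. \<forall>j\<in>{1..n}. \<forall>m\<in>{1..n}. j < m \<longrightarrow>
        y i j \<otimes>\<^bsub>A\<^esub> y i m = q \<odot>\<^bsub>A\<^esub> (y i m \<otimes>\<^bsub>A\<^esub> y i j)) \<and>
     (\<forall>i\<in>{1..n}. \<forall>j\<in>{1..n}. \<forall>l\<in>{1..n}. \<forall>m\<in>{1..n}. i < l \<longrightarrow> m < j \<longrightarrow>
        y i j \<otimes>\<^bsub>A\<^esub> y l m = y l m \<otimes>\<^bsub>A\<^esub> y i j) \<and>
     (\<forall>i\<in>{1..n}. \<forall>j\<in>{1..n}. \<forall>l\<in>{1..n}. \<forall>m\<in>{1..n}. i < l \<longrightarrow> j < m \<longrightarrow>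
        y i j \<otimes>\<^bsub>A\<^esub> y l m = y l m \<otimes>\<^bsub>A\<^esub> y i j \<oplus>\<^bsub>A\<^esub> (q - inverse q) \<odot>\<^bsub>A\<^esub> (y i m \<otimes>\<^bsub>A\<^esub> y l j))"

lemma qmat_familyD:
  assumes "qmat_family n q A y"
  shows "i \<in> {1..n} \<Longrightarrow> j \<in> {1..n} \<Longrightarrow> y i j \<in> carrier A"
    and "i \<in> {1..n} \<Longrightarrow> j \<in> {1..n} \<Longrightarrow> l \<in> {1..n} \<Longrightarrow> i < l \<Longrightarrow>
        y i j \<otimes>\<^bsub>A\<^esub> y l j = q \<odot>\<^bsub>A\<^esub> (y l j \<otimes>\<^bsub>A\<^esub> y i j)"
    and "i \<in> {1..n} \<Longrightarrow> j \<in> {1..n} \<Longrightarrow> m \<in> {1..n} \<Longrightarrow> j < m \<Longrightarrow>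
        y i j \<otimes>\<^bsub>A\<^esub> y i m = q \<odot>\<^bsub>A\<^esub> (y i m \<otimes>\<^bsub>A\<^esub> y i j)"
    and "i \<in> {1..n} \<Longrightarrow> j \<in> {1..n} \<Longrightarrow> l \<in> {1..n} \<Longrightarrow> m \<in> {1..n} \<Longrightarrow> i < l \<Longrightarrow> m < j \<Longrightarrow>
        y i j \<otimes>\<^bsub>A\<^esub> y l m = y l m \<otimes>\<^bsub>A\<^esub> y i j"
    and "i \<in> {1..n} \<Longrightarrow> j \<in> {1..n} \<Longrightarrow> l \<in> {1..n} \<Longrightarrow> m \<in> {1..n} \<Longrightarrow> i < l \<Longrightarrow> j < m \<Longrightarrow>
        y i j \<otimes>\<^bsub>A\<^esub> y l m = y l m \<otimes>\<^bsub>A\<^esub> y i j \<oplus>\<^bsub>A\<^esub> (q - inverse q) \<odot>\<^bsub>A\<^esub> (y i m \<otimes>\<^bsub>A\<^esub> y l j)"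
proof -
  note d = assms[unfolded qmat_family_def]
  show "i \<in> {1..n} \<Longrightarrow> j \<in> {1..n} \<Longrightarrow> y i j \<in> carrier A"
    by (rule d[THEN conjunct1, THEN bspec, THEN bspec])
  show "i \<in> {1..n} \<Longrightarrow> j \<in> {1..n} \<Longrightarrow> l \<in> {1..n} \<Longrightarrow> i < l \<Longrightarrow>
        y i j \<otimes>\<^bsub>A\<^esub> y l j = q \<odot>\<^bsub>A\<^esub> (y l j \<otimes>\<^bsub>A\<^esub> y i j)"
    by (rule d[THEN conjunct2, THEN conjunct1, THEN bspec, THEN bspec, THEN bspec, THEN mp])
  show "i \<in> {1..n} \<Longrightarrow> j \<in> {1..n} \<Longrightarrow> m \<in> {1..n} \<Longrightarrow> j < m \<Longrightarrow>
        y i j \<otimes>\<^bsub>A\<^esub> y i m = q \<odot>\<^bsub>A\<^esub> (y i m \<otimes>\<^bsub>A\<^esub> y i j)"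
    by (rule d[THEN conjunct2, THEN conjunct2, THEN conjunct1, THEN bspec, THEN bspec, THEN bspec, THEN mp])
  show "i \<in> {1..n} \<Longrightarrow> j \<in> {1..n} \<Longrightarrow> l \<in> {1..n} \<Longrightarrow> m \<in> {1..n} \<Longrightarrow> i < l \<Longrightarrow> m < j \<Longrightarrow>
        y i j \<otimes>\<^bsub>A\<^esub> y l m = y l m \<otimes>\<^bsub>A\<^esub> y i j"
    by (rule d[THEN conjunct2, THEN conjunct2, THEN conjunct2, THEN conjunct1, THEN bspec, THEN bspec,
        THEN bspec, THEN bspec, THEN mp, THEN mp])
  show "i \<in> {1..n} \<Longrightarrow> j \<in> {1..n} \<Longrightarrow> l \<in> {1..n} \<Longrightarrow> m \<in> {1..n} \<Longrightarrow> i < l \<Longrightarrow> j < m \<Longrightarrow>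
        y i j \<otimes>\<^bsub>A\<^esub> y l m = y l m \<otimes>\<^bsub>A\<^esub> y i j \<oplus>\<^bsub>A\<^esub> (q - inverse q) \<odot>\<^bsub>A\<^esub> (y i m \<otimes>\<^bsub>A\<^esub> y l j)"
    by (rule d[THEN conjunct2, THEN conjunct2, THEN conjunct2, THEN conjunct2, THEN bspec, THEN bspec,
        THEN bspec, THEN bspec, THEN mp, THEN mp])
qed

lemma qmat_familyI:
  assumes "\<And>i j. i \<in> {1..n} \<Longrightarrow> j \<in> {1..n} \<Longrightarrow> y i j \<in> carrier A"
    and "\<And>i j l. i \<in> {1..n} \<Longrightarrow> j \<in> {1..n} \<Longrightarrow> l \<in> {1..n} \<Longrightarrow> i < l \<Longrightarrow>
        y i j \<otimes>\<^bsub>A\<^esub> y l j = q \<odot>\<^bsub>A\<^esub> (y l j \<otimes>\<^bsub>A\<^esub> y i j)"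
    and "\<And>i j m. i \<in> {1..n} \<Longrightarrow> j \<in> {1..n} \<Longrightarrow> m \<in> {1..n} \<Longrightarrow> j < m \<Longrightarrow>
        y i j \<otimes>\<^bsub>A\<^esub> y i m = q \<odot>\<^bsub>A\<^esub> (y i m \<otimes>\<^bsub>A\<^esub> y i j)"
    and "\<And>i j l m. i \<in> {1..n} \<Longrightarrow> j \<in> {1..n} \<Longrightarrow> l \<in> {1..n} \<Longrightarrow> m \<in> {1..n} \<Longrightarrow> i < l \<Longrightarrow> m < j \<Longrightarrow>
        y i j \<otimes>\<^bsub>A\<^esub> y l m = y l m \<otimes>\<^bsub>A\<^esub> y i j"
    and "\<And>i j l m. i \<in> {1..n} \<Longrightarrow> j \<in> {1..n} \<Longrightarrow> l \<in> {1..n} \<Longrightarrow> m \<in> {1..n} \<Longrightarrow> i < l \<Longrightarrow> j < m \<Longrightarrow>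
        y i j \<otimes>\<^bsub>A\<^esub> y l m = y l m \<otimes>\<^bsub>A\<^esub> y i j \<oplus>\<^bsub>A\<^esub> (q - inverse q) \<odot>\<^bsub>A\<^esub> (y i m \<otimes>\<^bsub>A\<^esub> y l j)"
  shows "qmat_family n q A y"
  unfolding qmat_family_def by (intro conjI ballI impI) (rule assms; assumption)+

lemma qmat_family_hom:
  fixes A :: "('k::field, 'a) module"
  assumes A: "kalg A" and f: "f \<in> alg_hom A T" and y: "qmat_family n q A y"
  shows "qmat_family n q T (\<lambda>i j. f (y i j))"
proof -
  interpret A: kalg A by fact
  note yd = qmat_familyD[OF y] and h = alg_homD[OF f]
  show ?thesis
  proof (rule qmat_familyI)
    fix i j assume i: "i \<in> {1..n}" and j: "j \<in> {1..n}"
    show "f (y i j) \<in> carrier T" using h(1)[OF yd(1)[OF i j]] .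
    fix l assume l: "l \<in> {1..n}"
    note c = yd(1)[OF i j] yd(1)[OF l j] yd(1)[OF i l]
    show "f (y i j) \<otimes>\<^bsub>T\<^esub> f (y l j) = q \<odot>\<^bsub>T\<^esub> (f (y l j) \<otimes>\<^bsub>T\<^esub> f (y i j))" if "i < l"
      using arg_cong[OF yd(2)[OF i j l that], of f] c by (simp add: h)
    show "f (y i j) \<otimes>\<^bsub>T\<^esub> f (y i l) = q \<odot>\<^bsub>T\<^esub> (f (y i l) \<otimes>\<^bsub>T\<^esub> f (y i j))" if "j < l"
      using arg_cong[OF yd(3)[OF i j l that], of f] c by (simp add: h)
    fix m assume m: "m \<in> {1..n}"
    note c = c yd(1)[OF l m] yd(1)[OF i m]
    show "f (y i j) \<otimes>\<^bsub>T\<^esub> f (y l m) = f (y l m) \<otimes>\<^bsub>T\<^esub> f (y i j)" if "i < l" "m < j"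
      using arg_cong[OF yd(4)[OF i j l m that], of f] c by (simp add: h)
    show "f (y i j) \<otimes>\<^bsub>T\<^esub> f (y l m) = f (y l m) \<otimes>\<^bsub>T\<^esub> f (y i j)
        \<oplus>\<^bsub>T\<^esub> (q - inverse q) \<odot>\<^bsub>T\<^esub> (f (y i m) \<otimes>\<^bsub>T\<^esub> f (y l j))" if "i < l" "j < m"
      using arg_cong[OF yd(5)[OF i j l m that], of f] c by (simp add: h)
  qed
qed

lemma qmat_rels_carrier: "qmat_rels n q \<subseteq> carrier (free_alg ({1..n} \<times> {1..n}))"
proof
  fix r assume "r \<in> qmat_rels n q"
  then show "r \<in> carrier (free_alg ({1..n} \<times> {1..n}))"
    unfolding qmat_rels_def free_alg_simps
    by (elim UnE CollectE exE conjE; hypsubst; intro CollectI keys_diff_subset keys_single_subset) auto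
qed

lemma kalg_qmat: "kalg (qmat n q)"
  unfolding qmat_def by (rule kalg.kalg_quot_alg[OF kalg_free_alg qmat_rels_carrier])

lemma X_family: "qmat_family n q (qmat n q) (X n q)"
proof -
  define V where "V = {1..n} \<times> {1..n}"
  interpret F: kalg "free_alg V :: ('a, (nat \<times> nat) list \<Rightarrow>\<^sub>0 'a) module" by (rule kalg_free_alg)
  note rc = qmat_rels_carrier[of n q, folded V_def]
  note simps = F.quot_alg_simps(2-)[OF rc] F.quot_cls_closed[OF rc]
  let ?s = "Poly_Mapping.single :: (nat \<times> nat) list \<Rightarrow> 'a \<Rightarrow> _"
  let ?q = "quot_cls (free_alg V) (qmat_rels n q)"
  have eq: "?q (?s v c) = ?q (?s w d)"
    if "?s v c - ?s w d \<in> qmat_rels n q" "v \<in> lists V" "w \<in> lists V" for v w c d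
    using that by (intro free_alg_quot_eqI rc keys_single_subset)
  have eq2: "?q (?s v c) = ?q (?s w d + ?s u e)"
    if "?s v c - ?s w d - ?s u e \<in> qmat_rels n q" "v \<in> lists V" "w \<in> lists V" "u \<in> lists V" for v w u c d e
  proof (intro free_alg_quot_eqI rc)
    show "Poly_Mapping.keys (?s w d + ?s u e) \<subseteq> lists V"
      by (rule order_trans[OF Poly_Mapping.keys_add]) (intro Un_least keys_single_subset that)
    show "?s v c - (?s w d + ?s u e) \<in> qmat_rels n q"
      using that(1) by (simp only: diff_diff_eq)
  qed (intro keys_single_subset that)
  have k: "Poly_Mapping.keys (?s v c) \<subseteq> lists V" if "v \<in> lists V" for v c
    using that by (rule keys_single_subset)
  have vV: "(i, j) \<in> V" if "i \<in> {1..n}" "j \<in> {1..n}" for i j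
    using that by (simp add: V_def)
  show ?thesis
    unfolding qmat_def X_def V_def[symmetric]
  proof (rule qmat_familyI)
    fix i j assume ij: "i \<in> {1..n}" "j \<in> {1..n}"
    note v = vV[OF ij]
    show "?q (?s [(i, j)] 1) \<in> carrier (quot_alg (free_alg V) (qmat_rels n q))"
      using v by (simp add: simps k del: keys_single)
    fix l assume l: "l \<in> {1..n}"
    note v = v vV[OF l ij(2)] vV[OF ij(1) l]
    show "?q (?s [(i, j)] 1) \<otimes>\<^bsub>quot_alg (free_alg V) (qmat_rels n q)\<^esub> ?q (?s [(l, j)] 1) = q \<odot>\<^bsub>quot_alg (free_alg V) (qmat_rels n q)\<^esub> (?q (?s [(l, j)] 1) \<otimes>\<^bsub>quot_alg (free_alg V) (qmat_rels n q)\<^esub> ?q (?s [(i, j)] 1))" if "i < l"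
    proof -
      have "?s [(i,j), (l,j)] 1 - ?s [(l,j), (i,j)] q \<in> qmat_rels n q"
        unfolding qmat_rels_def using ij l that by blast
      from eq[OF this] show ?thesis using v by (simp add: simps k del: keys_single)
    qed
    show "?q (?s [(i, j)] 1) \<otimes>\<^bsub>quot_alg (free_alg V) (qmat_rels n q)\<^esub> ?q (?s [(i, l)] 1) = q \<odot>\<^bsub>quot_alg (free_alg V) (qmat_rels n q)\<^esub> (?q (?s [(i, l)] 1) \<otimes>\<^bsub>quot_alg (free_alg V) (qmat_rels n q)\<^esub> ?q (?s [(i, j)] 1))" if "j < l"
    proof -
      have "?s [(i,j), (i,l)] 1 - ?s [(i,l), (i,j)] q \<in> qmat_rels n q"
        unfolding qmat_rels_def using ij l that by blast
      from eq[OF this] show ?thesis using v by (simp add: simps k del: keys_single)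
    qed
    fix m assume m: "m \<in> {1..n}"
    note v = v vV[OF l m] vV[OF ij(1) m]
    show "?q (?s [(i, j)] 1) \<otimes>\<^bsub>quot_alg (free_alg V) (qmat_rels n q)\<^esub> ?q (?s [(l, m)] 1) = ?q (?s [(l, m)] 1) \<otimes>\<^bsub>quot_alg (free_alg V) (qmat_rels n q)\<^esub> ?q (?s [(i, j)] 1)" if "i < l" "m < j"
    proof -
      have "?s [(i,j), (l,m)] 1 - ?s [(l,m), (i,j)] 1 \<in> qmat_rels n q"
        unfolding qmat_rels_def using ij l m that by blast
      from eq[OF this] show ?thesis using v by (simp add: simps k del: keys_single)
    qed
    show "?q (?s [(i, j)] 1) \<otimes>\<^bsub>quot_alg (free_alg V) (qmat_rels n q)\<^esub> ?q (?s [(l, m)] 1) = ?q (?s [(l, m)] 1) \<otimes>\<^bsub>quot_alg (free_alg V) (qmat_rels n q)\<^esub> ?q (?s [(i, j)] 1) \<oplus>\<^bsub>quot_alg (free_alg V) (qmat_rels n q)\<^esub> (q - inverse q) \<odot>\<^bsub>quot_alg (free_alg V) (qmat_rels n q)\<^esub> (?q (?s [(i, m)] 1) \<otimes>\<^bsub>quot_alg (free_alg V) (qmat_rels n q)\<^esub> ?q (?s [(l, j)] 1))" if "i < l" "j < m"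
    proof -
      have "?s [(i,j), (l,m)] 1 - ?s [(l,m), (i,j)] 1 - ?s [(i,m), (l,j)] (q - inverse q) \<in> qmat_rels n q"
        unfolding qmat_rels_def using ij l m that by blast
      from eq2[OF this] show ?thesis using v by (simp add: simps k del: keys_single)
    qed
  qed
qed

lemma qmat_universal:
  fixes T :: "('k::field, 'b) module"
  assumes T: "kalg T" and y: "qmat_family n q T y"
  shows "\<exists>g\<in>alg_hom (qmat n q) T. \<forall>i\<in>{1..n}. \<forall>j\<in>{1..n}. g (X n q i j) = y i j"
proof -
  interpret T: kalg T by fact
  let ?V = "{1..n} \<times> {1..n}"
  interpret F: kalg "free_alg ?V :: ('k, (nat \<times> nat) list \<Rightarrow>\<^sub>0 'k) module" by (rule kalg_free_alg)
  let ?y = "\<lambda>(i, j). y i j"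
  note yd = qmat_familyD[OF y]
  have "?y \<in> ?V \<rightarrow> carrier T" using yd(1) by auto
  then obtain h where h: "h \<in> alg_hom (free_alg ?V) T"
    and hs: "\<And>w c. w \<in> lists ?V \<Longrightarrow> h (Poly_Mapping.single w c) = c \<odot>\<^bsub>T\<^esub> T.word ?y w"
    and hd: "\<And>g k. Poly_Mapping.keys g \<subseteq> lists ?V \<Longrightarrow> Poly_Mapping.keys k \<subseteq> lists ?V \<Longrightarrow> h (g - k) = h g \<ominus>\<^bsub>T\<^esub> h k"
    by (rule T.free_alg_universal) blast
  have hd1: "h (Poly_Mapping.single v c - Poly_Mapping.single w d) =
      c \<odot>\<^bsub>T\<^esub> T.word ?y v \<ominus>\<^bsub>T\<^esub> d \<odot>\<^bsub>T\<^esub> T.word ?y w" if "v \<in> lists ?V" "w \<in> lists ?V" for v w c d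
    using that hd[of "Poly_Mapping.single v c" "Poly_Mapping.single w d"]
    by (simp only: keys_single_subset hs)
  have hd2: "h (Poly_Mapping.single v c - Poly_Mapping.single w d - Poly_Mapping.single u e) =
      c \<odot>\<^bsub>T\<^esub> T.word ?y v \<ominus>\<^bsub>T\<^esub> d \<odot>\<^bsub>T\<^esub> T.word ?y w \<ominus>\<^bsub>T\<^esub> e \<odot>\<^bsub>T\<^esub> T.word ?y u"
    if "v \<in> lists ?V" "w \<in> lists ?V" "u \<in> lists ?V" for v w u c d e
    using that hd1[OF that(1,2), of c d]
      hd[of "Poly_Mapping.single v c - Poly_Mapping.single w d" "Poly_Mapping.single u e"]
    by (simp only: keys_single_subset keys_diff_subset hs)
  have "h r = \<zero>\<^bsub>T\<^esub>" if "r \<in> qmat_rels n q" for r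
    using that unfolding qmat_rels_def
  proof (elim UnE CollectE exE conjE)
    fix i j l assume *: "r = Poly_Mapping.single [(i,j), (l,j)] 1 - Poly_Mapping.single [(l,j), (i,j)] q"
      "{i,j,l} \<subseteq> {1..n}" "i < l"
    then have m: "i \<in> {1..n}" "j \<in> {1..n}" "l \<in> {1..n}" by blast+
    have w: "[(i,j), (l,j)] \<in> lists ?V" "[(l,j), (i,j)] \<in> lists ?V" using m by auto
    show ?thesis
      unfolding *(1) hd1[OF w] using yd(2)[OF m *(3)] yd(1) m by (simp add: T.r_right_minus_eq)
  next
    fix i j l assume *: "r = Poly_Mapping.single [(i,j), (i,l)] 1 - Poly_Mapping.single [(i,l), (i,j)] q"
      "{i,j,l} \<subseteq> {1..n}" "j < l"
    then have m: "i \<in> {1..n}" "j \<in> {1..n}" "l \<in> {1..n}" by blast+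
    have w: "[(i,j), (i,l)] \<in> lists ?V" "[(i,l), (i,j)] \<in> lists ?V" using m by auto
    show ?thesis
      unfolding *(1) hd1[OF w] using yd(3)[OF m *(3)] yd(1) m by (simp add: T.r_right_minus_eq)
  next
    fix i j l k assume *: "r = Poly_Mapping.single [(i,j), (l,k)] 1 - Poly_Mapping.single [(l,k), (i,j)] 1"
      "{i,j,l,k} \<subseteq> {1..n}" "i < l" "k < j"
    then have m: "i \<in> {1..n}" "j \<in> {1..n}" "l \<in> {1..n}" "k \<in> {1..n}" by blast+
    have w: "[(i,j), (l,k)] \<in> lists ?V" "[(l,k), (i,j)] \<in> lists ?V" using m by auto
    show ?thesis
      unfolding *(1) hd1[OF w] using yd(4)[OF m *(3,4)] yd(1) m by (simp add: T.r_right_minus_eq)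
  next
    fix i j l k assume *: "r = Poly_Mapping.single [(i,j), (l,k)] 1 - Poly_Mapping.single [(l,k), (i,j)] 1
        - Poly_Mapping.single [(i,k), (l,j)] (q - inverse q)"
      "{i,j,l,k} \<subseteq> {1..n}" "i < l" "j < k"
    then have m: "i \<in> {1..n}" "j \<in> {1..n}" "l \<in> {1..n}" "k \<in> {1..n}" by blast+
    have w: "[(i,j), (l,k)] \<in> lists ?V" "[(l,k), (i,j)] \<in> lists ?V" "[(i,k), (l,j)] \<in> lists ?V" using m by auto
    show ?thesis
      unfolding *(1) hd2[OF w] using yd(5)[OF m *(3,4)] yd(1) m by (simp add: T.add_minus_minus)
  qed
  then obtain g where g: "g \<in> alg_hom (qmat n q) T"
    "\<And>r. r \<in> carrier (free_alg ?V) \<Longrightarrow> g (quot_cls (free_alg ?V) (qmat_rels n q) r) = h r"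
    using F.quot_alg_universal[OF qmat_rels_carrier T h, folded qmat_def] by blast
  have "g (X n q i j) = y i j" if "i \<in> {1..n}" "j \<in> {1..n}" for i j
  proof -
    have w: "[(i, j)] \<in> lists ?V" using that by auto
    then have "Poly_Mapping.single [(i, j)] (1::'k) \<in> carrier (free_alg ?V)" by simp
    from g(2)[OF this] show ?thesis
      unfolding X_def hs[OF w] using yd(1)[OF that] by simp
  qed
  with g(1) show ?thesis by blast
qed

text \<open>The common form of both localized algebras: generators at positions in \<open>P\<close>
  are killed and those at positions in \<open>U\<close> inverted. The two cases differ only in the
  position sets, so the universal property is established once.\<close>

locale qmat_localization =
  fixes n :: nat and q :: "'k::field" and P U :: "(nat \<times> nat) set"
  assumes P: "P \<subseteq> {1..n} \<times> {1..n}" and U: "U \<subseteq> {1..n} \<times> {1..n}"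
begin

definition "JP = (\<lambda>(i, j). X n q i j) ` P"
definition "y0 i j = quot_cls (qmat n q) JP (X n q i j)"
definition "SU = (\<lambda>(i, j). y0 i j) ` U"
definition "R0 = quot_alg (qmat n q) JP"
definition "R = loc R0 SU"
definition "y i j = to_loc R0 SU (y0 i j)"

sublocale Q: kalg "qmat n q" by (rule kalg_qmat)

lemma JP: "JP \<subseteq> carrier (qmat n q)"
proof
  fix a assume "a \<in> JP"
  then obtain i j where "(i, j) \<in> P" "a = X n q i j" unfolding JP_def by (elim imageE) force
  then show "a \<in> carrier (qmat n q)" using P qmat_familyD(1)[OF X_family, of i n j q] by blast
qed

sublocale R0: kalg R0 unfolding R0_def by (rule Q.kalg_quot_alg[OF JP])

lemma y0_family: "qmat_family n q R0 y0"
  unfolding y0_def R0_def by (rule qmat_family_hom[OF kalg_qmat Q.quot_cls_alg_hom[OF JP] X_family])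

lemma SU: "SU \<subseteq> carrier R0"
proof
  fix a assume "a \<in> SU"
  then obtain i j where "(i, j) \<in> U" "a = y0 i j" unfolding SU_def by (elim imageE) force
  then show "a \<in> carrier R0" using U qmat_familyD(1)[OF y0_family, of i j] by blast
qed

sublocale R: kalg R unfolding R_def by (rule R0.kalg_loc[OF SU])

lemma y_family: "qmat_family n q R y"
  unfolding y_def R_def by (rule qmat_family_hom[OF R0.kalg_axioms R0.to_loc_alg_hom[OF SU] y0_family])

lemma y_zero:
  assumes "(i, j) \<in> P"
  shows "y i j = \<zero>\<^bsub>R\<^esub>"
proof -
  interpret h: alg_hom_pair R0 R "to_loc R0 SU"
    unfolding R_def using R0.to_loc_alg_hom[OF SU] R0.kalg_loc[OF SU]
    by (intro alg_hom_pair.intro alg_hom_pair_axioms.intro R0.kalg_axioms)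
  have "X n q i j \<in> JP" using assms by (force simp: JP_def)
  then have "y0 i j = \<zero>\<^bsub>R0\<^esub>" unfolding y0_def R0_def by (rule Q.quot_cls_zero[OF JP])
  then show ?thesis by (simp add: y_def)
qed

lemma y_Units: "(i, j) \<in> U \<Longrightarrow> y i j \<in> Units R"
  unfolding y_def R_def by (rule R0.to_loc_Units[OF SU]) (force simp: SU_def)

text \<open>The universal properties of the presentation, of the quotient and of the localization,
  applied in turn: \<open>z\<close> determines a map on the generators, \<open>P0\<close> lets it
  pass to the quotient, \<open>UU\<close> to the localization.\<close>

lemma universal:
  fixes T :: "('k, 'b) module"
  assumes T: "kalg T" and z: "qmat_family n q T z"
    and P0: "\<And>i j. (i, j) \<in> P \<Longrightarrow> z i j = \<zero>\<^bsub>T\<^esub>"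
    and UU: "\<And>i j. (i, j) \<in> U \<Longrightarrow> z i j \<in> Units T"
  shows "\<exists>g\<in>alg_hom R T. \<forall>i\<in>{1..n}. \<forall>j\<in>{1..n}. g (y i j) = z i j"
proof -
  obtain f where f: "f \<in> alg_hom (qmat n q) T"
    and fX: "\<And>i j. i \<in> {1..n} \<Longrightarrow> j \<in> {1..n} \<Longrightarrow> f (X n q i j) = z i j"
    using qmat_universal[OF T z] by blast
  have "f a = \<zero>\<^bsub>T\<^esub>" if "a \<in> JP" for a
    using that P P0 by (auto simp: JP_def fX)
  then obtain f0 where f0: "f0 \<in> alg_hom R0 T"
    and f0a: "\<And>a. a \<in> carrier (qmat n q) \<Longrightarrow> f0 (quot_cls (qmat n q) JP a) = f a"
    using Q.quot_alg_universal[OF JP T f] unfolding R0_def by blast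
  have f0y: "f0 (y0 i j) = z i j" if "i \<in> {1..n}" "j \<in> {1..n}" for i j
    unfolding y0_def f0a[OF qmat_familyD(1)[OF X_family that]] by (rule fX[OF that])
  have "f0 s \<in> Units T" if "s \<in> SU" for s
    using that U UU by (auto simp: SU_def f0y)
  then obtain g where g: "g \<in> alg_hom R T"
    and ga: "\<And>a. a \<in> carrier R0 \<Longrightarrow> g (to_loc R0 SU a) = f0 a"
    using R0.loc_universal[OF SU T f0] unfolding R_def by blast
  have "g (y i j) = z i j" if "i \<in> {1..n}" "j \<in> {1..n}" for i j
    unfolding y_def ga[OF qmat_familyD(1)[OF y0_family that]] by (rule f0y[OF that])
  with g show ?thesis by blast
qed

end

text \<open>Transposition exchanges the first two relations and preserves the other two. It reduces
  the algebra attached to column indices to the case of row indices.\<close>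

lemma (in kalg) qmat_family_transpose:
  assumes "qmat_family n q A y"
  shows "qmat_family n q A (\<lambda>i j. y j i)"
proof (rule qmat_familyI)
  note yd = qmat_familyD[OF assms]
  fix i j assume i: "i \<in> {1..n}" and j: "j \<in> {1..n}"
  show "y j i \<in> carrier A" using yd(1)[OF j i] .
  fix l assume l: "l \<in> {1..n}"
  show "y j i \<otimes> y j l = q \<odot> (y j l \<otimes> y j i)" if "i < l" using yd(3)[OF j i l that] .
  show "y j i \<otimes> y l i = q \<odot> (y l i \<otimes> y j i)" if "j < l" using yd(2)[OF j i l that] .
  fix m assume m: "m \<in> {1..n}"
  show "y j i \<otimes> y m l = y m l \<otimes> y j i" if "i < l" "m < j"
    using yd(4)[OF m l j i that(2,1)] by (rule sym)
  show "y j i \<otimes> y m l = y m l \<otimes> y j i \<oplus> (q - inverse q) \<odot> (y m i \<otimes> y j l)" if "i < l" "j < m"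
    \<comment> \<open>The transposed correction term has its two factors in the opposite order; they
      commute by the third relation.\<close>
    using yd(5)[OF j i m l that(2,1)] unfolding yd(4)[OF j l m i that(2,1)] .
qed

text \<open>Conjugation by \<open>y\<^bsub>r\<^sub>l,l\<^esub>\<close> scales row \<open>r\<^sub>l\<close> by \<open>q\<^sup>-\<^sup>1\<close> and column \<open>l\<close> by \<open>q\<close>.\<close>

definition row_wt :: "'k::field \<Rightarrow> nat \<Rightarrow> nat \<Rightarrow> 'k" where
  "row_wt q a i = (if i = a then inverse q else 1)"

definition col_wt :: "'k::field \<Rightarrow> nat \<Rightarrow> nat \<Rightarrow> 'k" where
  "col_wt q b j = (if j = b then q else 1)"

text \<open>For a nonzero generator in column \<open>j\<close> the row satisfies
  \<open>\<rho> j \<le> i\<close>, which leaves few positions relative to the pivot. In the pivot's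
  row or column the commutation is by a power of \<open>q\<close>. A generator below and to the left
  commutes outright. In the two remaining positions the fourth relation applies and its correction
  term vanishes.\<close>

lemma (in kalg) qmat_family_pivot_commute:
  assumes q: "q \<noteq> 0" and y: "qmat_family n q A y"
    and \<rho>: "\<And>j. j \<in> {1..t} \<Longrightarrow> \<rho> j \<in> {1..n}" "\<And>j l. j \<in> {1..t} \<Longrightarrow> l \<in> {1..t} \<Longrightarrow> j < l \<Longrightarrow> \<rho> j < \<rho> l"
    and t: "t \<le> n"
    and zero: "\<And>i j. i \<in> {1..n} \<Longrightarrow> j \<in> {1..n} \<Longrightarrow> t < j \<or> i < \<rho> j \<Longrightarrow> y i j = \<zero>"
    and l: "l \<in> {1..t}" and i: "i \<in> {1..n}" and j: "j \<in> {1..n}"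
  shows "y (\<rho> l) l \<otimes> y i j = (row_wt q (\<rho> l) i * col_wt q l j) \<odot> (y i j \<otimes> y (\<rho> l) l)"
proof -
  note yd = qmat_familyD[OF y]
  have rl: "\<rho> l \<in> {1..n}" using \<rho>(1)[OF l] .
  have ln: "l \<in> {1..n}" using l t by auto
  have c: "y i j \<in> carrier A" "y (\<rho> l) l \<in> carrier A" using yd(1) i j rl ln by blast+
  show ?thesis
  proof (cases "t < j \<or> i < \<rho> j")
    case True
    \<comment> \<open>A killed generator makes both sides zero, whatever its weight.\<close>
    then have "y i j = \<zero>" using zero i j by blast
    then show ?thesis using c by simp
  next
    case False
    then have jt: "j \<in> {1..t}" and ij: "\<rho> j \<le> i" using j by auto
    \<comment> \<open>To the right of the pivot no subdivision by rows is necessary: strict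
      monotonicity of \<open>\<rho>\<close> puts every nonzero generator there strictly below the
      pivot's row.\<close>
    consider (eq) "j = l" "i = \<rho> l" | (below) "j = l" "\<rho> l < i" | (row) "j < l" "i = \<rho> l"
      | (nw) "j < l" "i < \<rho> l" | (sw) "j < l" "\<rho> l < i" | (right) "l < j"
      using ij by fastforce
    then show ?thesis
    proof cases
      case eq
      then show ?thesis using c q by (simp add: row_wt_def col_wt_def)
    next
      case below
      then show ?thesis using yd(2)[OF rl ln i] by (simp add: row_wt_def col_wt_def)
    next
      case row
      have "y i j \<otimes> y i l = q \<odot> (y i l \<otimes> y i j)" using yd(3)[OF i j ln row(1)] .
      then have "inverse q \<odot> (y i j \<otimes> y i l) = y i l \<otimes> y i j"
        using c q row by (simp add: smult_left_cancel)
      then show ?thesis using row by (simp add: row_wt_def col_wt_def)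
    next
      case nw
      \<comment> \<open>The correction term contains the entry in the pivot's column and a row above
        the pivot.\<close>
      have "y i l = \<zero>" using zero[OF i ln] nw by blast
      moreover have "y (\<rho> l) j \<in> carrier A" using yd(1)[OF rl j] .
      ultimately have "y i j \<otimes> y (\<rho> l) l = y (\<rho> l) l \<otimes> y i j"
        using yd(5)[OF i j rl ln nw(2,1)] c by simp
      then show ?thesis using nw c by (simp add: row_wt_def col_wt_def)
    next
      case sw
      then show ?thesis using yd(4)[OF rl ln i j sw(2,1)] c by (simp add: row_wt_def col_wt_def)
    next
      case right
      have r: "\<rho> l < \<rho> j" using \<rho>(2)[OF l jt right] .
      \<comment> \<open>The correction term contains the entry of the pivot's row in column
        \<open>j\<close>, which lies above the pivot of that column.\<close>
      have "y (\<rho> l) j = \<zero>" using zero[OF rl j] r by blast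
      moreover have "y i l \<in> carrier A" using yd(1)[OF i ln] .
      ultimately have "y (\<rho> l) l \<otimes> y i j = y i j \<otimes> y (\<rho> l) l"
        using yd(5)[OF rl ln i j _ right] r ij c by simp
      then show ?thesis using right r ij c by (simp add: row_wt_def col_wt_def)
    qed
  qed
qed

subsection \<open>The algebras of a pair of index sequences\<close>

context kalg
begin

lemma conj_scale:
  assumes u: "u \<in> Units A" and a: "a \<in> carrier A" and e: "u \<otimes> a = w \<odot> (a \<otimes> u)"
  shows "u \<otimes> a \<otimes> inv u = w \<odot> a"
    and "w \<noteq> 0 \<Longrightarrow> inv u \<otimes> a \<otimes> u = inverse w \<odot> a"
proof -
  note uc = Units_closed[OF u]
  show "u \<otimes> a \<otimes> inv u = w \<odot> a"
    unfolding e using u uc a by (simp add: smult_mult_l m_assoc)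
  assume w: "w \<noteq> 0"
  have "a \<otimes> u = inverse w \<odot> (u \<otimes> a)"
    unfolding e using uc a w by (simp add: smult_left_cancel)
  then show "inv u \<otimes> a \<otimes> u = inverse w \<odot> a"
    using u uc a by (simp add: m_assoc smult_mult_r Units_l_cancel_inv)
qed

text \<open>Conjugation by \<open>u\<close> rescales each generator, and since the weights are
  nonzero so does conjugation by the inverse. Both are homomorphisms, so both preserve the generated
  subalgebra.\<close>

lemma conj_subalg_gen:
  assumes u: "u \<in> Units A" and G: "G \<subseteq> carrier A"
    and e: "\<And>g. g \<in> G \<Longrightarrow> \<exists>w. w \<noteq> 0 \<and> u \<otimes> g = w \<odot> (g \<otimes> u)"
    and a: "a \<in> subalg_gen A G"
  shows "u \<otimes> a \<otimes> inv u \<in> subalg_gen A G" "inv u \<otimes> a \<otimes> u \<in> subalg_gen A G"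
proof -
  note S = subalg_subalg_gen[OF G]
  \<comment> \<open>Stated for a variable unit in order to be used for \<open>u\<close> and for its
    inverse.\<close>
  have img: "u' \<otimes> a \<otimes> inv u' \<in> subalg_gen A G"
    if u': "u' \<in> Units A" and g': "\<And>g. g \<in> G \<Longrightarrow> u' \<otimes> g \<otimes> inv u' \<in> subalg_gen A G" for u'
  proof -
    interpret c: alg_hom_pair A A "\<lambda>a. u' \<otimes> a \<otimes> inv u'"
      using conj_alg_aut[OF u'] by unfold_locales (simp add: alg_aut_def)
    show ?thesis using c.image_subalg_gen[OF S G] g' a by blast
  qed
  show "u \<otimes> a \<otimes> inv u \<in> subalg_gen A G"
  proof (rule img[OF u])
    fix g assume g: "g \<in> G"
    then obtain w where w: "u \<otimes> g = w \<odot> (g \<otimes> u)" using e by blast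
    have gc: "g \<in> carrier A" using g G by blast
    show "u \<otimes> g \<otimes> inv u \<in> subalg_gen A G"
      unfolding conj_scale(1)[OF u gc w]
      using subalg_ring_closed(7)[OF S] subalg_gen_incl[of G] g by blast
  qed
  have "inv u \<otimes> a \<otimes> inv (inv u) \<in> subalg_gen A G"
  proof (rule img)
    show "inv u \<in> Units A" using u by simp
    fix g assume g: "g \<in> G"
    then obtain w where w: "w \<noteq> 0" "u \<otimes> g = w \<odot> (g \<otimes> u)" using e by blast
    have gc: "g \<in> carrier A" using g G by blast
    show "inv u \<otimes> g \<otimes> inv (inv u) \<in> subalg_gen A G"
      unfolding Units_inv_inv[OF u] conj_scale(2)[OF u gc w(2,1)]
      using subalg_ring_closed(7)[OF S] subalg_gen_incl[of G] g by blast
  qed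
  then show "inv u \<otimes> a \<otimes> u \<in> subalg_gen A G" using u by simp
qed

text \<open>Pivots commute, so dividing a generator by a pivot leaves its weight unchanged. The
  generators of \<open>Bp\<close> and \<open>Bm\<close> thus inherit the weights of their
  numerators.\<close>

lemma scale_mult_inv:
  assumes u: "u \<in> carrier A" and a: "a \<in> carrier A" and b: "b \<in> Units A"
    and e: "u \<otimes> a = w \<odot> (a \<otimes> u)" and c: "u \<otimes> b = b \<otimes> u"
  shows "u \<otimes> (a \<otimes> inv b) = w \<odot> ((a \<otimes> inv b) \<otimes> u)"
proof -
  have "u \<otimes> (a \<otimes> inv b) = (u \<otimes> a) \<otimes> inv b" using u a b by (simp add: m_assoc)
  also have "\<dots> = w \<odot> (a \<otimes> (u \<otimes> inv b))" unfolding e using u a b by (simp add: smult_mult_l m_assoc)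
  also have "\<dots> = w \<odot> (a \<otimes> (inv b \<otimes> u))" unfolding Units_inv_commute[OF b u c] ..
  also have "\<dots> = w \<odot> ((a \<otimes> inv b) \<otimes> u)" using u a b by (simp add: m_assoc)
  finally show ?thesis .
qed

end

lemma weight_nonzero: "q \<noteq> 0 \<Longrightarrow> row_wt q a i * col_wt q b j \<noteq> 0"
  by (simp add: row_wt_def col_wt_def)

lemma image_case_prod:
  "(\<lambda>(i, j). f i j) ` {(i, j). Q i j} = {f i j | i j. Q i j}"
  "(\<lambda>(i, j). f i j) ` {(g s, h s) | s. Q' s} = {f (g s) (h s) | s. Q' s}"
  by force+

section \<open>Index sequences and the positions that are killed or inverted\<close>

locale rc_pair =
  fixes n :: nat and q :: "'k::field" and r c :: "nat list" and t :: nat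
  assumes q: "q \<noteq> 0" and rc: "(r, c) \<in> RC n" and t: "t = length r"
begin

abbreviation "RP \<equiv> Rp n q r"
abbreviation "RM \<equiv> Rm n q c"
abbreviation "YY \<equiv> Y n q r"
abbreviation "ZZ \<equiv> Z n q c"

lemma ent_in:
  assumes "l \<in> {1..t}"
  shows "ent r l \<in> {1..n}" "ent c l \<in> {1..n}"
proof -
  have "r ! (l - 1) \<in> set r" "c ! (l - 1) \<in> set c"
    using assms rc t by (auto simp: RC_def intro!: nth_mem)
  then show "ent r l \<in> {1..n}" "ent c l \<in> {1..n}" using rc unfolding RC_def ent_def by blast+
qed

lemma ent_mono:
  assumes "j \<in> {1..t}" "l \<in> {1..t}" "j < l"
  shows "ent r j < ent r l" "ent c j < ent c l"
proof -
  have "sorted_wrt (<) r" "sorted_wrt (<) c" "length c = length r" using rc by (auto simp: RC_def)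
  \<comment> \<open>List positions start at 0 and sequence indices at 1; since \<open>j\<close> is
    at least 1, the truncated subtraction keeps the order strict.\<close>
  moreover have "j - 1 < l - 1" "l - 1 < length r" using assms t by auto
  ultimately show "ent r j < ent r l" "ent c j < ent c l"
    unfolding ent_def by (auto intro: sorted_wrt_nth_less)
qed

lemma t_le: "t \<le> n"
proof -
  have "distinct r" "set r \<subseteq> {1..n}"
    using rc by (auto simp: RC_def strict_sorted_iff)
  then show ?thesis using card_mono[of "{1..n}" "set r"] by (simp add: t distinct_card)
qed

lemma length_c: "length c = t"
  using rc t by (auto simp: RC_def)

lemma idx: "l \<in> {1..t} \<Longrightarrow> l \<in> {1..n}"
  using t_le by auto

definition "Pp = {(i, j). i \<in> {1..n} \<and> j \<in> {1..n} \<and> (j > length r \<or> i < ent r j)}"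
definition "Up = {(ent r s, s) | s. s \<in> {1..length r}}"
definition "Pm = {(i, j). i \<in> {1..n} \<and> j \<in> {1..n} \<and> (i > length c \<or> j < ent c i)}"
definition "Um = {(s, ent c s) | s. s \<in> {1..length c}}"

sublocale LP: qmat_localization n q Pp Up
proof
  show "Pp \<subseteq> {1..n} \<times> {1..n}" unfolding Pp_def by blast
  show "Up \<subseteq> {1..n} \<times> {1..n}" unfolding Up_def using ent_in(1) idx t by blast
qed

sublocale LM: qmat_localization n q Pm Um
proof
  show "Pm \<subseteq> {1..n} \<times> {1..n}" unfolding Pm_def by blast
  show "Um \<subseteq> {1..n} \<times> {1..n}" unfolding Um_def using ent_in(2) idx length_c by blast
qed

section \<open>Identification of the two algebras as instances of
  \<open>qmat_localization\<close>\<close>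

lemma Jp_eq: "Jp n q r = LP.JP"
  unfolding Jp_def LP.JP_def unfolding Pp_def image_case_prod ..

lemma Jm_eq: "Jm n q c = LM.JP"
  unfolding Jm_def LM.JP_def unfolding Pm_def image_case_prod ..

lemma Rp0_eq: "Rp0 n q r = LP.R0" and Y0_eq: "Y0 n q r = LP.y0"
  by (simp_all add: Rp0_def LP.R0_def Y0_def LP.y0_def Jp_eq fun_eq_iff)

lemma Rm0_eq: "Rm0 n q c = LM.R0" and Z0_eq: "Z0 n q c = LM.y0"
  by (simp_all add: Rm0_def LM.R0_def Z0_def LM.y0_def Jm_eq fun_eq_iff)

lemma Sp_eq: "Sp n q r = LP.SU"
  unfolding Sp_def LP.SU_def Y0_eq unfolding Up_def image_case_prod ..

lemma Sm_eq: "Sm n q c = LM.SU"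
  unfolding Sm_def LM.SU_def Z0_eq unfolding Um_def image_case_prod ..

lemma RP_eq: "RP = LP.R" and YY_eq: "YY = LP.y"
  by (simp_all add: Rp_def LP.R_def Y_def LP.y_def Rp0_eq Sp_eq Y0_eq fun_eq_iff)

lemma RM_eq: "RM = LM.R" and ZZ_eq: "ZZ = LM.y"
  by (simp_all add: Rm_def LM.R_def Z_def LM.y_def Rm0_eq Sm_eq Z0_eq fun_eq_iff)

sublocale RP: kalg RP unfolding RP_eq by (rule LP.R.kalg_axioms)
sublocale RM: kalg RM unfolding RM_eq by (rule LM.R.kalg_axioms)
sublocale T: tensor RP RM by unfold_locales

lemma YY_family: "qmat_family n q RP YY"
  unfolding RP_eq YY_eq by (rule LP.y_family)

lemma ZZ_family: "qmat_family n q RM ZZ"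
  unfolding RM_eq ZZ_eq by (rule LM.y_family)

lemma RP_universal:
  fixes E :: "('k, 'b) module"
  assumes "kalg E" "qmat_family n q E z" "\<And>i j. (i, j) \<in> Pp \<Longrightarrow> z i j = \<zero>\<^bsub>E\<^esub>"
    "\<And>i j. (i, j) \<in> Up \<Longrightarrow> z i j \<in> Units E"
  shows "\<exists>g\<in>alg_hom RP E. \<forall>i\<in>{1..n}. \<forall>j\<in>{1..n}. g (YY i j) = z i j"
  unfolding RP_eq YY_eq by (rule LP.universal[OF assms])

lemmas YY_closed = qmat_familyD(1)[OF YY_family]
lemmas ZZ_closed = qmat_familyD(1)[OF ZZ_family]

section \<open>The pivots: invertibility, weights and commutation\<close>

abbreviation "p l \<equiv> YY (ent r l) l"
abbreviation "u l \<equiv> ZZ l (ent c l)"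
abbreviation "x l \<equiv> T.pt (p l) (u l)"
abbreviation "ip l \<equiv> inv\<^bsub>RP\<^esub> (p l)"
abbreviation "iu l \<equiv> inv\<^bsub>RM\<^esub> (u l)"

lemma p_Units: "l \<in> {1..t} \<Longrightarrow> p l \<in> Units RP"
  unfolding RP_eq YY_eq by (rule LP.y_Units) (auto simp: Up_def t)

lemma u_Units: "l \<in> {1..t} \<Longrightarrow> u l \<in> Units RM"
  unfolding RM_eq ZZ_eq by (rule LM.y_Units) (auto simp: Um_def length_c)

lemma YY_zero: "i \<in> {1..n} \<Longrightarrow> j \<in> {1..n} \<Longrightarrow> t < j \<or> i < ent r j \<Longrightarrow> YY i j = \<zero>\<^bsub>RP\<^esub>"
  unfolding RP_eq YY_eq by (rule LP.y_zero) (auto simp: Pp_def t)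

text \<open>Written with the column index first, in the form that the transposed family
  \<open>\<lambda>i j. ZZ j i\<close> requires in \<open>qmat_family_pivot_commute\<close>.\<close>

lemma ZZ_zero: "i \<in> {1..n} \<Longrightarrow> j \<in> {1..n} \<Longrightarrow> t < j \<or> i < ent c j \<Longrightarrow> ZZ j i = \<zero>\<^bsub>RM\<^esub>"
  unfolding RM_eq ZZ_eq by (rule LM.y_zero) (auto simp: Pm_def length_c)

lemma p_scale:
  "l \<in> {1..t} \<Longrightarrow> i \<in> {1..n} \<Longrightarrow> j \<in> {1..n} \<Longrightarrow>
    p l \<otimes>\<^bsub>RP\<^esub> YY i j = (row_wt q (ent r l) i * col_wt q l j) \<odot>\<^bsub>RP\<^esub> (YY i j \<otimes>\<^bsub>RP\<^esub> p l)"
  by (rule RP.qmat_family_pivot_commute[OF q YY_family ent_in(1) ent_mono(1) t_le YY_zero])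

lemma u_scale:
  "l \<in> {1..t} \<Longrightarrow> i \<in> {1..n} \<Longrightarrow> j \<in> {1..n} \<Longrightarrow>
    u l \<otimes>\<^bsub>RM\<^esub> ZZ j i = (row_wt q (ent c l) i * col_wt q l j) \<odot>\<^bsub>RM\<^esub> (ZZ j i \<otimes>\<^bsub>RM\<^esub> u l)"
  by (rule RM.qmat_family_pivot_commute[OF q RM.qmat_family_transpose[OF ZZ_family]
        ent_in(2) ent_mono(2) t_le ZZ_zero])

text \<open>Either \<open>m = l\<close>, and the weights \<open>inverse q\<close> and
  \<open>q\<close> cancel, or the sequences being strictly increasing puts the two pivots in
  different rows and different columns, and both weights are 1.\<close>

lemma pivot_weight:
  assumes l: "l \<in> {1..t}" and m: "m \<in> {1..t}"
  shows "row_wt q (ent r l) (ent r m) * col_wt q l m = 1" "row_wt q (ent c l) (ent c m) * col_wt q l m = 1"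
proof -
  have "m \<noteq> l \<Longrightarrow> ent r m \<noteq> ent r l \<and> ent c m \<noteq> ent c l"
    using ent_mono[OF l m] ent_mono[OF m l] by (cases "l < m") auto
  then show "row_wt q (ent r l) (ent r m) * col_wt q l m = 1" "row_wt q (ent c l) (ent c m) * col_wt q l m = 1"
    using q by (auto simp: row_wt_def col_wt_def)
qed

lemma p_commute: "l \<in> {1..t} \<Longrightarrow> m \<in> {1..t} \<Longrightarrow> p l \<otimes>\<^bsub>RP\<^esub> p m = p m \<otimes>\<^bsub>RP\<^esub> p l"
  using p_scale[of l "ent r m" m] pivot_weight(1)[of l m] ent_in(1)[of m] idx[of m]
    p_Units[of l] p_Units[of m] by (simp add: RP.Units_closed)

lemma u_commute: "l \<in> {1..t} \<Longrightarrow> m \<in> {1..t} \<Longrightarrow> u l \<otimes>\<^bsub>RM\<^esub> u m = u m \<otimes>\<^bsub>RM\<^esub> u l"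
  using u_scale[of l "ent c m" m] pivot_weight(2)[of l m] ent_in(2)[of m] idx[of m]
    u_Units[of l] u_Units[of m] by (simp add: RM.Units_closed)

section \<open>The subalgebras \<open>Bp\<close> and \<open>Bm\<close> and conjugation by the
  pivots\<close>

definition "Gp = {YY i l \<otimes>\<^bsub>RP\<^esub> ip l | i l. l \<in> {1..t} \<and> i \<in> {1..n} \<and> i > ent r l}"
definition "Gm = {ZZ l j \<otimes>\<^bsub>RM\<^esub> iu l | j l. l \<in> {1..t} \<and> j \<in> {1..n} \<and> j > ent c l}"

lemma Bp_eq: "Bp n q r = subalg_gen RP Gp" and Bm_eq: "Bm n q c = subalg_gen RM Gm"
  by (simp_all add: Bp_def Bm_def Gp_def Gm_def t[symmetric] length_c)

lemma Gp_carrier: "Gp \<subseteq> carrier RP"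
  unfolding Gp_def using YY_closed p_Units idx by blast

lemma Gm_carrier: "Gm \<subseteq> carrier RM"
  unfolding Gm_def using ZZ_closed u_Units idx by blast

lemma subalg_Bp: "subalg (Bp n q r) RP"
  unfolding Bp_eq by (rule RP.subalg_subalg_gen[OF Gp_carrier])

lemma subalg_Bm: "subalg (Bm n q c) RM"
  unfolding Bm_eq by (rule RM.subalg_subalg_gen[OF Gm_carrier])

lemma conj_Bp:
  assumes l: "l \<in> {1..t}" and a: "a \<in> Bp n q r"
  shows "p l \<otimes>\<^bsub>RP\<^esub> a \<otimes>\<^bsub>RP\<^esub> ip l \<in> Bp n q r" "ip l \<otimes>\<^bsub>RP\<^esub> a \<otimes>\<^bsub>RP\<^esub> p l \<in> Bp n q r"
proof -
  have "\<exists>w. w \<noteq> 0 \<and> p l \<otimes>\<^bsub>RP\<^esub> g = w \<odot>\<^bsub>RP\<^esub> (g \<otimes>\<^bsub>RP\<^esub> p l)" if gG: "g \<in> Gp" for g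
  proof -
    obtain i m where g: "g = YY i m \<otimes>\<^bsub>RP\<^esub> ip m" and m: "m \<in> {1..t}" and i: "i \<in> {1..n}"
      using gG unfolding Gp_def by blast
    have "p l \<otimes>\<^bsub>RP\<^esub> g = (row_wt q (ent r l) i * col_wt q l m) \<odot>\<^bsub>RP\<^esub> (g \<otimes>\<^bsub>RP\<^esub> p l)"
      unfolding g
      by (rule RP.scale_mult_inv[OF RP.Units_closed[OF p_Units[OF l]] YY_closed[OF i idx[OF m]] p_Units[OF m]
            p_scale[OF l i idx[OF m]] p_commute[OF l m]])
    then show ?thesis using weight_nonzero[OF q] by blast
  qed
  from RP.conj_subalg_gen[OF p_Units[OF l] Gp_carrier this a[unfolded Bp_eq]]
  show "p l \<otimes>\<^bsub>RP\<^esub> a \<otimes>\<^bsub>RP\<^esub> ip l \<in> Bp n q r" "ip l \<otimes>\<^bsub>RP\<^esub> a \<otimes>\<^bsub>RP\<^esub> p l \<in> Bp n q r"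
    unfolding Bp_eq by blast+
qed

lemma conj_Bm:
  assumes l: "l \<in> {1..t}" and a: "a \<in> Bm n q c"
  shows "u l \<otimes>\<^bsub>RM\<^esub> a \<otimes>\<^bsub>RM\<^esub> iu l \<in> Bm n q c" "iu l \<otimes>\<^bsub>RM\<^esub> a \<otimes>\<^bsub>RM\<^esub> u l \<in> Bm n q c"
proof -
  have "\<exists>w. w \<noteq> 0 \<and> u l \<otimes>\<^bsub>RM\<^esub> g = w \<odot>\<^bsub>RM\<^esub> (g \<otimes>\<^bsub>RM\<^esub> u l)" if gG: "g \<in> Gm" for g
  proof -
    obtain j m where g: "g = ZZ m j \<otimes>\<^bsub>RM\<^esub> iu m" and m: "m \<in> {1..t}" and j: "j \<in> {1..n}"
      using gG unfolding Gm_def by blast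
    have "u l \<otimes>\<^bsub>RM\<^esub> g = (row_wt q (ent c l) j * col_wt q l m) \<odot>\<^bsub>RM\<^esub> (g \<otimes>\<^bsub>RM\<^esub> u l)"
      unfolding g
      by (rule RM.scale_mult_inv[OF RM.Units_closed[OF u_Units[OF l]] ZZ_closed[OF idx[OF m] j] u_Units[OF m]
            u_scale[OF l j idx[OF m]] u_commute[OF l m]])
    then show ?thesis using weight_nonzero[OF q] by blast
  qed
  from RM.conj_subalg_gen[OF u_Units[OF l] Gm_carrier this a[unfolded Bm_eq]]
  show "u l \<otimes>\<^bsub>RM\<^esub> a \<otimes>\<^bsub>RM\<^esub> iu l \<in> Bm n q c" "iu l \<otimes>\<^bsub>RM\<^esub> a \<otimes>\<^bsub>RM\<^esub> u l \<in> Bm n q c"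
    unfolding Bm_eq by blast+
qed

section \<open>The coefficient algebra and the pivot products\<close>

abbreviation "S \<equiv> tensor_sub RP RM (Bp n q r) (Bm n q c)"

lemma subalg_S: "subalg S T.AC"
  by (rule T.subalg_tensor_sub[OF subalg_Bp subalg_Bm])

lemma Bp_carrier: "a \<in> Bp n q r \<Longrightarrow> a \<in> carrier RP"
  using RP.subalg_ring_closed(1)[OF subalg_Bp] by blast

lemma Bm_carrier: "a \<in> Bm n q c \<Longrightarrow> a \<in> carrier RM"
  using RM.subalg_ring_closed(1)[OF subalg_Bm] by blast

lemma x_Units:
  assumes l: "l \<in> {1..t}"
  shows "x l \<in> Units T.AC" "inv\<^bsub>T.AC\<^esub> x l = T.pt (ip l) (iu l)"
proof -
  note pu = p_Units[OF l] u_Units[OF l]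
  have c: "x l \<in> carrier T.AC" "T.pt (ip l) (iu l) \<in> carrier T.AC"
    using pu by (simp_all add: RP.Units_closed RM.Units_closed)
  have i: "x l \<otimes>\<^bsub>T.AC\<^esub> T.pt (ip l) (iu l) = \<one>\<^bsub>T.AC\<^esub>" "T.pt (ip l) (iu l) \<otimes>\<^bsub>T.AC\<^esub> x l = \<one>\<^bsub>T.AC\<^esub>"
    using pu by (simp_all add: T.pt_mult RP.Units_closed RM.Units_closed T.pt_one)
  show "x l \<in> Units T.AC" using c i unfolding Units_def by blast
  show "inv\<^bsub>T.AC\<^esub> x l = T.pt (ip l) (iu l)" by (rule T.AC.inv_unique'[OF c i, symmetric])
qed

lemma conj_pt:
  assumes l: "l \<in> {1..t}" and a: "a \<in> carrier RP" and b: "b \<in> carrier RM"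
  shows "x l \<otimes>\<^bsub>T.AC\<^esub> T.pt a b \<otimes>\<^bsub>T.AC\<^esub> inv\<^bsub>T.AC\<^esub> x l =
      T.pt (p l \<otimes>\<^bsub>RP\<^esub> a \<otimes>\<^bsub>RP\<^esub> ip l) (u l \<otimes>\<^bsub>RM\<^esub> b \<otimes>\<^bsub>RM\<^esub> iu l)"
    "inv\<^bsub>T.AC\<^esub> x l \<otimes>\<^bsub>T.AC\<^esub> T.pt a b \<otimes>\<^bsub>T.AC\<^esub> x l =
      T.pt (ip l \<otimes>\<^bsub>RP\<^esub> a \<otimes>\<^bsub>RP\<^esub> p l) (iu l \<otimes>\<^bsub>RM\<^esub> b \<otimes>\<^bsub>RM\<^esub> u l)"
  using p_Units[OF l] u_Units[OF l] a b
  by (simp_all add: x_Units(2)[OF l] T.pt_mult RP.Units_closed RM.Units_closed)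

text \<open>The elements whose conjugate lies in \<open>S\<close> form a subalgebra, so pure tensors
  suffice; on these conjugation acts factorwise and preserves \<open>Bp\<close> and
  \<open>Bm\<close>.\<close>

lemma conj_S:
  assumes l: "l \<in> {1..t}" and s: "s \<in> S"
  shows "x l \<otimes>\<^bsub>T.AC\<^esub> s \<otimes>\<^bsub>T.AC\<^esub> inv\<^bsub>T.AC\<^esub> x l \<in> S" "inv\<^bsub>T.AC\<^esub> x l \<otimes>\<^bsub>T.AC\<^esub> s \<otimes>\<^bsub>T.AC\<^esub> x l \<in> S"
proof -
  note X = x_Units(1)[OF l]
  have img: "v \<otimes>\<^bsub>T.AC\<^esub> s \<otimes>\<^bsub>T.AC\<^esub> inv\<^bsub>T.AC\<^esub> v \<in> S"
    if v: "v \<in> Units T.AC"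
      and pt: "\<And>a b. a \<in> Bp n q r \<Longrightarrow> b \<in> Bm n q c \<Longrightarrow> v \<otimes>\<^bsub>T.AC\<^esub> T.pt a b \<otimes>\<^bsub>T.AC\<^esub> inv\<^bsub>T.AC\<^esub> v \<in> S" for v
  proof -
    have h: "alg_hom_pair T.AC T.AC (\<lambda>s. v \<otimes>\<^bsub>T.AC\<^esub> s \<otimes>\<^bsub>T.AC\<^esub> inv\<^bsub>T.AC\<^esub> v)"
      using T.AC.conj_alg_aut[OF v] unfolding alg_aut_def
      by (intro alg_hom_pair.intro T.AC.kalg_axioms alg_hom_pair_axioms.intro) blast
    have "S \<subseteq> {s \<in> carrier T.AC. v \<otimes>\<^bsub>T.AC\<^esub> s \<otimes>\<^bsub>T.AC\<^esub> inv\<^bsub>T.AC\<^esub> v \<in> S}"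
      by (rule T.tensor_sub_minimal[OF alg_hom_pair.subalg_vimage[OF h subalg_S]])
        (use Bp_carrier Bm_carrier pt in blast)+
    then show ?thesis using s by blast
  qed
  show "x l \<otimes>\<^bsub>T.AC\<^esub> s \<otimes>\<^bsub>T.AC\<^esub> inv\<^bsub>T.AC\<^esub> x l \<in> S"
  proof (rule img[OF X])
    fix a b assume a: "a \<in> Bp n q r" and b: "b \<in> Bm n q c"
    show "x l \<otimes>\<^bsub>T.AC\<^esub> T.pt a b \<otimes>\<^bsub>T.AC\<^esub> inv\<^bsub>T.AC\<^esub> x l \<in> S"
      unfolding conj_pt[OF l Bp_carrier[OF a] Bm_carrier[OF b]]
      by (rule T.pt_in_tensor_sub[OF conj_Bp(1)[OF l a] conj_Bm(1)[OF l b]])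
  qed
  have "inv\<^bsub>T.AC\<^esub> x l \<otimes>\<^bsub>T.AC\<^esub> s \<otimes>\<^bsub>T.AC\<^esub> inv\<^bsub>T.AC\<^esub> (inv\<^bsub>T.AC\<^esub> x l) \<in> S"
  proof (rule img[OF T.AC.Units_inv_Units[OF X]])
    fix a b assume a: "a \<in> Bp n q r" and b: "b \<in> Bm n q c"
    show "inv\<^bsub>T.AC\<^esub> x l \<otimes>\<^bsub>T.AC\<^esub> T.pt a b \<otimes>\<^bsub>T.AC\<^esub> inv\<^bsub>T.AC\<^esub> (inv\<^bsub>T.AC\<^esub> x l) \<in> S"
      unfolding T.AC.Units_inv_inv[OF X] conj_pt[OF l Bp_carrier[OF a] Bm_carrier[OF b]]
      by (rule T.pt_in_tensor_sub[OF conj_Bp(2)[OF l a] conj_Bm(2)[OF l b]])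
  qed
  then show "inv\<^bsub>T.AC\<^esub> x l \<otimes>\<^bsub>T.AC\<^esub> s \<otimes>\<^bsub>T.AC\<^esub> x l \<in> S"
    unfolding T.AC.Units_inv_inv[OF X] .
qed

section \<open>Generation of \<open>B\<close> by the coefficient algebra and the pivot
  products\<close>

definition "GB = {T.pt (YY i l) (ZZ l j) | i j l. l \<in> {1..t} \<and> i \<in> {1..n} \<and> j \<in> {1..n} \<and> i \<ge> ent r l \<and> j \<ge> ent c l}
  \<union> {T.pt (ip l) (iu l) | l. l \<in> {1..t}}"
abbreviation "BB \<equiv> B n q r c"

lemma BB_eq: "BB = subalg_gen T.AC GB"
  unfolding B_def GB_def t[symmetric] ..

lemma GB_carrier: "GB \<subseteq> carrier T.AC"
  unfolding GB_def using YY_closed ZZ_closed idx p_Units u_Units by blast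

lemma subalg_BB: "subalg BB T.AC"
  unfolding BB_eq by (rule T.AC.subalg_subalg_gen[OF GB_carrier])

lemma GB_BB: "g \<in> GB \<Longrightarrow> g \<in> BB"
  unfolding BB_eq using T.AC.subalg_gen_incl by blast

lemma pt_in_BB:
  assumes "l \<in> {1..t}" "i \<in> {1..n}" "j \<in> {1..n}" "i \<ge> ent r l" "j \<ge> ent c l"
  shows "T.pt (YY i l) (ZZ l j) \<in> BB"
  by (rule GB_BB) (use assms in \<open>auto simp: GB_def\<close>)

lemma inv_in_BB: "l \<in> {1..t} \<Longrightarrow> T.pt (ip l) (iu l) \<in> BB"
  by (rule GB_BB) (auto simp: GB_def)

lemma GpE:
  assumes "g \<in> Gp"
  obtains i l where "g = YY i l \<otimes>\<^bsub>RP\<^esub> ip l" "l \<in> {1..t}" "i \<in> {1..n}" "ent r l < i"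
  using assms unfolding Gp_def by blast

lemma GmE:
  assumes "g \<in> Gm"
  obtains j l where "g = ZZ l j \<otimes>\<^bsub>RM\<^esub> iu l" "l \<in> {1..t}" "j \<in> {1..n}" "ent c l < j"
  using assms unfolding Gm_def by blast

lemma left_hom: "alg_hom_pair RP T.AC (\<lambda>a. T.pt a \<one>\<^bsub>RM\<^esub>)"
  by (intro alg_hom_pair.intro RP.kalg_axioms T.AC.kalg_axioms alg_hom_pair_axioms.intro T.pt_left_alg_hom)

lemma right_hom: "alg_hom_pair RM T.AC (T.pt \<one>\<^bsub>RP\<^esub>)"
  by (intro alg_hom_pair.intro RM.kalg_axioms T.AC.kalg_axioms alg_hom_pair_axioms.intro T.pt_right_alg_hom)

text \<open>A quotient \<open>Y_il p_l^-1\<close> on one side alone is obtained by choosing the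
  pivot on the other side: the product of \<open>Y_il (x) u_l\<close> and
  \<open>p_l^-1 (x) u_l^-1\<close> has second factor 1. The same works with the factors exchanged,
  and the two kinds of elements multiply to all pure tensors.\<close>

lemma S_BB: "S \<subseteq> BB"
proof (rule T.tensor_sub_minimal[OF subalg_BB])
  note BBc = T.AC.subalg_ring_closed[OF subalg_BB]
  have "(\<lambda>a. T.pt a \<one>\<^bsub>RM\<^esub>) ` subalg_gen RP Gp \<subseteq> BB"
  proof (rule alg_hom_pair.image_subalg_gen[OF left_hom subalg_BB Gp_carrier], rule image_subsetI)
    fix g assume "g \<in> Gp"
    then obtain i l where g: "g = YY i l \<otimes>\<^bsub>RP\<^esub> ip l" and l: "l \<in> {1..t}" and i: "i \<in> {1..n}" "ent r l < i"
      by (rule GpE)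
    have "T.pt g \<one>\<^bsub>RM\<^esub> = T.pt (YY i l) (u l) \<otimes>\<^bsub>T.AC\<^esub> T.pt (ip l) (iu l)"
      unfolding g using p_Units[OF l] u_Units[OF l] YY_closed[OF i(1) idx[OF l]]
      by (simp add: T.pt_mult RM.Units_closed)
    then show "T.pt g \<one>\<^bsub>RM\<^esub> \<in> BB"
      using BBc(5)[OF pt_in_BB[OF l i(1) ent_in(2)[OF l]] inv_in_BB[OF l]] i(2) by simp
  qed
  then have 1: "T.pt a \<one>\<^bsub>RM\<^esub> \<in> BB" if "a \<in> Bp n q r" for a
    using that unfolding Bp_eq by blast
  have "T.pt \<one>\<^bsub>RP\<^esub> ` subalg_gen RM Gm \<subseteq> BB"
  proof (rule alg_hom_pair.image_subalg_gen[OF right_hom subalg_BB Gm_carrier], rule image_subsetI)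
    fix g assume "g \<in> Gm"
    then obtain j l where g: "g = ZZ l j \<otimes>\<^bsub>RM\<^esub> iu l" and l: "l \<in> {1..t}" and j: "j \<in> {1..n}" "ent c l < j"
      by (rule GmE)
    have "T.pt \<one>\<^bsub>RP\<^esub> g = T.pt (p l) (ZZ l j) \<otimes>\<^bsub>T.AC\<^esub> T.pt (ip l) (iu l)"
      unfolding g using p_Units[OF l] u_Units[OF l] ZZ_closed[OF idx[OF l] j(1)]
      by (simp add: T.pt_mult RP.Units_closed)
    then show "T.pt \<one>\<^bsub>RP\<^esub> g \<in> BB"
      using BBc(5)[OF pt_in_BB[OF l ent_in(1)[OF l] j(1)] inv_in_BB[OF l]] j(2) by simp
  qed
  then have 2: "T.pt \<one>\<^bsub>RP\<^esub> b \<in> BB" if "b \<in> Bm n q c" for b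
    using that unfolding Bm_eq by blast
  show "T.pt a b \<in> BB" if "a \<in> Bp n q r" "b \<in> Bm n q c" for a b
    unfolding T.pt_split(1)[OF Bp_carrier[OF that(1)] Bm_carrier[OF that(2)]]
    by (rule BBc(5)[OF 1[OF that(1)] 2[OF that(2)]])
qed (use Bp_carrier Bm_carrier in blast)+

text \<open>Each generator \<open>Y_il (x) Z_lj\<close> is
  \<open>Y_il p_l^-1 (x) Z_lj u_l^-1\<close> times the pivot product with the same index
  \<open>l\<close>, and the other generators are the inverses of the pivot products.\<close>

lemma BB_minimal:
  assumes D: "subalg D T.AC" and S: "S \<subseteq> D"
    and x: "\<And>l. l \<in> {1..t} \<Longrightarrow> x l \<in> D \<and> inv\<^bsub>T.AC\<^esub> x l \<in> D"
  shows "BB \<subseteq> D"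
  unfolding BB_eq
proof (rule T.AC.subalg_gen_subset[OF D], rule subsetI)
  note Dc = T.AC.subalg_ring_closed[OF D]
  fix g assume "g \<in> GB"
  then consider (1) i j l where "g = T.pt (YY i l) (ZZ l j)" "l \<in> {1..t}" "i \<in> {1..n}" "j \<in> {1..n}"
      "ent r l \<le> i" "ent c l \<le> j"
    | (2) l where "g = T.pt (ip l) (iu l)" "l \<in> {1..t}"
    unfolding GB_def by blast
  then show "g \<in> D"
  proof cases
    case 1
    note l = 1(2)
    \<comment> \<open>\<open>B\<close> admits the pivot itself as a factor, while the generators of
      \<open>Bp\<close> lie strictly below it; for the pivot the quotient is 1.\<close>
    have y: "YY i l \<otimes>\<^bsub>RP\<^esub> ip l \<in> Bp n q r"
    proof (cases "i = ent r l")
      case True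
      show ?thesis
        unfolding True RP.Units_r_inv[OF p_Units[OF l]] by (rule RP.subalg_ring_closed(3)[OF subalg_Bp])
    next
      case False
      then have "ent r l < i" using 1(5) by simp
      then have "YY i l \<otimes>\<^bsub>RP\<^esub> ip l \<in> Gp" unfolding Gp_def using l 1(3) by blast
      then show ?thesis unfolding Bp_eq using RP.subalg_gen_incl by blast
    qed
    have z: "ZZ l j \<otimes>\<^bsub>RM\<^esub> iu l \<in> Bm n q c"
    proof (cases "j = ent c l")
      case True
      show ?thesis
        unfolding True RM.Units_r_inv[OF u_Units[OF l]] by (rule RM.subalg_ring_closed(3)[OF subalg_Bm])
    next
      case False
      then have "ent c l < j" using 1(6) by simp
      then have "ZZ l j \<otimes>\<^bsub>RM\<^esub> iu l \<in> Gm" unfolding Gm_def using l 1(4) by blast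
      then show ?thesis unfolding Bm_eq using RM.subalg_gen_incl by blast
    qed
    note cl = RP.Units_closed[OF p_Units[OF l]] RM.Units_closed[OF u_Units[OF l]]
      YY_closed[OF 1(3) idx[OF l]] ZZ_closed[OF idx[OF l] 1(4)]
      RP.Units_inv_closed[OF p_Units[OF l]] RM.Units_inv_closed[OF u_Units[OF l]]
    have "g = T.pt (YY i l \<otimes>\<^bsub>RP\<^esub> ip l) (ZZ l j \<otimes>\<^bsub>RM\<^esub> iu l) \<otimes>\<^bsub>T.AC\<^esub> x l"
      unfolding 1(1) using p_Units[OF l] u_Units[OF l] cl by (simp add: T.pt_mult RP.m_assoc RM.m_assoc)
    moreover have "T.pt (YY i l \<otimes>\<^bsub>RP\<^esub> ip l) (ZZ l j \<otimes>\<^bsub>RM\<^esub> iu l) \<in> D"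
      by (rule subsetD[OF S T.pt_in_tensor_sub[OF y z]])
    ultimately show ?thesis using Dc(5)[OF _ conjunct1[OF x[OF l]]] by simp
  next
    case 2
    show ?thesis unfolding 2(1) x_Units(2)[OF 2(2), symmetric] by (rule conjunct2[OF x[OF 2(2)]])
  qed
qed

end

section \<open>The grading by columns of the first factor\<close>

context rc_pair
begin

abbreviation "End \<equiv> end_alg T.AC :: ('k, ((nat \<Rightarrow> int) \<Rightarrow> ('k qml \<times> 'k qml \<Rightarrow>\<^sub>0 'k) set) \<Rightarrow>
  (nat \<Rightarrow> int) \<Rightarrow> ('k qml \<times> 'k qml \<Rightarrow>\<^sub>0 'k) set) module"
abbreviation "sh \<equiv> shift T.AC :: _ \<Rightarrow> (nat \<Rightarrow> int) \<Rightarrow> _"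
abbreviation "left a \<equiv> T.pt a \<one>\<^bsub>RM\<^esub>"
abbreviation "right b \<equiv> T.pt \<one>\<^bsub>RP\<^esub> b"

sublocale End: kalg End by (rule T.AC.kalg_end_alg)

lemma left_Units:
  assumes "a \<in> Units RP"
  shows "left a \<in> Units T.AC" "inv\<^bsub>T.AC\<^esub> left a = left (inv\<^bsub>RP\<^esub> a)"
  using alg_hom_pair.hom_Units[OF left_hom assms] .

text \<open>The coaction of the torus that records the column degree of the first factor.\<close>

lemma coaction:
  "\<exists>h\<in>alg_hom T.AC End. (\<forall>i\<in>{1..n}. \<forall>j\<in>{1..n}. h (left (YY i j)) = sh (left (YY i j)) (udeg j 1)) \<and>
     (\<forall>b\<in>carrier RM. h (right b) = sh (right b) 0)"
proof -
  \<comment> \<open>Homomorphisms on the two factors extend to the tensor product only if their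
    images commute, so the map on the first factor is constructed with values in the centralizer of
    the image of the second.\<close>
  define C where "C = {E \<in> carrier End. \<forall>F\<in>{sh (right b) 0 | b. b \<in> carrier RM} \<inter> carrier End.
      E \<otimes>\<^bsub>End\<^esub> F = F \<otimes>\<^bsub>End\<^esub> E}"
  have CA: "subalg C End" unfolding C_def by (rule End.subalg_centralizer)
  interpret TC: kalg "End\<lparr>carrier := C\<rparr>" by (rule End.kalg_subalg[OF CA])
  have CE: "C \<subseteq> carrier End" unfolding C_def by blast
  have leftC: "sh (left a) d \<in> C" if a: "a \<in> carrier RP" for a d
    unfolding C_def
  proof (intro CollectI conjI ballI)
    show "sh (left a) d \<in> carrier End" using a by (simp add: T.AC.shift_closed)
    fix F assume "F \<in> {sh (right b) 0 | b. b \<in> carrier RM} \<inter> carrier End"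
    then obtain b where b: "b \<in> carrier RM" "F = sh (right b) 0" by blast
    show "sh (left a) d \<otimes>\<^bsub>End\<^esub> F = F \<otimes>\<^bsub>End\<^esub> sh (left a) d"
      using a b by (simp add: T.AC.shift_mult T.pt_mult)
  qed
  define w where "w i j = sh (left (YY i j)) (udeg j 1)" for i j
  have fam: "qmat_family n q T.AC (\<lambda>i j. left (YY i j))"
    by (rule qmat_family_hom[OF RP.kalg_axioms T.pt_left_alg_hom YY_family])
  note fd = qmat_familyD[OF fam]
  have wfam: "qmat_family n q (End\<lparr>carrier := C\<rparr>) w"
    unfolding w_def
  proof (rule qmat_familyI)
    fix i j assume i: "i \<in> {1..n}" and j: "j \<in> {1..n}"
    show "sh (left (YY i j)) (udeg j 1) \<in> carrier (End\<lparr>carrier := C\<rparr>)"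
      using leftC[OF YY_closed[OF i j]] by simp
    fix l assume l: "l \<in> {1..n}"
    note cl = fd(1)[OF i j] fd(1)[OF l j] fd(1)[OF i l]
    show "sh (left (YY i j)) (udeg j 1) \<otimes>\<^bsub>End\<lparr>carrier := C\<rparr>\<^esub> sh (left (YY l j)) (udeg j 1) =
      q \<odot>\<^bsub>End\<lparr>carrier := C\<rparr>\<^esub> (sh (left (YY l j)) (udeg j 1) \<otimes>\<^bsub>End\<lparr>carrier := C\<rparr>\<^esub> sh (left (YY i j)) (udeg j 1))"
      if "i < l"
      using cl by (simp add: T.AC.shift_mult T.AC.shift_smult fd(2)[OF i j l that])
    show "sh (left (YY i j)) (udeg j 1) \<otimes>\<^bsub>End\<lparr>carrier := C\<rparr>\<^esub> sh (left (YY i l)) (udeg l 1) =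
      q \<odot>\<^bsub>End\<lparr>carrier := C\<rparr>\<^esub> (sh (left (YY i l)) (udeg l 1) \<otimes>\<^bsub>End\<lparr>carrier := C\<rparr>\<^esub> sh (left (YY i j)) (udeg j 1))"
      if "j < l"
      using cl by (simp add: T.AC.shift_mult T.AC.shift_smult fd(3)[OF i j l that] add.commute[of "udeg l 1"])
    fix m assume m: "m \<in> {1..n}"
    note cl = cl fd(1)[OF l m] fd(1)[OF i m]
    show "sh (left (YY i j)) (udeg j 1) \<otimes>\<^bsub>End\<lparr>carrier := C\<rparr>\<^esub> sh (left (YY l m)) (udeg m 1) =
      sh (left (YY l m)) (udeg m 1) \<otimes>\<^bsub>End\<lparr>carrier := C\<rparr>\<^esub> sh (left (YY i j)) (udeg j 1)"
      if "i < l" "m < j"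
      using cl by (simp add: T.AC.shift_mult T.AC.shift_smult fd(4)[OF i j l m that] add.commute[of "udeg m 1"])
    show "sh (left (YY i j)) (udeg j 1) \<otimes>\<^bsub>End\<lparr>carrier := C\<rparr>\<^esub> sh (left (YY l m)) (udeg m 1) =
      sh (left (YY l m)) (udeg m 1) \<otimes>\<^bsub>End\<lparr>carrier := C\<rparr>\<^esub> sh (left (YY i j)) (udeg j 1)
      \<oplus>\<^bsub>End\<lparr>carrier := C\<rparr>\<^esub> (q - inverse q) \<odot>\<^bsub>End\<lparr>carrier := C\<rparr>\<^esub>
        (sh (left (YY i m)) (udeg m 1) \<otimes>\<^bsub>End\<lparr>carrier := C\<rparr>\<^esub> sh (left (YY l j)) (udeg j 1))"
      if "i < l" "j < m"
      \<comment> \<open>The correction term exchanges the columns of its two factors but keeps the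
        pair of columns, so all three products have the same degree.\<close>
      using cl by (simp add: T.AC.shift_mult T.AC.shift_smult T.AC.shift_add fd(5)[OF i j l m that]
          add.commute[of "udeg m 1"])
  qed
  have w0: "w i j = \<zero>\<^bsub>End\<lparr>carrier := C\<rparr>\<^esub>" if "(i, j) \<in> Pp" for i j
  proof -
    interpret h: ring_hom_ring RP T.AC "\<lambda>a. left a"
      using T.pt_left_alg_hom unfolding alg_hom_def
      by (intro ring_hom_ringI2 RP.ring_axioms T.AC.ring_axioms) blast
    have "YY i j = \<zero>\<^bsub>RP\<^esub>" using YY_zero[of i j] that unfolding Pp_def t by blast
    then have "left (YY i j) = \<zero>\<^bsub>T.AC\<^esub>" using h.hom_zero by simp
    then show ?thesis by (simp add: w_def T.AC.shift_zero)
  qed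
  \<comment> \<open>The pivots must be invertible in \<open>C\<close>, so the inverse operator, a
    shift by the opposite degree, has to lie in the centralizer as well; \<open>leftC\<close> holds
    for every element and every degree.\<close>
  have wU: "w i j \<in> Units (End\<lparr>carrier := C\<rparr>)" if "(i, j) \<in> Up" for i j
  proof -
    have ij: "j \<in> {1..t}" "i = ent r j" using that unfolding Up_def t by blast+
    have U: "YY i j \<in> Units RP" using p_Units[OF ij(1)] ij(2) by simp
    note LU = left_Units[OF U]
    let ?v = "sh (left (inv\<^bsub>RP\<^esub> (YY i j))) (- udeg j 1)"
    have "w i j \<in> C" "?v \<in> C"
      unfolding w_def using leftC U by (simp_all add: RP.Units_closed)
    moreover have "w i j \<otimes>\<^bsub>End\<^esub> ?v = \<one>\<^bsub>End\<^esub>" "?v \<otimes>\<^bsub>End\<^esub> w i j = \<one>\<^bsub>End\<^esub>"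
      using T.AC.shift_inverse[OF LU(1), of "udeg j 1"] unfolding w_def LU(2)[symmetric]
      by (metis End.Units_r_inv, metis End.Units_l_inv)
    ultimately show ?thesis unfolding Units_def by auto
  qed
  obtain f where f: "f \<in> alg_hom RP (End\<lparr>carrier := C\<rparr>)"
    and fY: "\<And>i j. i \<in> {1..n} \<Longrightarrow> j \<in> {1..n} \<Longrightarrow> f (YY i j) = w i j"
    using RP_universal[OF TC.kalg_axioms wfam w0 wU] by blast
  have f': "f \<in> alg_hom RP End" by (rule alg_hom_carrier_update[OF f CE])
  have g: "(\<lambda>b. sh (right b) 0) \<in> alg_hom RM End"
  proof (rule alg_homI)
    show "sh (right \<one>\<^bsub>RM\<^esub>) 0 = \<one>\<^bsub>End\<^esub>" by (simp only: T.pt_one T.AC.shift_one)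
  qed (simp_all add: T.AC.shift_closed T.AC.shift_mult T.AC.shift_add T.AC.shift_smult
        T.pt_mult T.pt_add_r T.pt_smult)
  have comm: "f a \<otimes>\<^bsub>End\<^esub> sh (right b) 0 = sh (right b) 0 \<otimes>\<^bsub>End\<^esub> f a"
    if "a \<in> carrier RP" "b \<in> carrier RM" for a b
  proof -
    have "f a \<in> C" using alg_homD(1)[OF f that(1)] by simp
    moreover have "sh (right b) 0 \<in> carrier End" using alg_homD(1)[OF g that(2)] .
    ultimately show ?thesis using that(2) unfolding C_def by blast
  qed
  obtain h where h: "h \<in> alg_hom T.AC End"
    and hpt: "\<And>a b. a \<in> carrier RP \<Longrightarrow> b \<in> carrier RM \<Longrightarrow> h (T.pt a b) = f a \<otimes>\<^bsub>End\<^esub> sh (right b) 0"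
    using T.tensor_alg_universal[OF End.kalg_axioms f' g comm] by blast
  have "h (left (YY i j)) = sh (left (YY i j)) (udeg j 1)" if "i \<in> {1..n}" "j \<in> {1..n}" for i j
  proof -
    have "h (left (YY i j)) = w i j \<otimes>\<^bsub>End\<^esub> \<one>\<^bsub>End\<^esub>"
      using hpt[OF YY_closed[OF that] RM.one_closed] unfolding fY[OF that] T.pt_one T.AC.shift_one .
    also have "\<dots> = w i j"
      using alg_homD(1)[OF f' YY_closed[OF that]] unfolding fY[OF that] by (rule End.r_one)
    finally show ?thesis unfolding w_def .
  qed
  moreover have "h (right b) = sh (right b) 0" if "b \<in> carrier RM" for b
  proof -
    have "h (right b) = \<one>\<^bsub>End\<^esub> \<otimes>\<^bsub>End\<^esub> sh (right b) 0"
      using hpt[OF RP.one_closed that] unfolding alg_homD(4)[OF f'] .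
    also have "\<dots> = sh (right b) 0" by (rule End.l_one[OF alg_homD(1)[OF g that]])
    finally show ?thesis .
  qed
  ultimately show ?thesis using h by blast
qed

text \<open>\<open>G d\<close> consists of the elements that the coaction sends to their own shift
  by \<open>d\<close>. Degrees add under products and change sign under inverses, so they can be
  computed from the generators.\<close>

lemma graded:
  obtains G :: "(nat \<Rightarrow> int) \<Rightarrow> ('k qml \<times> 'k qml \<Rightarrow>\<^sub>0 'k) set set"
  where "graded_skew_laurent (T.AC\<lparr>carrier := BB\<rparr>) S t x G"
proof -
  obtain h where h: "h \<in> alg_hom T.AC End"
    and hY: "\<And>i j. i \<in> {1..n} \<Longrightarrow> j \<in> {1..n} \<Longrightarrow> h (left (YY i j)) = sh (left (YY i j)) (udeg j 1)"
    and hR: "\<And>b. b \<in> carrier RM \<Longrightarrow> h (right b) = sh (right b) 0"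
    using coaction by blast
  have hp: "alg_hom_pair T.AC End h"
    by (intro alg_hom_pair.intro T.AC.kalg_axioms End.kalg_axioms alg_hom_pair_axioms.intro h)
  define G where "G d = {z \<in> carrier T.AC. h z = sh z d}" for d
  have Gc: "z \<in> carrier T.AC" if "z \<in> G d" for z d using that by (simp add: G_def)
  have G_mult: "z \<otimes>\<^bsub>T.AC\<^esub> w \<in> G (d + d')" if "z \<in> G d" "w \<in> G d'" for z w d d'
    using that unfolding G_def by (simp add: alg_homD(2)[OF h] T.AC.shift_mult)
  have G_inv: "inv\<^bsub>T.AC\<^esub> z \<in> G (- d)" if "z \<in> G d" "z \<in> Units T.AC" for z d
    using that alg_hom_pair.hom_Units(2)[OF hp that(2)] T.AC.shift_inverse(2)[OF that(2), of d]
    unfolding G_def by simp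
  have G0: "subalg (G 0) T.AC"
  proof (rule T.AC.subalgI)
    show "\<one>\<^bsub>T.AC\<^esub> \<in> G 0" unfolding G_def by (simp add: alg_homD(4)[OF h] T.AC.shift_one)
    fix z w assume z: "z \<in> G 0" and w: "w \<in> G 0"
    show "z \<otimes>\<^bsub>T.AC\<^esub> w \<in> G 0" using G_mult[OF z w] by (simp only: add_0)
    show "z \<oplus>\<^bsub>T.AC\<^esub> w \<in> G 0"
      using z w unfolding G_def by (simp add: alg_homD(3)[OF h] T.AC.shift_add)
  next
    fix z a assume z: "z \<in> G 0"
    show "a \<odot>\<^bsub>T.AC\<^esub> z \<in> G 0"
      using z unfolding G_def by (simp add: alg_homD(5)[OF h] T.AC.shift_smult)
  qed (auto simp: G_def)
  have GY: "left (YY i j) \<in> G (udeg j 1)" if "i \<in> {1..n}" "j \<in> {1..n}" for i j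
    unfolding G_def using hY[OF that] YY_closed[OF that] by simp
  have GR: "right b \<in> G 0" if "b \<in> carrier RM" for b
    unfolding G_def using hR[OF that] that by simp
  have um: "- udeg l 1 = udeg l (- 1)" for l by (auto simp: udeg_def fun_eq_iff)
  have u0: "udeg l 1 + udeg l (- 1) = 0" for l by (auto simp: udeg_def fun_eq_iff)
  \<comment> \<open>A generator of \<open>Bp\<close> is a quotient of two entries of the same
    column, so its degree cancels.\<close>
  have GL: "left a \<in> G 0" if "a \<in> Bp n q r" for a
  proof -
    have "(\<lambda>a. left a) ` subalg_gen RP Gp \<subseteq> G 0"
    proof (rule alg_hom_pair.image_subalg_gen[OF left_hom G0 Gp_carrier], rule image_subsetI)
      fix g assume "g \<in> Gp"
      then obtain i l where g: "g = YY i l \<otimes>\<^bsub>RP\<^esub> ip l" and l: "l \<in> {1..t}" and i: "i \<in> {1..n}"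
        by (rule GpE)
      note LU = left_Units[OF p_Units[OF l]]
      have "left (ip l) \<in> G (udeg l (- 1))"
        using G_inv[OF GY[OF ent_in(1)[OF l] idx[OF l]] LU(1)] unfolding LU(2) um .
      from G_mult[OF GY[OF i idx[OF l]] this] have "left (YY i l) \<otimes>\<^bsub>T.AC\<^esub> left (ip l) \<in> G 0"
        unfolding u0 .
      then show "left g \<in> G 0"
        unfolding g using YY_closed[OF i idx[OF l]] p_Units[OF l] by (simp add: T.pt_mult)
    qed
    then show ?thesis using that unfolding Bp_eq by blast
  qed
  have SG: "S \<subseteq> G 0"
  proof (rule T.tensor_sub_minimal[OF G0])
    show "T.pt a b \<in> G 0" if "a \<in> Bp n q r" "b \<in> Bm n q c" for a b
      unfolding T.pt_split(1)[OF Bp_carrier[OF that(1)] Bm_carrier[OF that(2)]]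
      by (rule T.AC.subalg_ring_closed(5)[OF G0 GL[OF that(1)] GR[OF Bm_carrier[OF that(2)]]])
  qed (use Bp_carrier Bm_carrier in blast)+
  \<comment> \<open>The second tensor factor has degree 0, hence a pivot product has the degree of
    its first factor.\<close>
  have xG: "x l \<in> G (udeg l 1)" if l: "l \<in> {1..t}" for l
  proof -
    have uc: "u l \<in> carrier RM" using u_Units[OF l] by (rule RM.Units_closed)
    have pc: "p l \<in> carrier RP" using p_Units[OF l] by (rule RP.Units_closed)
    show ?thesis
      using G_mult[OF GY[OF ent_in(1)[OF l] idx[OF l]] GR[OF uc]]
      unfolding T.pt_split(1)[OF pc uc] add_0_right .
  qed
  let ?R = "T.AC\<lparr>carrier := BB\<rparr>"
  note BBc = T.AC.subalg_ring_closed[OF subalg_BB]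
  interpret R: kalg ?R by (rule T.AC.kalg_subalg[OF subalg_BB])
  have inc: "(\<lambda>z. z) \<in> alg_hom ?R T.AC"
    by (rule alg_homI) (use BBc(1) in auto)
  have incp: "alg_hom_pair ?R T.AC (\<lambda>z. z)"
    by (intro alg_hom_pair.intro R.kalg_axioms T.AC.kalg_axioms alg_hom_pair_axioms.intro inc)
  have xB: "x l \<in> BB" "inv\<^bsub>T.AC\<^esub> x l \<in> BB" if l: "l \<in> {1..t}" for l
    unfolding x_Units(2)[OF l]
    using pt_in_BB[OF l ent_in(1)[OF l] ent_in(2)[OF l]] inv_in_BB[OF l] by simp_all
  have xU: "x l \<in> Units ?R" if l: "l \<in> {1..t}" for l
  proof -
    have "x l \<otimes>\<^bsub>T.AC\<^esub> inv\<^bsub>T.AC\<^esub> x l = \<one>\<^bsub>T.AC\<^esub>" "inv\<^bsub>T.AC\<^esub> x l \<otimes>\<^bsub>T.AC\<^esub> x l = \<one>\<^bsub>T.AC\<^esub>"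
      using x_Units(1)[OF l] by (rule T.AC.Units_r_inv, rule T.AC.Units_l_inv)
    then show ?thesis using xB[OF l] unfolding Units_def by auto
  qed
  \<comment> \<open>The inclusion of \<open>B\<close> is a homomorphism, so inverses taken in
    \<open>B\<close> and in the ambient algebra agree.\<close>
  have xinv: "inv\<^bsub>?R\<^esub> x l = inv\<^bsub>T.AC\<^esub> x l" if l: "l \<in> {1..t}" for l
    using alg_hom_pair.hom_Units(2)[OF incp xU[OF l]] by simp
  have sub: "subalg D T.AC" if D: "subalg D ?R" for D
  proof -
    note Dc = R.subalg_ring_closed[OF D]
    show ?thesis
      by (rule T.AC.subalgI) (use Dc BBc(1) in auto)
  qed
  have subS: "subalg S ?R"
  proof -
    note Sc = T.AC.subalg_ring_closed[OF subalg_S]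
    show ?thesis
      by (rule R.subalgI) (use Sc S_BB in auto)
  qed
  have "graded_skew_laurent ?R S t x G"
  proof (intro graded_skew_laurent.intro graded_skew_laurent_axioms.intro R.kalg_axioms subS)
    fix l assume l: "l \<in> {1..t}"
    show "x l \<in> Units ?R" by (rule xU[OF l])
    show "x l \<in> G (udeg l 1)" by (rule xG[OF l])
    show "inv\<^bsub>?R\<^esub> x l \<in> G (udeg l (- 1))"
      unfolding xinv[OF l] um[symmetric] by (rule G_inv[OF xG[OF l] x_Units(1)[OF l]])
    fix m assume m: "m \<in> {1..t}"
    show "x l \<otimes>\<^bsub>?R\<^esub> x m = x m \<otimes>\<^bsub>?R\<^esub> x l"
      using p_Units[OF l] p_Units[OF m] u_Units[OF l] u_Units[OF m] p_commute[OF l m] u_commute[OF l m]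
      by (simp add: T.pt_mult RP.Units_closed RM.Units_closed)
  next
    fix l a assume l: "l \<in> {1..t}" and a: "a \<in> S"
    show "x l \<otimes>\<^bsub>?R\<^esub> a \<otimes>\<^bsub>?R\<^esub> inv\<^bsub>?R\<^esub> x l \<in> S" "inv\<^bsub>?R\<^esub> x l \<otimes>\<^bsub>?R\<^esub> a \<otimes>\<^bsub>?R\<^esub> x l \<in> S"
      unfolding xinv[OF l] using conj_S[OF l a] by simp_all
  next
    fix D assume D: "subalg D ?R" "S \<subseteq> D" "\<And>l. l \<in> {1..t} \<Longrightarrow> x l \<in> D \<and> inv\<^bsub>?R\<^esub> x l \<in> D"
    have "BB \<subseteq> D" by (rule BB_minimal[OF sub[OF D(1)] D(2)]) (use D(3) xinv in metis)
    then show "carrier ?R \<subseteq> D" by simp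
  next
    fix a b d d' assume "a \<in> G d" "b \<in> G d'"
    then show "a \<otimes>\<^bsub>?R\<^esub> b \<in> G (d + d')" using G_mult by simp
  next
    fix a assume "a \<in> S" then show "a \<in> G 0" using SG by blast
  next
    fix F :: "(nat \<Rightarrow> int) set" and \<delta> z i
    assume F: "finite F" "inj_on \<delta> F" and z: "\<And>i. i \<in> F \<Longrightarrow> z i \<in> G (\<delta> i) \<and> z i \<in> carrier ?R"
      and s: "(\<Oplus>\<^bsub>?R\<^esub>i\<in>F. z i) = \<zero>\<^bsub>?R\<^esub>" and i: "i \<in> F"
    \<comment> \<open>The coaction is restricted at its source only: sums are formed in
      \<open>B\<close>, while the operators still act on families in the whole tensor
      product.\<close>
    have h': "h \<in> alg_hom ?R End" using alg_hom_comp[OF inc h] .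
    have "z i = \<zero>\<^bsub>T.AC\<^esub>"
    proof (rule T.AC.shift_direct[OF R.kalg_axioms h' F _ _ _ s i])
      fix j assume "j \<in> F"
      from z[OF this] show "z j \<in> carrier ?R" "z j \<in> carrier T.AC" "h (z j) = sh (z j) (\<delta> j)"
        by (auto simp: G_def)
    qed
    then show "z i = \<zero>\<^bsub>?R\<^esub>" by simp
  qed
  then show ?thesis by (rule that)
qed

end

theorem lemma2p7:
  fixes n :: nat and q :: "'k::field" and r c :: "nat list" and t :: nat
  assumes "n \<ge> 1" and "q \<noteq> 0" and "(r, c) \<in> RC n" and "t = length r"
  shows "\<exists>h \<eta>. (\<forall>l\<in>{1..t}. h l \<in> torus n \<times> torus n \<and> HH_acts n q r c (h l) (\<eta> l)) \<and>
           skew_laurent (RR n q r c\<lparr>carrier := B n q r c\<rparr>)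
             (tensor_sub (Rp n q r) (Rm n q c) (Bp n q r) (Bm n q c))
             t
             (\<lambda>l. RR_tensor n q r c (Y n q r (ent r l) l) (Z n q c l (ent c l)))
             \<eta>"
proof -
  interpret rc_pair n q r c t using assms(2-4) by unfold_locales
  \<comment> \<open>Conjugation in the whole tensor product, because the torus action has to be
    verified there; the skew-Laurent structure uses only its values on \<open>S\<close>.\<close>
  define \<eta> where "\<eta> l a = x l \<otimes>\<^bsub>T.AC\<^esub> a \<otimes>\<^bsub>T.AC\<^esub> inv\<^bsub>T.AC\<^esub> x l" for l a
  \<comment> \<open>Read off from \<open>p_scale\<close> and \<open>u_scale\<close>. On the first
    factor, row \<open>r_l\<close> has weight \<open>inverse q\<close> and column \<open>l\<close>
    weight \<open>q\<close>. As \<open>u_scale\<close> comes from the transposed family, the roles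
    are exchanged on the second factor: row \<open>l\<close> has weight \<open>q\<close> and column
    \<open>c_l\<close> weight \<open>inverse q\<close>.\<close>
  define h where "h l = ((\<lambda>i\<in>{1..n}. row_wt q (ent r l) i, \<lambda>j\<in>{1..n}. col_wt q l j),
    (\<lambda>i\<in>{1..n}. col_wt q l i, \<lambda>j\<in>{1..n}. row_wt q (ent c l) j))" for l
  have wt0: "row_wt q a i \<noteq> 0" "col_wt q a i \<noteq> 0" for a i
    using q by (simp_all add: row_wt_def col_wt_def)
  have ht: "h l \<in> torus n \<times> torus n" for l
    unfolding h_def torus_def using wt0 by auto
  have HH: "HH_acts n q r c (h l) (\<eta> l)" if l: "l \<in> {1..t}" for l
    unfolding HH_acts_def
  proof (rule conjI, goal_cases)
    case 1
    show ?case
      using T.AC.conj_alg_aut[OF x_Units(1)[OF l]] unfolding \<eta>_def .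
  next
    case 2
    show ?case
    proof (rule exI[of _ "\<lambda>a. p l \<otimes>\<^bsub>RP\<^esub> a \<otimes>\<^bsub>RP\<^esub> ip l"], rule exI[of _ "\<lambda>b. u l \<otimes>\<^bsub>RM\<^esub> b \<otimes>\<^bsub>RM\<^esub> iu l"],
        intro conjI ballI)
      show "\<eta> l (T.pt a b) = T.pt (p l \<otimes>\<^bsub>RP\<^esub> a \<otimes>\<^bsub>RP\<^esub> ip l) (u l \<otimes>\<^bsub>RM\<^esub> b \<otimes>\<^bsub>RM\<^esub> iu l)"
        if "a \<in> carrier RP" "b \<in> carrier RM" for a b
        unfolding \<eta>_def by (rule conj_pt(1)[OF l that])
      show "torus_acts n RP YY (fst (h l)) (\<lambda>a. p l \<otimes>\<^bsub>RP\<^esub> a \<otimes>\<^bsub>RP\<^esub> ip l)"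
        unfolding torus_acts_def
      proof (intro conjI ballI)
        show "(\<lambda>a. p l \<otimes>\<^bsub>RP\<^esub> a \<otimes>\<^bsub>RP\<^esub> ip l) \<in> alg_aut RP" by (rule RP.conj_alg_aut[OF p_Units[OF l]])
        fix i j assume i: "i \<in> {1..n}" and j: "j \<in> {1..n}"
        show "p l \<otimes>\<^bsub>RP\<^esub> YY i j \<otimes>\<^bsub>RP\<^esub> ip l = (fst (fst (h l)) i * snd (fst (h l)) j) \<odot>\<^bsub>RP\<^esub> YY i j"
          unfolding RP.conj_scale(1)[OF p_Units[OF l] YY_closed[OF i j] p_scale[OF l i j]]
          using i j by (simp add: h_def)
      qed
      show "torus_acts n RM ZZ (snd (h l)) (\<lambda>b. u l \<otimes>\<^bsub>RM\<^esub> b \<otimes>\<^bsub>RM\<^esub> iu l)"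
        unfolding torus_acts_def
      proof (intro conjI ballI)
        show "(\<lambda>b. u l \<otimes>\<^bsub>RM\<^esub> b \<otimes>\<^bsub>RM\<^esub> iu l) \<in> alg_aut RM" by (rule RM.conj_alg_aut[OF u_Units[OF l]])
        fix i j assume i: "i \<in> {1..n}" and j: "j \<in> {1..n}"
        show "u l \<otimes>\<^bsub>RM\<^esub> ZZ i j \<otimes>\<^bsub>RM\<^esub> iu l = (fst (snd (h l)) i * snd (snd (h l)) j) \<odot>\<^bsub>RM\<^esub> ZZ i j"
          \<comment> \<open>\<open>u_scale\<close> takes the column index before the row index,
            hence \<open>j\<close> precedes \<open>i\<close> here.\<close>
          unfolding RM.conj_scale(1)[OF u_Units[OF l] ZZ_closed[OF i j] u_scale[OF l j i]]
          using i j by (simp add: h_def mult.commute)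
      qed
    qed
  qed
  obtain G where "graded_skew_laurent (T.AC\<lparr>carrier := BB\<rparr>) S t x G" by (rule graded)
  then interpret gsl: graded_skew_laurent "T.AC\<lparr>carrier := BB\<rparr>" S t x G .
  have "skew_laurent (T.AC\<lparr>carrier := BB\<rparr>) S t x \<eta>"
  proof (rule gsl.skew_laurent)
    fix l a assume l: "l \<in> {1..t}"
    have inc: "alg_hom_pair (T.AC\<lparr>carrier := BB\<rparr>) T.AC (\<lambda>z. z)"
      using T.AC.subalg_ring_closed(1)[OF subalg_BB]
      by (intro alg_hom_pair.intro gsl.kalg_axioms T.AC.kalg_axioms alg_hom_pair_axioms.intro alg_homI) auto
    have "inv\<^bsub>T.AC\<lparr>carrier := BB\<rparr>\<^esub> x l = inv\<^bsub>T.AC\<^esub> x l"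
      using alg_hom_pair.hom_Units(2)[OF inc gsl.x_Units[OF l]] by simp
    then show "\<eta> l a = x l \<otimes>\<^bsub>T.AC\<lparr>carrier := BB\<rparr>\<^esub> a \<otimes>\<^bsub>T.AC\<lparr>carrier := BB\<rparr>\<^esub> inv\<^bsub>T.AC\<lparr>carrier := BB\<rparr>\<^esub> x l"
      by (simp add: \<eta>_def)
  qed
  with ht HH show ?thesis by blast
qed

end
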